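(* Let $n\in\mathbf N$ with $n\ge2$. Then, as formal power series in $z_1,w_1,\dots,z_n,w_n$, \begin{align*} &(1-z_1w_1-\dots-z_nw_n)\,F_n(z_1,w_1,\dots,z_n,w_n)=\sum_{r=2}^n\ \sum_{1\le j(1)<\dots<j(r)\le n}\\ &\quad\Big(z_{j(1)}w_{j(r)}\,\widetilde F_{j(1)+n-j(r)}(z_1,w_1,\dots,z_{j(1)-1},w_{j(1)-1},z_{j(1)},w_{j(r)},z_{j(r)+1},w_{j(r)+1},\dots,z_n,w_n)\Big)\\ &\quad\odot\bigg(\bigodot_{i=1}^{r-1}\Big(w_{j(i)}z_{j(i+1)}\,\widetilde F_{j(i+1)-j(i)}(w_{j(i)},z_{j(i)+1},w_{j(i)+1},\dots,z_{j(i+1)-1},w_{j(i+1)-1},z_{j(i+1)})\Big)\bigg), \end{align*} where $$\widetilde F_j(x_1,y_1,\dots,x_j,y_j):=\begin{cases}F_j(x_1,y_1,\dots,x_j,y_j)&\text{if }j\ge2,\\ F_1(x_1,y_1)/(x_1y_1)&\text{if }j=1.\end{cases}$$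
   Context: **The operator $T$.** $T$ is the quasi-nilpotent $\mathrm{DT}(\delta_0,1)$-operator, and $\tau$ is the unique normalized trace on the von Neumann algebra generated by $T$. It is realized as the limit in $*$-moments of strictly upper triangular random matrices with i.i.d. complex Gaussian entries: for every word $p(T^*,T)$ in $T^*$ and $T$, $$\tau(p(T^*,T))=\lim_{d\to\infty}\mathbb E\Big[\tfrac1d\operatorname{Tr}\,p(T_d^*,T_d)\Big],$$ where $T_d$ is the random $d\times d$ matrix that is zero on and below the diagonal and whose entries strictly above the diagonal are i.i.d. complex Gaussian with mean $0$ and $\mathbb E|t|^2=1/d$ (real and imaginary parts independent, each of variance $1/(2d)$). **The numbers $N$.** For $n\in\mathbf N=\{1,2,\dots\}$ and $k_1,\dots,k_n,\ell_1,\dots,\ell_n\in\mathbf N\cup\{0\}$: if $k_1+\dots+k_n\neq\ell_1+\dots+\ell_n$, put $N(k_1,\ell_1,\dots,k_n,\ell_n)=0$; if $m:=k_1+\dots+k_n=\ell_1+\dots+\ell_n$, put $$N(k_1,\ell_1,\dots,k_n,\ell_n)=(m+1)!\,\tau\big((T^* )^{k_1}T^{\ell_1}\cdots(T^* )^{k_n}T^{\ell_n}\big).$$ **Generating functions.** For $n\in\mathbf N$, $$F_n(z_1,w_1,\dots,z_n,w_n)=\sum_{\substack{k_1,\dots,k_n\ge0\\ \ell_1,\dots,\ell_n\ge0}}N(k_1,\ell_1,\dots,k_n,\ell_n)\,z_1^{k_1}w_1^{\ell_1}\cdots z_n^{k_n}w_n^{\ell_n}.$$ **The operation $\odot$.**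 For formal power series $f,g$ (in finitely many commuting variables, here the $z_i$ and $w_i$) all of whose monomials have even total degree, write $f^{(k)}$ for the homogeneous part of $f$ of degree $2k$. Then $$f\odot g=\sum_{k,\ell\ge0}\binom{k+\ell}{k}f^{(k)}g^{(\ell)}.$$ This operation is bilinear, commutative and associative; $\bigodot_{i=1}^{r-1}$ denotes the iterated $\odot$-product. Each $\widetilde F_1(x,y)$ occurs in the formula multiplied by $xy$, so that $xy\,\widetilde F_1(x,y)=F_1(x,y)$ is a genuine formal power series. *)

theory Defs
  imports
    "HOL-Probability.Probability"
    "HOL-Library.Poly_Mapping"
    "Jordan_Normal_Form.Schur_Decomposition"
begin

section \<open>Complex Hilbert spaces and von Neumann algebras\<close>

text \<open>
  A complex Hilbert space is rendered as a complete real inner product space (with the real part of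
  the inner product) on which the complex scalars act, compatibly with the real scalars and the norm.
  The norm condition makes multiplication by the imaginary unit an isometry, so that
  the complex inner product is recovered as \<open>Complex (x \<bullet> y) (x \<bullet> scaleC \<i> y)\<close>. For complex linear
  bounded operators the real adjoint \<open>adjoint\<close> is the adjoint for the complex inner product.
\<close>

locale complex_hilbert_space = vector_space scaleC
  for scaleC :: "complex \<Rightarrow> 'h::{real_inner,complete_space} \<Rightarrow> 'h" +
  assumes scaleC_of_real: "scaleC (of_real r) x = r *\<^sub>R x"
    and norm_scaleC: "norm (scaleC c x) = cmod c * norm x"
begin

definition bounded_operators :: "('h \<Rightarrow> 'h) set" where
  "bounded_operators = {A. bounded_linear A \<and> (\<forall>c x. A (scaleC c x) = scaleC c (A x))}"

definition commutant :: "('h \<Rightarrow> 'h) set \<Rightarrow> ('h \<Rightarrow> 'h) set" where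
  "commutant S = {A \<in> bounded_operators. \<forall>B\<in>S. A \<circ> B = B \<circ> A}"

definition von_neumann_generated :: "('h \<Rightarrow> 'h) \<Rightarrow> ('h \<Rightarrow> 'h) set" where
  "von_neumann_generated T = commutant (commutant {T, adjoint T})"

definition normalized_trace :: "('h \<Rightarrow> 'h) set \<Rightarrow> (('h \<Rightarrow> 'h) \<Rightarrow> complex) \<Rightarrow> bool" where
  "normalized_trace M \<tau> \<longleftrightarrow>
     (\<forall>A\<in>M. \<forall>B\<in>M. \<tau> (\<lambda>x. A x + B x) = \<tau> A + \<tau> B) \<and>
     (\<forall>A\<in>M. \<forall>c. \<tau> (\<lambda>x. scaleC c (A x)) = c * \<tau> A) \<and>
     (\<forall>A\<in>M. \<tau> (adjoint A \<circ> A) \<in> \<real>\<^sub>\<ge>\<^sub>0) \<and>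
     (\<forall>A\<in>M. \<forall>B\<in>M. \<tau> (A \<circ> B) = \<tau> (B \<circ> A)) \<and>
     \<tau> id = 1"

definition faithful :: "('h \<Rightarrow> 'h) set \<Rightarrow> (('h \<Rightarrow> 'h) \<Rightarrow> complex) \<Rightarrow> bool" where
  "faithful M \<tau> \<longleftrightarrow> (\<forall>A\<in>M. \<tau> (adjoint A \<circ> A) = 0 \<longrightarrow> A = (\<lambda>_. 0))"

end

section \<open>The random matrix model\<close>

text \<open>Complex Gaussian law with mean \<open>0\<close> and second absolute moment \<open>v\<close>; note that
  \<open>normal_density\<close> takes the standard deviation as its parameter.\<close>

definition complex_gaussian :: "real \<Rightarrow> complex measure" where
  "complex_gaussian v =
     distr (density lborel (normal_density 0 (sqrt (v / 2))) \<Otimes>\<^sub>M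
            density lborel (normal_density 0 (sqrt (v / 2))))
       borel (\<lambda>(x, y). Complex x y)"

text \<open>Joint law of the i.i.d.\ entries strictly above the diagonal (indices start at \<open>0\<close>).\<close>

definition entries_law :: "nat \<Rightarrow> (nat \<times> nat \<Rightarrow> complex) measure" where
  "entries_law d = Pi\<^sub>M {(i, j). i < j \<and> j < d} (\<lambda>_. complex_gaussian (1 / real d))"

definition strict_upper_mat :: "nat \<Rightarrow> (nat \<times> nat \<Rightarrow> complex) \<Rightarrow> complex mat" where
  "strict_upper_mat d t = mat d d (\<lambda>(i, j). if i < j then t (i, j) else 0)"

datatype letter = Plain | Star

type_synonym star_word = "letter list"

definition mat_word :: "star_word \<Rightarrow> complex mat \<Rightarrow> complex mat" where
  "mat_word p X =
     foldr (\<lambda>c Y. (case c of Plain \<Rightarrow> X | Star \<Rightarrow> mat_adjoint X) * Y) p (1\<^sub>m (dim_row X))"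

definition op_word :: "star_word \<Rightarrow> ('h::real_inner \<Rightarrow> 'h) \<Rightarrow> ('h \<Rightarrow> 'h)" where
  "op_word p T = foldr (\<lambda>c A. (case c of Plain \<Rightarrow> T | Star \<Rightarrow> adjoint T) \<circ> A) p id"

definition mat_trace :: "complex mat \<Rightarrow> complex" where
  "mat_trace X = (\<Sum>i<dim_row X. X $$ (i, i))"

definition expected_trace :: "star_word \<Rightarrow> nat \<Rightarrow> complex" where
  "expected_trace p d =
     (\<integral>t. mat_trace (mat_word p (strict_upper_mat d t)) / of_nat d \<partial>entries_law d)"

section \<open>The quasi-nilpotent DT operator\<close>

text \<open>
  The operator is specified by its \<open>*\<close>-moments. Quasi-nilpotency is not listed as a condition: the
  \<open>*\<close>-moments with respect to a faithful normal trace determine \<open>(von_neumann_generated T, \<tau>)\<close> up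
  to isomorphism, and hence also the spectrum of \<open>T\<close>. Normality need not be listed either:
  uniqueness of a faithful trace forces the algebra to be a finite factor.
\<close>

locale quasinilpotent_DT = complex_hilbert_space scaleC
  for scaleC :: "complex \<Rightarrow> 'h::{real_inner,complete_space} \<Rightarrow> 'h" +
  fixes T :: "'h \<Rightarrow> 'h" and \<tau> :: "('h \<Rightarrow> 'h) \<Rightarrow> complex"
  assumes T_bounded: "T \<in> bounded_operators"
    and trace: "normalized_trace (von_neumann_generated T) \<tau>"
    and trace_faithful: "faithful (von_neumann_generated T) \<tau>"
    and trace_unique: "normalized_trace (von_neumann_generated T) \<tau>' \<Longrightarrow>
          A \<in> von_neumann_generated T \<Longrightarrow> \<tau>' A = \<tau> A"
    and moments: "expected_trace p \<longlonglongrightarrow> \<tau> (op_word p T)"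

text \<open>The argument \<open>[(k\<^sub>1, l\<^sub>1), \<dots>, (k\<^sub>n, l\<^sub>n)]\<close> encodes the numbers \<open>k\<^sub>1, l\<^sub>1, \<dots>, k\<^sub>n, l\<^sub>n\<close>.\<close>

definition DT_N ::
    "('h::real_inner \<Rightarrow> 'h) \<Rightarrow> (('h \<Rightarrow> 'h) \<Rightarrow> complex) \<Rightarrow> (nat \<times> nat) list \<Rightarrow> complex" where
  "DT_N T \<tau> kls =
     (let m = sum_list (map fst kls) in
      if m \<noteq> sum_list (map snd kls) then 0
      else fact (m + 1) * \<tau> (foldr (\<lambda>(k, l) A. (adjoint T ^^ k) \<circ> (T ^^ l) \<circ> A) kls id))"

section \<open>Formal power series in several commuting variables\<close>

text \<open>Monomials are finitely supported exponent functions \<open>'v \<Rightarrow>\<^sub>0 nat\<close>, written additively.\<close>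

typedef ('v, 'a) mfps = "UNIV :: (('v \<Rightarrow>\<^sub>0 nat) \<Rightarrow> 'a) set"
  morphisms mcoeff Mfps
  by simp

lemma mcoeff_Mfps [simp]: "mcoeff (Mfps f) m = f m"
  by (simp add: Mfps_inverse)

lemma mfps_eqI: "(\<And>m. mcoeff f m = mcoeff g m) \<Longrightarrow> f = g"
  by (metis ext mcoeff_inject)

lemma finite_add_eq:
  fixes m :: "'v \<Rightarrow>\<^sub>0 nat"
  shows "finite {(a, b). a + b = m}"
proof -
  let ?L = "Poly_Mapping.lookup" and ?K = "Poly_Mapping.keys m"
  let ?S = "{a. \<forall>v. ?L a v \<le> ?L m v}"
  let ?F = "{f. \<forall>v. (v \<in> ?K \<longrightarrow> f v \<in> {..Max (?L m ` ?K)}) \<and> (v \<notin> ?K \<longrightarrow> f v = 0)}"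
  have "finite ?F"
    by (rule finite_set_of_finite_funs) auto
  moreover have "?L ` ?S \<subseteq> ?F"
  proof (clarsimp, intro conjI impI)
    fix a v assume *: "\<forall>v. ?L a v \<le> ?L m v"
    { assume "v \<in> ?K"
      then have "?L m v \<le> Max (?L m ` ?K)" by simp
      with * show "?L a v \<le> Max (?L m ` ?K)" using le_trans by blast }
    { assume "v \<notin> ?K"
      then have "?L m v = 0" by (simp add: in_keys_iff)
      with * show "?L a v = 0" by (metis le_zero_eq) }
  qed
  ultimately have "finite (?L ` ?S)"
    using finite_subset by blast
  moreover have "inj_on ?L ?S"
    by (simp add: inj_on_def)
  ultimately have "finite ?S" by (rule finite_imageD)
  moreover have "{(a, b). a + b = m} \<subseteq> ?S \<times> ?S"
    by (auto simp: lookup_add)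
  ultimately show ?thesis
    using finite_subset[OF _ finite_cartesian_product] by blast
qed

instantiation mfps :: (type, comm_ring_1) comm_ring_1
begin

definition zero_mfps :: "('a, 'b) mfps" where
  "0 = Mfps (\<lambda>_. 0)"

definition one_mfps :: "('a, 'b) mfps" where
  "1 = Mfps (\<lambda>m. if m = 0 then 1 else 0)"

definition plus_mfps :: "('a, 'b) mfps \<Rightarrow> ('a, 'b) mfps \<Rightarrow> ('a, 'b) mfps" where
  "f + g = Mfps (\<lambda>m. mcoeff f m + mcoeff g m)"

definition uminus_mfps :: "('a, 'b) mfps \<Rightarrow> ('a, 'b) mfps" where
  "- f = Mfps (\<lambda>m. - mcoeff f m)"

definition minus_mfps :: "('a, 'b) mfps \<Rightarrow> ('a, 'b) mfps \<Rightarrow> ('a, 'b) mfps" where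
  "f - g = Mfps (\<lambda>m. mcoeff f m - mcoeff g m)"

definition times_mfps :: "('a, 'b) mfps \<Rightarrow> ('a, 'b) mfps \<Rightarrow> ('a, 'b) mfps" where
  "f * g = Mfps (\<lambda>m. \<Sum>(a, b) | a + b = m. mcoeff f a * mcoeff g b)"

instance
proof
  fix f g h :: "('a, 'b) mfps"
  show "f + g + h = f + (g + h)" "f + g = g + f" "0 + f = f" "- f + f = 0" "f - g = f + - g"
    by (rule mfps_eqI; simp add: plus_mfps_def zero_mfps_def uminus_mfps_def minus_mfps_def)+
  show "f * g = g * f"
  proof (rule mfps_eqI)
    fix m
    show "mcoeff (f * g) m = mcoeff (g * f) m"
      unfolding times_mfps_def mcoeff_Mfps
      by (rule sum.reindex_bij_witness[where i = prod.swap and j = prod.swap])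
        (auto simp: add.commute mult.commute)
  qed
  show "(f + g) * h = f * h + g * h"
    by (rule mfps_eqI)
      (simp add: times_mfps_def plus_mfps_def distrib_right case_prod_unfold sum.distrib)
  show "1 * f = f"
  proof (rule mfps_eqI)
    fix m
    have "mcoeff (1 * f) m = (\<Sum>(a, b) | a + b = m. if a = 0 then mcoeff f b else 0)"
      unfolding times_mfps_def one_mfps_def mcoeff_Mfps
      by (rule sum.cong) auto
    also have "\<dots> = (\<Sum>(a, b) \<in> {(0 :: 'a \<Rightarrow>\<^sub>0 nat, m)}. if a = 0 then mcoeff f b else 0)"
      by (rule sum.mono_neutral_right) (auto simp: finite_add_eq split: if_splits)
    finally show "mcoeff (1 * f) m = mcoeff f m" by simp
  qed
  show "(0::('a, 'b) mfps) \<noteq> 1"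
  proof
    assume "(0::('a, 'b) mfps) = 1"
    then have "mcoeff (0::('a, 'b) mfps) 0 = mcoeff (1::('a, 'b) mfps) 0" by simp
    then show False by (simp add: zero_mfps_def one_mfps_def)
  qed
  show "f * g * h = f * (g * h)"
  proof (rule mfps_eqI)
    fix m
    let ?c = mcoeff
    have "?c (f * g * h) m =
        (\<Sum>p | fst p + snd p = m. \<Sum>q | fst q + snd q = fst p.
          ?c f (fst q) * ?c g (snd q) * ?c h (snd p))"
      by (simp add: times_mfps_def case_prod_unfold sum_distrib_right)
    also have "\<dots> = (\<Sum>(p, q) \<in> (SIGMA p:{p. fst p + snd p = m}. {q. fst q + snd q = fst p}).
        ?c f (fst q) * ?c g (snd q) * ?c h (snd p))"
      using finite_add_eq by (subst sum.Sigma) (auto simp: case_prod_unfold)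
    also have "\<dots> = (\<Sum>(p, q) \<in> (SIGMA p:{p. fst p + snd p = m}. {q. fst q + snd q = snd p}).
        ?c f (fst p) * (?c g (fst q) * ?c h (snd q)))"
      by (rule sum.reindex_bij_witness[where
            i = "\<lambda>(p, q). ((fst p + fst q, snd q), (fst p, fst q))" and
            j = "\<lambda>(p, q). ((fst q, snd q + snd p), (snd q, snd p))"])
        (auto simp: algebra_simps)
    also have "\<dots> = (\<Sum>p | fst p + snd p = m. \<Sum>q | fst q + snd q = snd p.
        ?c f (fst p) * (?c g (fst q) * ?c h (snd q)))"
      using finite_add_eq by (subst sum.Sigma) (auto simp: case_prod_unfold)
    also have "\<dots> = ?c (f * (g * h)) m"
      by (simp add: times_mfps_def case_prod_unfold sum_distrib_left)
    finally show "?c (f * g * h) m = ?c (f * (g * h)) m" .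
  qed
qed

end

definition mvar :: "'v \<Rightarrow> ('v, 'a::comm_ring_1) mfps" where
  "mvar v = Mfps (\<lambda>m. if m = Poly_Mapping.single v 1 then 1 else 0)"

definition total_degree :: "('v \<Rightarrow>\<^sub>0 nat) \<Rightarrow> nat" where
  "total_degree m = (\<Sum>v\<in>Poly_Mapping.keys m. Poly_Mapping.lookup m v)"

definition homogeneous_part :: "nat \<Rightarrow> ('v, 'a::comm_ring_1) mfps \<Rightarrow> ('v, 'a) mfps" where
  "homogeneous_part k f = Mfps (\<lambda>m. if total_degree m = 2 * k then mcoeff f m else 0)"

text \<open>The coefficient of \<open>m\<close> in \<open>homogeneous_part k f * homogeneous_part l g\<close> vanishes unless
  \<open>2 * k + 2 * l = total_degree m\<close>, so the truncated sum below is the coefficient of the full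
  infinite series. Only used for series whose monomials all have even total degree.\<close>

definition odot :: "('v, 'a::comm_ring_1) mfps \<Rightarrow> ('v, 'a) mfps \<Rightarrow> ('v, 'a) mfps"
    (infixl \<open>\<odot>\<close> 70) where
  "f \<odot> g = Mfps (\<lambda>m. \<Sum>k\<le>total_degree m. \<Sum>l\<le>total_degree m.
     of_nat ((k + l) choose k) * mcoeff (homogeneous_part k f * homogeneous_part l g) m)"

text \<open>The series \<open>1\<close> is neutral for \<open>\<odot>\<close> on series whose monomials all have even total degree.\<close>

definition odot_list :: "('v, 'a::comm_ring_1) mfps list \<Rightarrow> ('v, 'a) mfps" where
  "odot_list fs = foldr (\<odot>) fs 1"

section \<open>The generating functions\<close>

datatype var = Z nat | W nat

text \<open>The monomial \<open>x\<^sub>1\<^sup>k\<^sup>1 y\<^sub>1\<^sup>l\<^sup>1 \<cdots> x\<^sub>n\<^sup>k\<^sup>n y\<^sub>n\<^sup>l\<^sup>n\<close> for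
  \<open>xys = [(x\<^sub>1, y\<^sub>1), \<dots>, (x\<^sub>n, y\<^sub>n)]\<close> and \<open>kls = [(k\<^sub>1, l\<^sub>1), \<dots>, (k\<^sub>n, l\<^sub>n)]\<close>.\<close>

definition pair_monomial :: "('v \<times> 'v) list \<Rightarrow> (nat \<times> nat) list \<Rightarrow> ('v \<Rightarrow>\<^sub>0 nat)" where
  "pair_monomial xys kls =
     (\<Sum>((x, y), (k, l)) \<leftarrow> zip xys kls. Poly_Mapping.single x k + Poly_Mapping.single y l)"

text \<open>\<open>DT_F T \<tau> [(x\<^sub>1, y\<^sub>1), \<dots>, (x\<^sub>n, y\<^sub>n)]\<close> is the series \<open>F\<^sub>n(x\<^sub>1, y\<^sub>1, \<dots>, x\<^sub>n, y\<^sub>n)\<close> in the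
  given variables.\<close>

definition DT_F ::
    "('h::real_inner \<Rightarrow> 'h) \<Rightarrow> (('h \<Rightarrow> 'h) \<Rightarrow> complex) \<Rightarrow> ('v \<times> 'v) list \<Rightarrow> ('v, complex) mfps" where
  "DT_F T \<tau> xys = Mfps (\<lambda>m.
     \<Sum>kls | length kls = length xys \<and> pair_monomial xys kls = m. DT_N T \<tau> kls)"

text \<open>The product of \<open>x y\<close> with \<open>F\<close>-tilde at the variables \<open>xys\<close>. For a single pair, \<open>F\<close>-tilde is the
  quotient of \<open>F\<^sub>1(x, y)\<close> by \<open>x y\<close>, which is not a power series; it only occurs with \<open>xys = [(x, y)]\<close>,
  where the product is \<open>F\<^sub>1(x, y)\<close>.\<close>

definition times_F_tilde ::
    "('h::real_inner \<Rightarrow> 'h) \<Rightarrow> (('h \<Rightarrow> 'h) \<Rightarrow> complex) \<Rightarrow> 'v \<Rightarrow> 'v \<Rightarrow> ('v \<times> 'v) list \<Rightarrow>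
     ('v, complex) mfps" where
  "times_F_tilde T \<tau> x y xys =
     (if length xys = 1 then DT_F T \<tau> xys else mvar x * mvar y * DT_F T \<tau> xys)"

end

theory Submission
  imports Defs
begin

text \<open>
  The identity is a recursion for the \<open>*\<close>-moments of \<open>T\<close>, read off coefficient by coefficient. Write
  \<open>c(p)\<close> for the moment of a word \<open>p\<close>. The recursion comes from comparing the random matrices of
  sizes \<open>d\<close> and \<open>d + 1\<close>. With unnormalized entries of variance \<open>1\<close>, the matrix of size \<open>d + 1\<close> is
  the matrix \<open>S\<close> of size \<open>d\<close> bordered by an independent Gaussian column \<open>u\<close> and a zero row. Expand the
  trace of a word as a sum over closed walks on the indices. A walk which avoids the new index
  contributes to the trace for \<open>S\<close>. A walk can visit the new, largest index only between a \<open>T\<close> and a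
  \<open>T\<^sup>*\<close>, and the visits cut the word into stretches, each of which contributes a quadratic form
  \<open>u\<^sup>* A u\<close> with \<open>A\<close> a shorter word in \<open>S\<close>. Hence the trace grows by a sum, over the nonempty sets of
  visited places, of products of such quadratic forms (\<open>walk_trace_Suc\<close>).

  To leading order in \<open>d\<close> the expectation of a product of quadratic forms is obtained by replacing each
  \<open>u\<^sup>* A u\<close> by the trace of \<open>A\<close>, and expectations of products of traces factorize. For a word with \<open>m\<close>
  letters \<open>T\<close> the expected trace is asymptotically \<open>c(p) d\<^sup>m\<^sup>+\<^sup>1\<close>, so that its increment
  is asymptotically \<open>(m + 1) c(p) d\<^sup>m\<close>. This gives the recursion \<open>moment_recursion\<close>: \<open>(m + 1) c(p)\<close> is
  the sum over the nonempty sets of visited places of the products of the moments of the stretches.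
  Factorization is proved together with the recursion, by induction on the power of \<open>d\<close>
  (\<open>factorizes_all\<close>): in each increment the power of \<open>d\<close> is smaller by one.

  Expectations are handled algebraically. Polynomials in the Gaussian entries form a ring, the
  expectation is a linear functional on it, and the asymptotics rest on
  Gaussian integration by parts (\<open>expectation_gen_Star\<close>). The analytic input is the computation of the
  moments of a complex Gaussian variable, which identifies this functional with the integral
  (\<open>expected_trace_eq\<close>).

  Finally, \<open>N = (m + 1)! c\<close>. Divide each coefficient by the factorial of half the degree of its
  monomial. Then \<open>\<odot>\<close> becomes the ordinary product for series in disjoint sets of variables
  (\<open>ncoeff_odot\<close>), the coefficient of \<open>F\<^sub>n\<close> becomes \<open>(m + 1) c\<close>, and the coefficients of the factors on
  the right become the moments of the stretches (\<open>ncoeff_segment\<close>, \<open>ncoeff_outer\<close>). The sets with a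
  single visited place give the terms \<open>z\<^sub>i w\<^sub>i F\<^sub>n\<close> on the left, the sets with \<open>r \<ge> 2\<close> elements
  \<open>j(1) < \<dots> < j(r)\<close> give the sum on the right. The largest index turns \<open>T\<close> into \<open>T\<^sup>*\<close>, whereas the gaps
  inside the blocks of \<open>N\<close> turn \<open>T\<^sup>*\<close> into \<open>T\<close>; the two pictures are exchanged by reversing the order
  of the indices, which shows that moments do not change when \<open>T\<close> and \<open>T\<^sup>*\<close> are exchanged
  (\<open>star_moment_swap\<close>).
\<close>

section \<open>Wick calculus for Gaussian polynomials\<close>

text \<open>The symbol \<open>(Plain, e)\<close> stands for the matrix entry at \<open>e\<close> and \<open>(Star, e)\<close> for its complex
  conjugate; the two are independent variables of the polynomial ring, and monomials are multisets of
  symbols.\<close>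

type_synonym entry_symbol = "letter \<times> (nat \<times> nat)"
type_synonym wick_poly = "entry_symbol multiset \<Rightarrow>\<^sub>0 complex"

definition gen :: "letter \<Rightarrow> nat \<times> nat \<Rightarrow> wick_poly" where
  "gen c e = Poly_Mapping.single {#(c, e)#} 1"

text \<open>The moment of a monomial in independent standard complex Gaussian variables: a variable of this law
  satisfies \<open>E |t|\<^sup>2\<^sup>k = k!\<close>, and its mixed moments with unequal exponents vanish.\<close>

definition gauss_moment :: "entry_symbol multiset \<Rightarrow> complex" where
  "gauss_moment M =
     (if \<forall>e. count M (Plain, e) = count M (Star, e)
      then \<Prod>e\<in>snd ` set_mset M. fact (count M (Plain, e)) else 0)"

definition expectation :: "wick_poly \<Rightarrow> complex" where
  "expectation f = (\<Sum>M\<in>Poly_Mapping.keys f. Poly_Mapping.lookup f M * gauss_moment M)"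

text \<open>The Wirtinger derivative with respect to the entry at \<open>e\<close>, for which conjugates are constants.\<close>

definition deriv_plain :: "nat \<times> nat \<Rightarrow> wick_poly \<Rightarrow> wick_poly" where
  "deriv_plain e f = (\<Sum>M\<in>Poly_Mapping.keys f.
     Poly_Mapping.single (M - {#(Plain, e)#}) (Poly_Mapping.lookup f M * of_nat (count M (Plain, e))))"

text \<open>The expectation and the derivative are additive, so their identities need to be checked on
  monomials only.\<close>

lemma poly_mapping_additive_eqI:
  fixes A B :: "('a \<Rightarrow>\<^sub>0 'b::comm_monoid_add) \<Rightarrow> 'c::cancel_comm_monoid_add"
  assumes "\<And>f g. A (f + g) = A f + A g" and "\<And>f g. B (f + g) = B f + B g"
    and "\<And>k c. A (Poly_Mapping.single k c) = B (Poly_Mapping.single k c)"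
  shows "A f = B f"
proof (induction f rule: update_induct)
  case const
  show ?case using assms(3)[of _ 0] by simp
next
  case (update f a b)
  have "Poly_Mapping.update a b f = f + Poly_Mapping.single a b"
    using update by (intro poly_mapping_eqI) (auto simp: lookup_update lookup_add lookup_single when_def in_keys_iff)
  then show ?case using update assms by simp
qed

lemma expectation_add: "expectation (f + g) = expectation f + expectation g"
  unfolding expectation_def by (rule setsum_keys_plus_distrib) (auto simp: algebra_simps)

lemma expectation_single: "expectation (Poly_Mapping.single M c) = c * gauss_moment M"
  by (simp add: expectation_def)

lemma expectation_0 [simp]: "expectation 0 = 0"
  by (simp add: expectation_def)

lemma expectation_1: "expectation 1 = 1"
proof -
  have "expectation 1 = expectation (Poly_Mapping.single {#} 1)" by simp
  then show ?thesis by (simp add: expectation_def gauss_moment_def del: single_one)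
qed

lemma expectation_sum: "expectation (\<Sum>i\<in>I. f i) = (\<Sum>i\<in>I. expectation (f i))"
  by (induction I rule: infinite_finite_induct) (auto simp: expectation_add)

lemma expectation_uminus: "expectation (- f) = - expectation f"
  using expectation_add[of f "- f"] by (simp add: eq_neg_iff_add_eq_0 add.commute)

lemma expectation_diff: "expectation (f - g) = expectation f - expectation g"
  using expectation_add[of f "- g"] by (simp add: expectation_uminus)

lemma deriv_plain_add: "deriv_plain e (f + g) = deriv_plain e f + deriv_plain e g"
  unfolding deriv_plain_def
  by (rule setsum_keys_plus_distrib) (auto simp: algebra_simps single_add)

lemma deriv_plain_single:
  "deriv_plain e (Poly_Mapping.single M c) =
     Poly_Mapping.single (M - {#(Plain, e)#}) (c * of_nat (count M (Plain, e)))"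
  by (simp add: deriv_plain_def)

lemma deriv_plain_0 [simp]: "deriv_plain e 0 = 0"
  by (simp add: deriv_plain_def)

lemma deriv_plain_1 [simp]: "deriv_plain e 1 = 0"
proof -
  have "deriv_plain e 1 = deriv_plain e (Poly_Mapping.single {#} 1)" by simp
  then show ?thesis by (simp add: deriv_plain_single del: single_one)
qed

lemma deriv_plain_sum: "deriv_plain e (\<Sum>i\<in>I. f i) = (\<Sum>i\<in>I. deriv_plain e (f i))"
  by (induction I rule: infinite_finite_induct) (auto simp: deriv_plain_add)

lemma deriv_plain_gen:
  "deriv_plain e (gen c e') = (if c = Plain \<and> e' = e then 1 else 0)"
  by (auto simp: gen_def deriv_plain_single)

lemma deriv_plain_mult_single:
  "deriv_plain e (Poly_Mapping.single M a * Poly_Mapping.single N b) =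
     deriv_plain e (Poly_Mapping.single M a) * Poly_Mapping.single N b +
     Poly_Mapping.single M a * deriv_plain e (Poly_Mapping.single N b)"
proof -
  let ?x = "(Plain, e)"
  have *: "Poly_Mapping.single (M + N - {#?x#}) (a * b * of_nat (count K ?x)) =
      Poly_Mapping.single L (a * b * of_nat (count K ?x))"
    if "?x \<in># K \<Longrightarrow> M + N - {#?x#} = L" for K L
    using that by (cases "?x \<in># K") (auto simp: not_in_iff)
  have "deriv_plain e (Poly_Mapping.single M a * Poly_Mapping.single N b) =
      Poly_Mapping.single (M + N - {#?x#}) (a * b * of_nat (count M ?x)) +
      Poly_Mapping.single (M + N - {#?x#}) (a * b * of_nat (count N ?x))"
    by (simp add: mult_single deriv_plain_single single_add[symmetric] algebra_simps)
  also have "Poly_Mapping.single (M + N - {#?x#}) (a * b * of_nat (count M ?x)) =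
      Poly_Mapping.single (M - {#?x#} + N) (a * b * of_nat (count M ?x))"
    by (rule *) simp
  also have "Poly_Mapping.single (M + N - {#?x#}) (a * b * of_nat (count N ?x)) =
      Poly_Mapping.single (M + (N - {#?x#})) (a * b * of_nat (count N ?x))"
    by (rule *) simp
  finally show ?thesis
    by (simp add: mult_single deriv_plain_single algebra_simps)
qed

lemma deriv_plain_mult:
  "deriv_plain e (f * g) = deriv_plain e f * g + f * deriv_plain e g"
proof (rule poly_mapping_additive_eqI[where f = f])
  fix M a
  show "deriv_plain e (Poly_Mapping.single M a * g) =
      deriv_plain e (Poly_Mapping.single M a) * g + Poly_Mapping.single M a * deriv_plain e g"
    by (rule poly_mapping_additive_eqI[where f = g])
      (auto simp: deriv_plain_add algebra_simps deriv_plain_mult_single)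
qed (auto simp: deriv_plain_add algebra_simps)

lemma deriv_plain_prod_list:
  "deriv_plain e (prod_list fs) =
     (\<Sum>k<length fs. deriv_plain e (fs ! k) * prod_list (take k fs) * prod_list (drop (Suc k) fs))"
proof (induction fs)
  case (Cons f fs)
  then show ?case
    by (simp add: deriv_plain_mult sum.lessThan_Suc_shift sum_distrib_left algebra_simps del: sum.lessThan_Suc)
qed simp

text \<open>Removing a conjugate entry against one of the \<open>k\<close> matching entries accounts for one factor of
  \<open>k! = k (k - 1)!\<close>.\<close>

lemma gauss_moment_add_Star:
  "gauss_moment (add_mset (Star, e) M) =
     of_nat (count M (Plain, e)) * gauss_moment (M - {#(Plain, e)#})"
proof (cases "(Plain, e) \<in># M")
  case False
  then have "count (add_mset (Star, e) M) (Plain, e) \<noteq> count (add_mset (Star, e) M) (Star, e)"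
    by (simp add: not_in_iff)
  then have "gauss_moment (add_mset (Star, e) M) = 0"
    unfolding gauss_moment_def by (meson)
  then show ?thesis using False by (simp add: not_in_iff)
next
  case True
  then obtain N where M: "M = add_mset (Plain, e) N" by (metis insert_DiffM)
  let ?N = "add_mset (Star, e) (add_mset (Plain, e) N)"
  have iff: "(\<forall>e'. count ?N (Plain, e') = count ?N (Star, e')) \<longleftrightarrow>
      (\<forall>e'. count N (Plain, e') = count N (Star, e'))" by auto
  have "(\<Prod>e'\<in>snd ` set_mset ?N. fact (count ?N (Plain, e'))) =
      of_nat (Suc (count N (Plain, e))) * (\<Prod>e'\<in>snd ` set_mset N. fact (count N (Plain, e')) :: complex)"
    (is "?L = _ * ?R")
    if bal: "\<forall>e'. count N (Plain, e') = count N (Star, e')"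
  proof -
    let ?A = "snd ` set_mset N"
    have "?L = (\<Prod>e'\<in>insert e ?A. fact (count ?N (Plain, e')))"
      by (rule prod.cong) auto
    also have "\<dots> = fact (Suc (count N (Plain, e))) * (\<Prod>e'\<in>?A - {e}. fact (count ?N (Plain, e')))"
      by (subst prod.insert_remove) auto
    also have "(\<Prod>e'\<in>?A - {e}. fact (count ?N (Plain, e'))) =
        (\<Prod>e'\<in>?A - {e}. fact (count N (Plain, e')) :: complex)"
      by (rule prod.cong) auto
    also have "fact (Suc (count N (Plain, e))) * \<dots> =
        of_nat (Suc (count N (Plain, e))) * (fact (count N (Plain, e)) * \<dots>)"
      by simp
    also have "fact (count N (Plain, e)) * (\<Prod>e'\<in>?A - {e}. fact (count N (Plain, e')) :: complex) = ?R"
    proof (cases "e \<in> ?A")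
      case True
      then show ?thesis by (simp add: prod.remove)
    next
      case False
      then have "(Plain, e) \<notin># N" by force
      then have "count N (Plain, e) = 0" by (simp add: not_in_iff)
      with False show ?thesis by simp
    qed
    finally show ?thesis .
  qed
  then show ?thesis
    unfolding M gauss_moment_def by (simp add: iff cong: if_cong)
qed

text \<open>Gaussian integration by parts. Iterating it produces Wick's formula, but one application at a time
  is enough: it removes one quadratic form in the last column from a product of such forms.\<close>

lemma expectation_gen_Star: "expectation (gen Star e * f) = expectation (deriv_plain e f)"
  by (rule poly_mapping_additive_eqI[where f = f])
    (auto simp: algebra_simps expectation_add deriv_plain_add gen_def mult_single expectation_single
      deriv_plain_single gauss_moment_add_Star)

section \<open>Words in a strictly upper triangular matrix as sums over walks\<close>

text \<open>The entry \<open>(a, b)\<close> of the strictly upper triangular matrix with entries \<open>x Plain\<close>, or of its adjoint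
  with entries \<open>x Star\<close>. The values \<open>x\<close> lie in an arbitrary ring, since both formal symbols and
  complex numbers will be substituted.\<close>

definition step :: "(letter \<Rightarrow> nat \<times> nat \<Rightarrow> 'r::comm_ring_1) \<Rightarrow> letter \<Rightarrow> nat \<Rightarrow> nat \<Rightarrow> 'r" where
  "step x c a b = (case c of
      Plain \<Rightarrow> if a < b then x Plain (a, b) else 0
    | Star \<Rightarrow> if b < a then x Star (b, a) else 0)"

text \<open>The entry \<open>(a, b)\<close> of a word in the \<open>d \<times> d\<close> matrix and its adjoint. The bound \<open>d\<close> restricts the
  intermediate indices only, so that the same entries may be used for matrices of several sizes.\<close>

primrec walk :: "(letter \<Rightarrow> nat \<times> nat \<Rightarrow> 'r::comm_ring_1) \<Rightarrow> nat \<Rightarrow> star_word \<Rightarrow> nat \<Rightarrow> nat \<Rightarrow> 'r" where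
  "walk x d [] a b = (if a = b then 1 else 0)"
| "walk x d (c # p) a b = (\<Sum>i<d. step x c a i * walk x d p i b)"

definition walk_trace :: "(letter \<Rightarrow> nat \<times> nat \<Rightarrow> 'r::comm_ring_1) \<Rightarrow> nat \<Rightarrow> star_word \<Rightarrow> 'r" where
  "walk_trace x d p = (\<Sum>a<d. walk x d p a a)"

lemma walk_append:
  assumes "a < d"
  shows "walk x d (p @ q) a b = (\<Sum>i<d. walk x d p a i * walk x d q i b)"
  using assms
proof (induction p arbitrary: a)
  case Nil
  then show ?case by (simp add: if_distrib[where f = "\<lambda>y. y * _"] sum.delta cong: if_cong)
next
  case (Cons c p)
  have "walk x d ((c # p) @ q) a b = (\<Sum>j<d. \<Sum>i<d. step x c a j * walk x d p j i * walk x d q i b)"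
    by (simp add: Cons.IH sum_distrib_left mult.assoc)
  also have "\<dots> = (\<Sum>i<d. \<Sum>j<d. step x c a j * walk x d p j i * walk x d q i b)"
    by (rule sum.swap)
  finally show ?case by (simp add: sum_distrib_right)
qed

lemma walk_trace_commute: "walk_trace x d (p @ q) = walk_trace x d (q @ p)"
proof -
  have "walk_trace x d (p @ q) = (\<Sum>a<d. \<Sum>i<d. walk x d p a i * walk x d q i a)"
    unfolding walk_trace_def by (rule sum.cong) (auto simp: walk_append)
  also have "\<dots> = (\<Sum>i<d. \<Sum>a<d. walk x d q i a * walk x d p a i)"
    by (subst sum.swap) (simp add: mult.commute)
  also have "\<dots> = walk_trace x d (q @ p)"
    unfolding walk_trace_def by (rule sum.cong) (auto simp: walk_append)
  finally show ?thesis .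
qed

abbreviation upper_edges :: "nat \<Rightarrow> (nat \<times> nat) set" where
  "upper_edges d \<equiv> {(i, j). i < j \<and> j < d}"

lemma finite_upper_edges: "finite (upper_edges d)"
  by (rule finite_subset[of _ "{..<d} \<times> {..<d}"]) auto

text \<open>Regrouping a monomial entry by entry, which is the form in which independence applies.\<close>

lemma prod_symbols:
  fixes g :: "letter \<Rightarrow> 'e \<Rightarrow> 'r::comm_monoid_mult"
  assumes "finite U" and "set_mset M \<subseteq> UNIV \<times> U"
  shows "(\<Prod>(c, e)\<in>#M. g c e) =
    (\<Prod>e\<in>U. g Plain e ^ count M (Plain, e) * g Star e ^ count M (Star, e))"
  using assms(2)
proof (induction M)
  case (add x M)
  obtain c e where x: "x = (c, e)" by force
  with add have e: "e \<in> U" by auto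
  have "(\<Prod>e'\<in>U. g Plain e' ^ count (add_mset x M) (Plain, e') * g Star e' ^ count (add_mset x M) (Star, e')) =
      (\<Prod>e'\<in>U. (if e' = e then g c e else 1) *
        (g Plain e' ^ count M (Plain, e') * g Star e' ^ count M (Star, e')))"
    by (rule prod.cong; cases c) (auto simp: x ac_simps)
  also have "\<dots> = (\<Prod>e'\<in>U. if e' = e then g c e else 1) *
      (\<Prod>e'\<in>U. g Plain e' ^ count M (Plain, e') * g Star e' ^ count M (Star, e'))"
    by (rule prod.distrib)
  also have "(\<Prod>e'\<in>U. if e' = e then g c e else 1) = g c e"
    using assms(1) e by (simp add: prod.delta)
  finally show ?case using add by (simp add: x)
qed simp

text \<open>With a fixed finite set of entries the moment is a product over independent variables.\<close>

lemma gauss_moment_prod: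
  assumes "finite U" and "set_mset M \<subseteq> UNIV \<times> U"
  shows "gauss_moment M =
    (\<Prod>e\<in>U. if count M (Plain, e) = count M (Star, e) then fact (count M (Plain, e)) else 0)"
proof (cases "\<forall>e. count M (Plain, e) = count M (Star, e)")
  case True
  have "(\<Prod>e\<in>snd ` set_mset M. fact (count M (Plain, e)) :: complex) = (\<Prod>e\<in>U. fact (count M (Plain, e)))"
  proof (rule prod.mono_neutral_left)
    show "\<forall>e\<in>U - snd ` set_mset M. fact (count M (Plain, e)) = (1 :: complex)"
    proof
      fix e assume "e \<in> U - snd ` set_mset M"
      then have "(Plain, e) \<notin># M" by force
      then have "count M (Plain, e) = 0" by (simp add: not_in_iff)
      then show "fact (count M (Plain, e)) = (1 :: complex)" by simp
    qed
  qed (use assms in auto)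
  also have "\<dots> = (\<Prod>e\<in>U. if count M (Plain, e) = count M (Star, e) then fact (count M (Plain, e)) else 0)"
    by (rule prod.cong) (use True in auto)
  finally show ?thesis unfolding gauss_moment_def if_P[OF True] .
next
  case False
  then obtain e where e: "count M (Plain, e) \<noteq> count M (Star, e)" by blast
  have "e \<in> U"
  proof (rule ccontr)
    assume "e \<notin> U"
    then have "(c, e) \<notin># M" for c using assms by auto
    then have "count M (c, e) = 0" for c by (simp add: not_in_iff)
    with e show False by simp
  qed
  then have "(\<Prod>e\<in>U. if count M (Plain, e) = count M (Star, e) then fact (count M (Plain, e)) else 0) = (0::complex)"
    using e assms(1) by (intro prod_zero) auto
  then show ?thesis using False unfolding gauss_moment_def by presburger
qed

text \<open>In a monomial with nonzero moment each entry occurs as often as its conjugate; summation over the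
  entries gives equal totals.\<close>

lemma gauss_moment_eq_0:
  assumes "size {#x \<in># M. fst x = Plain#} \<noteq> size {#x \<in># M. fst x = Star#}"
  shows "gauss_moment M = 0"
proof -
  have count: "count (image_mset snd {#x \<in># M. fst x = c#}) e = count M (c, e)" for c e
    by (induction M) auto
  have "\<not> (\<forall>e. count M (Plain, e) = count M (Star, e))"
  proof
    assume "\<forall>e. count M (Plain, e) = count M (Star, e)"
    then have "image_mset snd {#x \<in># M. fst x = Plain#} = image_mset snd {#x \<in># M. fst x = Star#}"
      by (intro multiset_eqI) (metis count)
    then have "size (image_mset snd {#x \<in># M. fst x = Plain#}) = size (image_mset snd {#x \<in># M. fst x = Star#})"
      by simp
    with assms show False by simp
  qed
  then show ?thesis unfolding gauss_moment_def by presburger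
qed

lemma single_mult_step:
  "Poly_Mapping.single M 1 * step gen c a i =
    (case c of
      Plain \<Rightarrow> if a < i then Poly_Mapping.single (add_mset (Plain, (a, i)) M) 1 else 0
    | Star \<Rightarrow> if i < a then Poly_Mapping.single (add_mset (Star, (i, a)) M) 1 else 0)"
  by (auto simp: step_def gen_def mult_single split: letter.splits)

lemma single_mult_walk_Cons:
  "Poly_Mapping.single M 1 * walk gen d (c # p) a b =
    (\<Sum>i<d. (Poly_Mapping.single M 1 * step gen c a i) * walk gen d p i b)"
  by (simp add: sum_distrib_left mult.assoc)

text \<open>Carrying the symbols collected so far in the monomial \<open>M\<close> turns a statement about words into one
  about single monomials.\<close>

lemma expectation_walk_unbalanced:
  assumes "size {#x \<in># M. fst x = Plain#} + count_list p Plain \<noteq>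
    size {#x \<in># M. fst x = Star#} + count_list p Star"
  shows "expectation (Poly_Mapping.single M 1 * walk gen d p a b) = 0"
  using assms
proof (induction p arbitrary: M a)
  case Nil
  then show ?case by (simp add: expectation_single gauss_moment_eq_0)
next
  case (Cons c p)
  show ?case
    unfolding single_mult_walk_Cons single_mult_step expectation_sum
    using Cons.prems by (intro sum.neutral ballI) (cases c; auto intro!: Cons.IH)
qed

lemma expectation_walk_trace_unbalanced:
  assumes "count_list p Plain \<noteq> count_list p Star"
  shows "expectation (walk_trace gen d p) = 0"
proof -
  have "expectation (walk gen d p a a) = 0" for a
    using expectation_walk_unbalanced[of "{#}" p d a a] assms by simp
  then show ?thesis by (simp add: walk_trace_def expectation_sum)
qed

fun swap_letter :: "letter \<Rightarrow> letter" where
  "swap_letter Plain = Star"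
| "swap_letter Star = Plain"

text \<open>Reversing the order of the indices maps an upper triangular matrix to a lower triangular one;
  combined with the adjoint it preserves the random matrix model and exchanges \<open>T\<close> with \<open>T\<^sup>*\<close>.\<close>

definition reverse_symbol :: "nat \<Rightarrow> entry_symbol \<Rightarrow> entry_symbol" where
  "reverse_symbol d = (\<lambda>(c, (i, j)). (swap_letter c, (d - Suc j, d - Suc i)))"

lemma count_reverse_symbol:
  assumes "set_mset M \<subseteq> UNIV \<times> upper_edges d" and "i < j" and "j < d"
  shows "count (image_mset (reverse_symbol d) M) (c, (i, j)) =
    count M (swap_letter c, (d - Suc j, d - Suc i))"
  using assms(1)
proof (induction M)
  case (add x M)
  obtain c' i' j' where x: "x = (c', (i', j'))" by (metis surj_pair)
  with add.prems have "i' < j'" "j' < d" by auto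
  then have "(reverse_symbol d x = (c, (i, j))) \<longleftrightarrow> (x = (swap_letter c, (d - Suc j, d - Suc i)))"
    using assms(2,3) by (cases c; cases c') (auto simp: x reverse_symbol_def)
  then show ?case using add by auto
qed simp

lemma gauss_moment_reverse:
  assumes "set_mset M \<subseteq> UNIV \<times> upper_edges d"
  shows "gauss_moment (image_mset (reverse_symbol d) M) = gauss_moment M"
proof -
  let ?r = "\<lambda>(i, j). (d - Suc j, d - Suc i)"
  have sub: "set_mset (image_mset (reverse_symbol d) M) \<subseteq> UNIV \<times> upper_edges d"
    using assms by (auto simp: reverse_symbol_def)
  show ?thesis
    unfolding gauss_moment_prod[OF finite_upper_edges assms] gauss_moment_prod[OF finite_upper_edges sub]
    by (rule prod.reindex_bij_witness[where i = ?r and j = ?r])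
      (auto simp: count_reverse_symbol[OF assms])
qed

lemma expectation_walk_reverse:
  assumes "set_mset M \<subseteq> UNIV \<times> upper_edges d" and "a < d" and "b < d"
  shows "expectation (Poly_Mapping.single (image_mset (reverse_symbol d) M) 1 *
      walk gen d (map swap_letter p) (d - Suc a) (d - Suc b)) =
    expectation (Poly_Mapping.single M 1 * walk gen d p a b)"
  using assms
proof (induction p arbitrary: M a)
  case Nil
  then have "d - Suc a = d - Suc b \<longleftrightarrow> a = b" by auto
  with Nil show ?case by (simp add: expectation_single gauss_moment_reverse)
next
  case (Cons c p)
  let ?rM = "image_mset (reverse_symbol d) M"
  have "expectation ((Poly_Mapping.single ?rM 1 * step gen (swap_letter c) (d - Suc a) (d - Suc i)) *
        walk gen d (map swap_letter p) (d - Suc i) (d - Suc b)) =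
      expectation ((Poly_Mapping.single M 1 * step gen c a i) * walk gen d p i b)" if i: "i < d" for i
  proof (cases c)
    case Plain
    show ?thesis
    proof (cases "a < i")
      case True
      then show ?thesis
        using Cons.IH[of "add_mset (Plain, (a, i)) M" i] Cons.prems i
        by (simp add: single_mult_step Plain reverse_symbol_def diff_less_mono2)
    next
      case False
      then show ?thesis using Cons.prems i by (simp add: single_mult_step Plain)
    qed
  next
    case Star
    show ?thesis
    proof (cases "i < a")
      case True
      then show ?thesis
        using Cons.IH[of "add_mset (Star, (i, a)) M" i] Cons.prems i
        by (simp add: single_mult_step Star reverse_symbol_def diff_less_mono2)
    next
      case False
      then show ?thesis using Cons.prems i by (simp add: single_mult_step Star)
    qed
  qed
  then have "(\<Sum>i<d. expectation ((Poly_Mapping.single ?rM 1 * step gen (swap_letter c) (d - Suc a) (d - Suc i)) *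
        walk gen d (map swap_letter p) (d - Suc i) (d - Suc b))) =
     (\<Sum>i<d. expectation ((Poly_Mapping.single M 1 * step gen c a i) * walk gen d p i b))"
    by (intro sum.cong) auto
  then show ?case
    unfolding list.map single_mult_walk_Cons expectation_sum
    by (subst (asm) sum.nat_diff_reindex)
qed

text \<open>Reversal of the indices is a bijection between the closed walks for a word and those for the word
  with \<open>T\<close> and \<open>T\<^sup>*\<close> exchanged, and it permutes the independent entries.\<close>

lemma expectation_walk_trace_swap:
  "expectation (walk_trace gen d (map swap_letter p)) = expectation (walk_trace gen d p)"
proof -
  have "(\<Sum>a<d. expectation (walk gen d (map swap_letter p) (d - Suc a) (d - Suc a))) =
      (\<Sum>a<d. expectation (walk gen d p a a))"
    using expectation_walk_reverse[of "{#}"] by (intro sum.cong) auto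
  then show ?thesis
    unfolding walk_trace_def expectation_sum
    by (subst (asm) sum.nat_diff_reindex)
qed

section \<open>Moments of the complex Gaussian law\<close>

abbreviation centered_normal :: "real \<Rightarrow> real measure" where
  "centered_normal \<sigma> \<equiv> density lborel (normal_density 0 \<sigma>)"

lemma integrable_power_centered_normal:
  assumes "\<sigma> > 0"
  shows "integrable (centered_normal \<sigma>) (\<lambda>x. complex_of_real x ^ k)"
proof -
  have "integrable (centered_normal \<sigma>) (\<lambda>x. x ^ k)"
    using integrable_normal_moment[OF assms, of 0 k]
    by (subst integrable_density) (auto simp: normal_density_nonneg)
  then have "integrable (centered_normal \<sigma>) (\<lambda>x. complex_of_real (x ^ k))"
    by (rule integrable_of_real)
  then show ?thesis by simp
qed

text \<open>Stein's identity for monomials, read off from the known moments.\<close>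

lemma centered_normal_moment_Suc:
  assumes \<sigma>: "\<sigma> > 0"
  shows "(\<integral>x. x ^ Suc k \<partial>centered_normal \<sigma>) = \<sigma>\<^sup>2 * real k * (\<integral>x. x ^ (k - 1) \<partial>centered_normal \<sigma>)"
proof -
  have mom: "(\<integral>x. x ^ n \<partial>centered_normal \<sigma>) = (\<integral>x. normal_density 0 \<sigma> x * (x - 0) ^ n \<partial>lborel)" for n
    by (subst integral_density) (auto simp: normal_density_nonneg)
  show ?thesis
  proof (cases "even k")
    case True
    then obtain j where k: "k = 2 * j" by blast
    have "(\<integral>x. x ^ Suc k \<partial>centered_normal \<sigma>) = 0"
      using integral_normal_moment_odd[OF \<sigma>, of 0 j] unfolding mom k by simp
    moreover have "real k * (\<integral>x. x ^ (k - 1) \<partial>centered_normal \<sigma>) = 0"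
    proof (cases j)
      case (Suc i)
      then have "k - 1 = 2 * i + 1" using k by simp
      then show ?thesis
        using integral_normal_moment_odd[OF \<sigma>, of 0 i] unfolding mom by simp
    qed (simp add: k)
    ultimately show ?thesis by simp
  next
    case False
    then obtain j where k: "k = 2 * j + 1" by (auto elim: oddE)
    then have "Suc k = 2 * Suc j" and "k - 1 = 2 * j" by auto
    then have "(\<integral>x. x ^ Suc k \<partial>centered_normal \<sigma>) = fact (2 * Suc j) / ((2 / \<sigma>\<^sup>2) ^ Suc j * fact (Suc j))"
      and "(\<integral>x. x ^ (k - 1) \<partial>centered_normal \<sigma>) = fact (2 * j) / ((2 / \<sigma>\<^sup>2) ^ j * fact j)"
      using integral_normal_moment_even[OF \<sigma>, of 0] unfolding mom by metis+
    moreover have "fact (2 * Suc j) = 2 * real (Suc j) * real k * (fact (2 * j) :: real)"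
      by (simp add: k algebra_simps)
    moreover have "(2 / \<sigma>\<^sup>2) ^ Suc j * fact (Suc j) = 2 / \<sigma>\<^sup>2 * real (Suc j) * ((2 / \<sigma>\<^sup>2) ^ j * fact j)"
      by simp
    moreover have "2 * real (Suc j) * real k * F / (2 / \<sigma>\<^sup>2 * real (Suc j) * c) = \<sigma>\<^sup>2 * real k * (F / c)" for F c
      using \<sigma> by (simp add: divide_simps del: of_nat_Suc)
    ultimately show ?thesis by (simp only:)
  qed
qed

text \<open>Stein's identity \<open>E[x P(x)] = \<sigma>\<^sup>2 E[P'(x)]\<close>; by linearity it suffices to know it for monomials.\<close>

lemma stein_poly:
  assumes \<sigma>: "\<sigma> > 0"
  shows "(\<integral>x. complex_of_real x * poly P (complex_of_real x) \<partial>centered_normal \<sigma>) =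
    of_real (\<sigma>\<^sup>2) * (\<integral>x. poly (pderiv P) (complex_of_real x) \<partial>centered_normal \<sigma>)"
proof -
  let ?N = "centered_normal \<sigma>"
  have mom: "(\<integral>x. complex_of_real x ^ k \<partial>?N) = of_real (\<integral>x. x ^ k \<partial>?N)" for k
    by (simp flip: of_real_power)
  have int: "integrable ?N (\<lambda>x. c * complex_of_real x ^ k)" for c k
    by (intro integrable_mult_right integrable_power_centered_normal assms)
  have "pderiv P = (\<Sum>i\<le>degree P. monom (of_nat i * coeff P i) (i - 1))"
    by (subst (1) poly_as_sum_of_monoms[symmetric], subst pderiv_sum) (simp add: pderiv_monom)
  then have peq: "(\<Sum>i\<le>degree P. of_nat i * coeff P i * complex_of_real x ^ (i - 1)) =
      poly (pderiv P) (complex_of_real x)" for x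
    by (simp add: poly_sum poly_monom)
  have "(\<integral>x. complex_of_real x * poly P (complex_of_real x) \<partial>?N) =
      (\<integral>x. (\<Sum>i\<le>degree P. coeff P i * complex_of_real x ^ Suc i) \<partial>?N)"
    by (simp add: poly_altdef sum_distrib_left ac_simps)
  also have "\<dots> = (\<Sum>i\<le>degree P. coeff P i * of_real (\<integral>x. x ^ Suc i \<partial>?N))"
    by (subst Bochner_Integration.integral_sum, rule int) (simp only: integral_mult_right_zero mom)
  also have "\<dots> = (\<Sum>i\<le>degree P. of_real (\<sigma>\<^sup>2) * (of_nat i * coeff P i * of_real (\<integral>x. x ^ (i - 1) \<partial>?N)))"
    by (intro sum.cong refl, subst centered_normal_moment_Suc[OF \<sigma>]) simp
  also have "\<dots> = of_real (\<sigma>\<^sup>2) * (\<integral>x. (\<Sum>i\<le>degree P. of_nat i * coeff P i * complex_of_real x ^ (i - 1)) \<partial>?N)"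
    by (subst Bochner_Integration.integral_sum, rule int)
      (simp only: integral_mult_right_zero mom sum_distrib_left mult.assoc)
  finally show ?thesis by (simp only: peq)
qed

abbreviation normal_pair :: "real \<Rightarrow> (real \<times> real) measure" where
  "normal_pair \<sigma> \<equiv> centered_normal \<sigma> \<Otimes>\<^sub>M centered_normal \<sigma>"

definition zpow :: "nat \<Rightarrow> nat \<Rightarrow> complex \<Rightarrow> complex" where
  "zpow a b z = z ^ a * cnj z ^ b"

lemma zpow_Suc_left:
  "zpow (Suc a) b (Complex x y) =
     complex_of_real x * zpow a b (Complex x y) + \<i> * (complex_of_real y * zpow a b (Complex x y))"
proof -
  have "zpow (Suc a) b z = z * zpow a b z" for z by (simp add: zpow_def)
  from this[of "Complex x y"] show ?thesis
    by (subst (asm) (2) Complex_eq) (simp add: algebra_simps)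
qed

lemma zpow_Suc_right:
  "zpow a (Suc b) (Complex x y) =
     complex_of_real x * zpow a b (Complex x y) - \<i> * (complex_of_real y * zpow a b (Complex x y))"
proof -
  have "zpow a (Suc b) (Complex x y) = cnj (Complex x y) * zpow a b (Complex x y)"
    by (simp add: zpow_def)
  also have "cnj (Complex x y) = complex_of_real x - \<i> * complex_of_real y"
    by (simp add: complex_eq_iff)
  finally show ?thesis by (simp only: left_diff_distrib mult.assoc)
qed

text \<open>The additional powers of the two coordinates make the induction work: a factor \<open>z\<close> or its conjugate
  is split into the coordinates \<open>x\<close> and \<open>y\<close>.\<close>

lemma integrable_zpow_aux:
  assumes \<sigma>: "\<sigma> > 0"
  shows "integrable (normal_pair \<sigma>)
    (\<lambda>p. complex_of_real (fst p) ^ i * complex_of_real (snd p) ^ j * zpow a b (Complex (fst p) (snd p)))"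
proof (induction a arbitrary: i j)
  case 0
  show ?case
  proof (induction b arbitrary: i j)
    case 0
    interpret prob_space "centered_normal \<sigma>" by (rule prob_space_normal_density[OF \<sigma>])
    interpret pair_sigma_finite "centered_normal \<sigma>" "centered_normal \<sigma>" ..
    have int: "integrable (centered_normal \<sigma>) (\<lambda>x. norm (complex_of_real x ^ k))" for k
      by (intro integrable_norm integrable_power_centered_normal \<sigma>)
    have "integrable (normal_pair \<sigma>) (\<lambda>p. complex_of_real (fst p) ^ i * complex_of_real (snd p) ^ j)"
    proof (rule Fubini_integrable)
      show "integrable (centered_normal \<sigma>) (\<lambda>x. \<integral>y. norm (complex_of_real (fst (x, y)) ^ i * complex_of_real (snd (x, y)) ^ j) \<partial>centered_normal \<sigma>)"
        using int by (simp add: norm_mult)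
      show "AE x in centered_normal \<sigma>. integrable (centered_normal \<sigma>) (\<lambda>y. complex_of_real (fst (x, y)) ^ i * complex_of_real (snd (x, y)) ^ j)"
        by (intro AE_I2) (auto intro!: integrable_mult_right integrable_power_centered_normal \<sigma>)
    qed measurable
    then show ?case by (simp add: zpow_def)
  next
    case (Suc b)
    have "integrable (normal_pair \<sigma>) (\<lambda>p.
        complex_of_real (fst p) ^ Suc i * complex_of_real (snd p) ^ j * zpow 0 b (Complex (fst p) (snd p)) -
        \<i> * (complex_of_real (fst p) ^ i * complex_of_real (snd p) ^ Suc j * zpow 0 b (Complex (fst p) (snd p))))"
      by (intro Bochner_Integration.integrable_diff integrable_mult_right Suc.IH)
    then show ?case
      by (simp add: zpow_Suc_right algebra_simps)
  qed
next
  case (Suc a)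
  have "integrable (normal_pair \<sigma>) (\<lambda>p.
      complex_of_real (fst p) ^ Suc i * complex_of_real (snd p) ^ j * zpow a b (Complex (fst p) (snd p)) +
      \<i> * (complex_of_real (fst p) ^ i * complex_of_real (snd p) ^ Suc j * zpow a b (Complex (fst p) (snd p))))"
    by (intro Bochner_Integration.integrable_add integrable_mult_right Suc.IH)
  then show ?case
    by (simp add: zpow_Suc_left algebra_simps)
qed

text \<open>Stein's identity in one coordinate while the other one is kept fixed: \<open>z\<^sup>a\<close> times a power of the
  conjugate is a polynomial in each coordinate.\<close>

lemma stein_zpow:
  assumes \<sigma>: "\<sigma> > 0"
  defines "I \<equiv> \<lambda>a b. \<integral>p. zpow a b (Complex (fst p) (snd p)) \<partial>normal_pair \<sigma>"
  shows "(\<integral>p. complex_of_real (fst p) * zpow a b (Complex (fst p) (snd p)) \<partial>normal_pair \<sigma>) =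
      of_real (\<sigma>\<^sup>2) * (of_nat a * I (a - 1) b + of_nat b * I a (b - 1))" (is "?X")
    and "(\<integral>p. complex_of_real (snd p) * zpow a b (Complex (fst p) (snd p)) \<partial>normal_pair \<sigma>) =
      of_real (\<sigma>\<^sup>2) * (\<i> * of_nat a * I (a - 1) b - \<i> * of_nat b * I a (b - 1))" (is "?Y")
proof -
  let ?N = "centered_normal \<sigma>"
  interpret prob_space ?N by (rule prob_space_normal_density[OF \<sigma>])
  interpret pair_sigma_finite ?N ?N ..
  have int: "integrable (normal_pair \<sigma>) (\<lambda>p. zpow a b (Complex (fst p) (snd p)))" for a b
    using integrable_zpow_aux[OF \<sigma>, of 0 0 a b] by simp
  have intx: "integrable (normal_pair \<sigma>) (\<lambda>p. complex_of_real (fst p) * zpow a b (Complex (fst p) (snd p)))"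
    using integrable_zpow_aux[OF \<sigma>, of 1 0 a b] by simp
  have inty: "integrable (normal_pair \<sigma>) (\<lambda>p. complex_of_real (snd p) * zpow a b (Complex (fst p) (snd p)))"
    using integrable_zpow_aux[OF \<sigma>, of 0 1 a b] by simp
  let ?D = "\<lambda>u v p. u * of_nat a * zpow (a - 1) b (Complex (fst p) (snd p)) + v * of_nat b * zpow a (b - 1) (Complex (fst p) (snd p))"
  have intD: "integrable (normal_pair \<sigma>) (?D u v)" for u v
    by (intro Bochner_Integration.integrable_add integrable_mult_right int)
  have ID: "(\<integral>p. ?D u v p \<partial>normal_pair \<sigma>) = u * of_nat a * I (a - 1) b + v * of_nat b * I a (b - 1)" for u v
    unfolding I_def by (subst Bochner_Integration.integral_add) (auto intro!: integrable_mult_right int)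
  have px: "zpow a b (Complex x y) = poly ([:\<i> * of_real y, 1:] ^ a * [:- \<i> * of_real y, 1:] ^ b) (of_real x)" for a b x y
    by (simp add: zpow_def Complex_eq complex_cnj_complex_of_real add.commute)
  have py: "zpow a b (Complex x y) = poly ([:of_real x, \<i>:] ^ a * [:of_real x, - \<i>:] ^ b) (of_real y)" for a b x y
    by (simp add: zpow_def Complex_eq mult.commute)
  have dx: "poly (pderiv ([:\<i> * of_real y, 1:] ^ a * [:- \<i> * of_real y, 1:] ^ b)) (of_real x) = ?D 1 1 (x, y)" for x y
    by (simp add: px pderiv_mult pderiv_power pderiv_pCons algebra_simps)
  have dy: "poly (pderiv ([:of_real x, \<i>:] ^ a * [:of_real x, - \<i>:] ^ b)) (of_real y) = ?D \<i> (- \<i>) (x, y)" for x y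
    by (simp add: py pderiv_mult pderiv_power pderiv_pCons algebra_simps)
  have "(\<integral>p. complex_of_real (fst p) * zpow a b (Complex (fst p) (snd p)) \<partial>normal_pair \<sigma>) =
      (\<integral>y. \<integral>x. complex_of_real x * zpow a b (Complex x y) \<partial>?N \<partial>?N)"
    using integral_snd[of "\<lambda>x y. complex_of_real x * zpow a b (Complex x y)"] intx
    by (simp add: case_prod_unfold)
  also have "\<dots> = (\<integral>y. of_real (\<sigma>\<^sup>2) * (\<integral>x. ?D 1 1 (x, y) \<partial>?N) \<partial>?N)"
    unfolding px stein_poly[OF \<sigma>] dx by (simp add: px)
  also have "\<dots> = of_real (\<sigma>\<^sup>2) * (\<integral>y. \<integral>x. ?D 1 1 (x, y) \<partial>?N \<partial>?N)"
    by simp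
  also have "(\<integral>y. \<integral>x. ?D 1 1 (x, y) \<partial>?N \<partial>?N) = (\<integral>p. ?D 1 1 p \<partial>normal_pair \<sigma>)"
    using integral_snd[of "\<lambda>x y. ?D 1 1 (x, y)"] intD[of 1 1]
    by (simp add: case_prod_unfold)
  finally show ?X by (simp only: ID) simp
  have "(\<integral>p. complex_of_real (snd p) * zpow a b (Complex (fst p) (snd p)) \<partial>normal_pair \<sigma>) =
      (\<integral>x. \<integral>y. complex_of_real y * zpow a b (Complex x y) \<partial>?N \<partial>?N)"
    using integral_fst[of "\<lambda>x y. complex_of_real y * zpow a b (Complex x y)"] inty
    by (simp add: case_prod_unfold)
  also have "\<dots> = (\<integral>x. of_real (\<sigma>\<^sup>2) * (\<integral>y. ?D \<i> (- \<i>) (x, y) \<partial>?N) \<partial>?N)"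
    unfolding py stein_poly[OF \<sigma>] dy by (simp add: py)
  also have "\<dots> = of_real (\<sigma>\<^sup>2) * (\<integral>x. \<integral>y. ?D \<i> (- \<i>) (x, y) \<partial>?N \<partial>?N)"
    by simp
  also have "(\<integral>x. \<integral>y. ?D \<i> (- \<i>) (x, y) \<partial>?N \<partial>?N) = (\<integral>p. ?D \<i> (- \<i>) p \<partial>normal_pair \<sigma>)"
    using integral_fst[of "\<lambda>x y. ?D \<i> (- \<i>) (x, y)"] intD[of \<i> "- \<i>"]
    by (simp add: case_prod_unfold)
  finally show ?Y by (simp only: ID) simp
qed

lemma zpow_measurable [measurable]: "zpow a b \<in> borel_measurable borel"
  unfolding zpow_def by (intro borel_measurable_continuous_onI continuous_intros)

lemma Complex_measurable: "(\<lambda>p. Complex (fst p) (snd p)) \<in> normal_pair \<sigma> \<rightarrow>\<^sub>M borel"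
  unfolding Complex_eq by measurable

text \<open>Apply Stein's identity to the factor \<open>x - \<i> y\<close>. The combination \<open>\<partial>\<^sub>x - \<i> \<partial>\<^sub>y\<close> is
  twice the Wirtinger derivative in \<open>z\<close>, so conjugates are constants, and the moments satisfy
  \<open>I(a, b + 1) = v a I(a - 1, b)\<close>.\<close>

lemma complex_gaussian_moment:
  assumes v: "v > 0"
  shows "integrable (complex_gaussian v) (zpow a b)"
    and "(\<integral>z. zpow a b z \<partial>complex_gaussian v) = (if a = b then fact a * of_real v ^ a else 0)"
proof -
  define \<sigma> where "\<sigma> = sqrt (v / 2)"
  have \<sigma>: "\<sigma> > 0" and \<sigma>2: "2 * \<sigma>\<^sup>2 = v" using v by (auto simp: \<sigma>_def)
  have cg: "complex_gaussian v = distr (normal_pair \<sigma>) borel (\<lambda>p. Complex (fst p) (snd p))"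
    by (simp add: complex_gaussian_def \<sigma>_def case_prod_unfold)
  have int: "integrable (normal_pair \<sigma>) (\<lambda>p. zpow a b (Complex (fst p) (snd p)))" for a b
    using integrable_zpow_aux[OF \<sigma>, of 0 0 a b] by simp
  show "integrable (complex_gaussian v) (zpow a b)"
    unfolding cg by (subst integrable_distr_eq[OF Complex_measurable]) (auto intro: int)
  define I where "I = (\<lambda>a b. \<integral>p. zpow a b (Complex (fst p) (snd p)) \<partial>normal_pair \<sigma>)"
  have rec: "I a (Suc b) = of_real v * of_nat a * I (a - 1) b" for a b
  proof -
    have intx: "integrable (normal_pair \<sigma>) (\<lambda>p. complex_of_real (fst p) * zpow a b (Complex (fst p) (snd p)))"
      using integrable_zpow_aux[OF \<sigma>, of 1 0 a b] by simp
    have inty: "integrable (normal_pair \<sigma>) (\<lambda>p. complex_of_real (snd p) * zpow a b (Complex (fst p) (snd p)))"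
      using integrable_zpow_aux[OF \<sigma>, of 0 1 a b] by simp
    have "I a (Suc b) = (\<integral>p. complex_of_real (fst p) * zpow a b (Complex (fst p) (snd p)) -
        \<i> * (complex_of_real (snd p) * zpow a b (Complex (fst p) (snd p))) \<partial>normal_pair \<sigma>)"
      unfolding I_def by (intro Bochner_Integration.integral_cong) (auto simp: zpow_Suc_right)
    also have "\<dots> = of_real (2 * \<sigma>\<^sup>2) * of_nat a * I (a - 1) b"
      using intx inty
      by (subst Bochner_Integration.integral_diff) (auto simp: stein_zpow[OF \<sigma>] I_def algebra_simps)
    finally show ?thesis by (simp only: \<sigma>2)
  qed
  interpret N: prob_space "centered_normal \<sigma>" by (rule prob_space_normal_density[OF \<sigma>])
  interpret P: pair_prob_space "centered_normal \<sigma>" "centered_normal \<sigma>" ..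
  have cnj: "I b a = cnj (I a b)" for a b
    unfolding I_def by (subst Bochner_Integration.integral_cnj[symmetric]) (simp add: zpow_def mult.commute)
  have "I a b = (if a = b then fact a * of_real v ^ a else 0)"
  proof (induction b arbitrary: a)
    case 0
    show ?case
    proof (cases a)
      case 0
      then show ?thesis using P.prob_space by (simp add: I_def zpow_def)
    next
      case (Suc a')
      have "I 0 (Suc a') = 0" using rec[of 0 a'] by simp
      then show ?thesis using cnj[of "Suc a'" 0] Suc by simp
    qed
  next
    case (Suc b)
    show ?case
      using Suc.IH[of "a - 1"] by (cases a) (auto simp: rec)
  qed
  then show "(\<integral>z. zpow a b z \<partial>complex_gaussian v) = (if a = b then fact a * of_real v ^ a else 0)"
    unfolding cg I_def by (subst integral_distr[OF Complex_measurable]) auto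
qed

section \<open>Expected traces as formal expectations\<close>

definition entry_value :: "(nat \<times> nat \<Rightarrow> complex) \<Rightarrow> letter \<Rightarrow> nat \<times> nat \<Rightarrow> complex" where
  "entry_value t c e = (case c of Plain \<Rightarrow> t e | Star \<Rightarrow> cnj (t e))"

text \<open>By independence the moment is a product over the entries, and each symbol contributes one factor
  \<open>1 / sqrt d\<close>.\<close>

lemma entries_law_moment:
  assumes d: "d > 0" and M: "set_mset M \<subseteq> UNIV \<times> upper_edges d"
  shows "integrable (entries_law d) (\<lambda>t. \<Prod>(c, e)\<in>#M. entry_value t c e)" (is ?A)
    and "(\<integral>t. (\<Prod>(c, e)\<in>#M. entry_value t c e) \<partial>entries_law d) =
      of_real (sqrt (1 / d)) ^ size M * gauss_moment M" (is ?B)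
proof -
  let ?U = "upper_edges d" and ?G = "complex_gaussian (1 / real d)"
  let ?s = "complex_of_real (sqrt (1 / d))"
  have v: "1 / real d > 0" using d by simp
  let ?f = "\<lambda>e. zpow (count M (Plain, e)) (count M (Star, e))"
  have eq: "(\<Prod>(c, e)\<in>#M. entry_value t c e) = (\<Prod>e\<in>?U. ?f e (t e))" for t
    by (subst prod_symbols[OF finite_upper_edges M]) (simp add: entry_value_def zpow_def)
  have "prob_space (centered_normal (sqrt (1 / real d / 2)))"
    by (rule prob_space_normal_density) (use d in simp)
  then interpret N: prob_space "centered_normal (sqrt (1 / real d / 2))" .
  interpret NP: pair_prob_space "centered_normal (sqrt (1 / real d / 2))" "centered_normal (sqrt (1 / real d / 2))" ..
  have "prob_space ?G"
    unfolding complex_gaussian_def case_prod_unfold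
    by (rule NP.prob_space_distr) (rule Complex_measurable)
  then interpret G: prob_space ?G .
  interpret product_sigma_finite "\<lambda>_::nat \<times> nat. ?G" ..
  have int: "integrable ?G (?f e)" for e
    by (rule complex_gaussian_moment(1)[OF v])
  show ?A
    unfolding eq entries_law_def
    by (rule product_integrable_prod[OF finite_upper_edges int])
  have s2: "complex_of_real (1 / d) = ?s * ?s"
    by (simp flip: of_real_mult)
  have "(\<integral>t. (\<Prod>(c, e)\<in>#M. entry_value t c e) \<partial>entries_law d) =
      (\<Prod>e\<in>?U. \<integral>z. ?f e z \<partial>?G)"
    unfolding eq entries_law_def
    by (rule product_integral_prod[OF finite_upper_edges int])
  also have "\<dots> = (\<Prod>e\<in>?U. (?s ^ count M (Plain, e) * ?s ^ count M (Star, e)) *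
      (if count M (Plain, e) = count M (Star, e) then fact (count M (Plain, e)) else 0))"
    by (intro prod.cong refl)
      (auto simp: complex_gaussian_moment(2)[OF v] s2 power_mult_distrib simp del: of_real_divide)
  also have "\<dots> = (\<Prod>(c, e)\<in>#M. ?s) * gauss_moment M"
    unfolding prod.distrib prod_symbols[OF finite_upper_edges M, of "\<lambda>_ _. ?s"]
      gauss_moment_prod[OF finite_upper_edges M] by simp
  also have "(\<Prod>(c, e)\<in>#M. ?s) = ?s ^ size M"
    by (simp add: case_prod_unfold image_mset_const_eq)
  finally show ?B .
qed

text \<open>Each letter of the word moves one symbol into the monomial \<open>M\<close>, so the integral and the formal
  expectation agree for words because they agree for monomials.\<close>

lemma integral_walk:
  assumes d: "d > 0" and "set_mset M \<subseteq> UNIV \<times> upper_edges d" and "a < d" and b: "b < d"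
  shows "integrable (entries_law d)
      (\<lambda>t. (\<Prod>(c, e)\<in>#M. entry_value t c e) * walk (entry_value t) d p a b)" (is "?A M p a")
    and "(\<integral>t. (\<Prod>(c, e)\<in>#M. entry_value t c e) * walk (entry_value t) d p a b \<partial>entries_law d) =
      of_real (sqrt (1 / d)) ^ (size M + length p) *
      expectation (Poly_Mapping.single M 1 * walk gen d p a b)" (is "?B M p a")
proof -
  have "?A M p a \<and> ?B M p a"
    using assms(2,3)
  proof (induction p arbitrary: M a)
    case Nil
    then show ?case
      using entries_law_moment[OF d, of M] by (simp add: expectation_single)
  next
    case (Cons c p)
    let ?s = "complex_of_real (sqrt (1 / d))"
    let ?P = "\<lambda>M t. \<Prod>(c, e)\<in>#M. entry_value t c e"
    let ?E = "\<lambda>i. expectation ((Poly_Mapping.single M 1 * step gen c a i) * walk gen d p i b)"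
    have *: "has_bochner_integral (entries_law d)
        (\<lambda>t. (?P M t * step (entry_value t) c a i) * walk (entry_value t) d p i b)
        (?s ^ (size M + length (c # p)) * ?E i)" (is "has_bochner_integral _ (?h i) _")
      if i: "i < d" for i
    proof -
      have "has_bochner_integral (entries_law d) (\<lambda>t. ?P (add_mset (c', e) M) t * walk (entry_value t) d p i b)
          (?s ^ (size M + length (c # p)) * expectation (Poly_Mapping.single (add_mset (c', e) M) 1 * walk gen d p i b))"
        if "e \<in> upper_edges d" for c' e
        using Cons.IH[of "add_mset (c', e) M" i] Cons.prems i that
        by (auto simp: has_bochner_integral_iff)
      from this[of "(a, i)" Plain] this[of "(i, a)" Star] show ?thesis
        using Cons.prems i unfolding single_mult_step
        by (cases c) (auto simp: step_def entry_value_def ac_simps)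
    qed
    have "has_bochner_integral (entries_law d) (\<lambda>t. \<Sum>i<d. ?h i t)
        (\<Sum>i<d. ?s ^ (size M + length (c # p)) * ?E i)"
      by (rule has_bochner_integral_sum) (use * in auto)
    moreover have "(\<Sum>i<d. ?h i t) = ?P M t * walk (entry_value t) d (c # p) a b" for t
      by (simp add: sum_distrib_left mult.assoc)
    moreover have "(\<Sum>i<d. ?s ^ (size M + length (c # p)) * ?E i) =
        ?s ^ (size M + length (c # p)) * expectation (Poly_Mapping.single M 1 * walk gen d (c # p) a b)"
      unfolding single_mult_walk_Cons expectation_sum sum_distrib_left ..
    ultimately show ?case by (simp add: has_bochner_integral_iff)
  qed
  then show "?A M p a" and "?B M p a" by auto
qed

lemma mat_word_walk:
  fixes t :: "nat \<times> nat \<Rightarrow> complex" and d :: nat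
  defines "X \<equiv> strict_upper_mat d t"
  shows "mat_word p X \<in> carrier_mat d d"
    and "a < d \<Longrightarrow> b < d \<Longrightarrow> mat_word p X $$ (a, b) = walk (entry_value t) d p a b"
proof -
  have X: "X \<in> carrier_mat d d" by (simp add: X_def strict_upper_mat_def)
  have adj: "mat_adjoint X \<in> carrier_mat d d"
    using X by (simp add: mat_adjoint_def mat_of_rows_def)
  have Xi: "X $$ (a, i) = step (entry_value t) Plain a i" if "a < d" "i < d" for a i
    using that by (simp add: X_def strict_upper_mat_def step_def entry_value_def)
  have Xadj: "mat_adjoint X $$ (a, i) = step (entry_value t) Star a i" if "a < d" "i < d" for a i
    using that X
    by (auto simp: mat_adjoint_def mat_of_rows_def X_def strict_upper_mat_def step_def entry_value_def)
  have word_Cons: "mat_word (c # p) X = (case c of Plain \<Rightarrow> X | Star \<Rightarrow> mat_adjoint X) * mat_word p X" for c p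
    by (simp add: mat_word_def)
  have carrier: "mat_word p X \<in> carrier_mat d d" for p
  proof (induction p)
    case Nil
    then show ?case using X by (auto simp: mat_word_def)
  next
    case (Cons c p)
    then show ?case using X adj by (cases c) (auto simp: word_Cons Cons)
  qed
  then show "mat_word p X \<in> carrier_mat d d" .
  show "mat_word p X $$ (a, b) = walk (entry_value t) d p a b" if "a < d" and b: "b < d"
    using that(1)
  proof (induction p arbitrary: a)
    case Nil
    then show ?case using X b by (auto simp: mat_word_def)
  next
    case (Cons c p)
    let ?Y = "case c of Plain \<Rightarrow> X | Star \<Rightarrow> mat_adjoint X"
    have Y: "?Y \<in> carrier_mat d d" using X adj by (cases c) auto
    have Yi: "?Y $$ (a, i) = step (entry_value t) c a i" if "i < d" for i
      using Xi Xadj Cons.prems that by (cases c) auto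
    have "mat_word (c # p) X $$ (a, b) = (\<Sum>i<d. ?Y $$ (a, i) * mat_word p X $$ (i, b))"
      using Y carrier[of p] Cons.prems b
      unfolding word_Cons
      by (auto simp: scalar_prod_def lessThan_atLeast0 intro!: sum.cong)
    also have "\<dots> = (\<Sum>i<d. step (entry_value t) c a i * walk (entry_value t) d p i b)"
      by (intro sum.cong refl) (auto simp: Yi Cons.IH)
    finally show ?case by simp
  qed
qed

lemma expected_trace_eq:
  assumes d: "d > 0"
  shows "expected_trace p d =
    of_real (sqrt (1 / d)) ^ length p * expectation (walk_trace gen d p) / of_nat d"
proof -
  let ?x = "\<lambda>t. entry_value t"
  have tr: "mat_trace (mat_word p (strict_upper_mat d t)) = walk_trace (?x t) d p" for t
  proof -
    have "dim_row (mat_word p (strict_upper_mat d t)) = d"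
      using mat_word_walk(1)[of p d t] by auto
    then show ?thesis
      by (auto simp: mat_trace_def walk_trace_def mat_word_walk(2) intro!: sum.cong)
  qed
  have int: "integrable (entries_law d) (\<lambda>t. walk (?x t) d p a a)"
    and val: "(\<integral>t. walk (?x t) d p a a \<partial>entries_law d) =
      of_real (sqrt (1 / d)) ^ length p * expectation (walk gen d p a a)"
    if "a < d" for a
    using integral_walk[OF d, of "{#}" a a p] that by simp_all
  have "expected_trace p d = (\<integral>t. (\<Sum>a<d. walk (?x t) d p a a) \<partial>entries_law d) / of_nat d"
    unfolding expected_trace_def tr walk_trace_def by simp
  also have "(\<integral>t. (\<Sum>a<d. walk (?x t) d p a a) \<partial>entries_law d) =
      (\<Sum>a<d. of_real (sqrt (1 / d)) ^ length p * expectation (walk gen d p a a))"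
    using int by (subst Bochner_Integration.integral_sum) (auto simp: val)
  finally show ?thesis
    by (simp add: walk_trace_def expectation_sum sum_distrib_left)
qed

section \<open>Adding one row and one column\<close>

text \<open>In each block the letters \<open>Plain\<close> come first, so that a walk rises and then falls: the gap inside
  a block is where it can sit at its largest index.\<close>

definition pair_word :: "(nat \<times> nat) list \<Rightarrow> star_word" where
  "pair_word kls = concat (map (\<lambda>(k, l). replicate k Plain @ replicate l Star) kls)"

lemma pair_word_simps [simp]:
  "pair_word [] = []"
  "pair_word ((k, l) # kls) = replicate k Plain @ replicate l Star @ pair_word kls"
  "pair_word (kls @ kls') = pair_word kls @ pair_word kls'"
  by (simp_all add: pair_word_def)

text \<open>\<open>visits s [] kls\<close> is the sum over the nonempty sets of gaps of the blocks \<open>kls\<close>, where the chosen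
  gaps cut the cyclic word into stretches and the weight of a set is the product of the weights of its
  stretches. A stretch starts with the \<open>l\<close> falling letters after a chosen gap, passes the blocks
  \<open>zs\<close>, and ends with the \<open>k\<close> rising letters before the next chosen gap. In \<open>visits_from\<close> the first
  chosen gap lies in a block with \<open>k\<close> rising letters; the blocks \<open>xs\<close> before it belong to the last
  stretch.\<close>

fun visits_from ::
    "(nat \<Rightarrow> (nat \<times> nat) list \<Rightarrow> nat \<Rightarrow> 'r::comm_ring_1) \<Rightarrow>
      nat \<Rightarrow> (nat \<times> nat) list \<Rightarrow> (nat \<times> nat) list \<Rightarrow> (nat \<times> nat) list \<Rightarrow> nat \<Rightarrow> 'r" where
  "visits_from s l zs [] xs k = s l (zs @ xs) k"
| "visits_from s l zs ((k', l') # ys) xs k =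
     visits_from s l (zs @ [(k', l')]) ys xs k + s l zs k' * visits_from s l' [] ys xs k"

fun visits ::
    "(nat \<Rightarrow> (nat \<times> nat) list \<Rightarrow> nat \<Rightarrow> 'r::comm_ring_1) \<Rightarrow>
      (nat \<times> nat) list \<Rightarrow> (nat \<times> nat) list \<Rightarrow> 'r" where
  "visits s xs [] = 0"
| "visits s xs ((k, l) # ys) = visits s (xs @ [(k, l)]) ys + visits_from s l [] ys xs k"

text \<open>The entry \<open>(a, b)\<close> of a product of \<open>n \<times> n\<close> matrices, given as functions of two indices.\<close>

primrec chain :: "nat \<Rightarrow> (nat \<Rightarrow> nat \<Rightarrow> 'r::comm_ring_1) list \<Rightarrow> nat \<Rightarrow> nat \<Rightarrow> 'r" where
  "chain n [] a b = (if a = b then 1 else 0)"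
| "chain n (A # As) a b = (\<Sum>i<n. A a i * chain n As i b)"

lemma chain_append:
  assumes "a < n"
  shows "chain n (As @ Bs) a b = (\<Sum>i<n. chain n As a i * chain n Bs i b)"
  using assms
proof (induction As arbitrary: a)
  case Nil
  then show ?case by (simp add: if_distrib[where f = "\<lambda>y. y * _"] sum.delta cong: if_cong)
next
  case (Cons A As)
  have "chain n ((A # As) @ Bs) a b = (\<Sum>j<n. \<Sum>i<n. A a j * chain n As j i * chain n Bs i b)"
    by (simp add: Cons.IH sum_distrib_left mult.assoc)
  also have "\<dots> = (\<Sum>i<n. \<Sum>j<n. A a j * chain n As j i * chain n Bs i b)"
    by (rule sum.swap)
  finally show ?case by (simp add: sum_distrib_right)
qed

lemma chain_insert_add:
  assumes "a < n" and "\<And>i j. i < n \<Longrightarrow> j < n \<Longrightarrow> M i j = A i j + B i j"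
  shows "chain n (As @ M # Bs) a b = chain n (As @ A # Bs) a b + chain n (As @ B # Bs) a b"
proof -
  have "(\<Sum>j<n. M i j * chain n Bs j b) = (\<Sum>j<n. A i j * chain n Bs j b) + (\<Sum>j<n. B i j * chain n Bs j b)"
    if "i < n" for i
    using that by (simp add: assms(2) distrib_right sum.distrib)
  then show ?thesis
    using assms(1) by (simp add: chain_append distrib_left sum.distrib)
qed

text \<open>A factor of rank one cuts the product into two.\<close>

lemma chain_insert_rank_one:
  assumes "a < n" and "b < n" and "\<And>i j. M i j = u i * v j"
  shows "chain n (As @ M # Bs) a b =
    (\<Sum>i<n. chain n As a i * u i) * (\<Sum>j<n. v j * chain n Bs j b)"
proof -
  have "chain n (As @ M # Bs) a b =
      (\<Sum>i<n. \<Sum>j<n. (chain n As a i * u i) * (v j * chain n Bs j b))"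
    using assms by (simp add: chain_append sum_distrib_left mult.assoc)
  then show ?thesis by (simp only: sum_product)
qed

lemma chain_snoc:
  assumes "a < n" and "b < n"
  shows "chain n (As @ [A]) a b = (\<Sum>i<n. chain n As a i * A i b)"
  using assms
  by (simp add: chain_append if_distrib[where f = "\<lambda>y. _ * y"] sum.delta cong: if_cong)

context
  fixes d :: nat
begin

abbreviation up :: "nat \<Rightarrow> nat \<Rightarrow> nat \<Rightarrow> wick_poly" where
  "up k \<equiv> walk gen (Suc d) (replicate k Plain)"

abbreviation down :: "nat \<Rightarrow> nat \<Rightarrow> nat \<Rightarrow> wick_poly" where
  "down l \<equiv> walk gen (Suc d) (replicate l Star)"

text \<open>In dimension \<open>d + 1\<close> a walk through a block either avoids the new index \<open>d\<close> in the gap of the block or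
  sits there. Accordingly the matrix \<open>block\<close> is the sum of \<open>pass\<close> and the rank one matrix \<open>hit\<close>.\<close>

definition block :: "nat \<times> nat \<Rightarrow> nat \<Rightarrow> nat \<Rightarrow> wick_poly" where
  "block = (\<lambda>(k, l). walk gen (Suc d) (replicate k Plain @ replicate l Star))"

definition pass :: "nat \<times> nat \<Rightarrow> nat \<Rightarrow> nat \<Rightarrow> wick_poly" where
  "pass = (\<lambda>(k, l) a b. \<Sum>x<d. up k a x * down l x b)"

definition hit :: "nat \<times> nat \<Rightarrow> nat \<Rightarrow> nat \<Rightarrow> wick_poly" where
  "hit = (\<lambda>(k, l) a b. up k a d * down l d b)"

text \<open>The quadratic form \<open>u\<^sup>* A u\<close>, where \<open>u\<close> is column \<open>d\<close>, which is independent of the \<open>d \<times> d\<close>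
  matrix, and \<open>A\<close> is a word in that matrix and its adjoint.\<close>

definition open_trace :: "star_word \<Rightarrow> wick_poly" where
  "open_trace q = (\<Sum>a<d. \<Sum>b<d. gen Star (a, d) * walk gen d q a b * gen Plain (b, d))"

text \<open>The contribution of a stretch from the index \<open>d\<close> back to it: the first and last letters of the
  stretch provide the two factors \<open>u\<close>. The empty stretch occurs when two neighbouring gaps are the
  same place because no letter separates them.\<close>

definition excursion :: "nat \<Rightarrow> (nat \<times> nat) list \<Rightarrow> nat \<Rightarrow> wick_poly" where
  "excursion l zs k =
     (if zs = [] \<and> l = 0 \<and> k = 0 then 1
      else if l \<noteq> 0 \<and> k \<noteq> 0
        then open_trace (replicate (l - 1) Star @ pair_word zs @ replicate (k - 1) Plain)
      else 0)"

text \<open>No entry leads upwards from the largest index.\<close>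

lemma up_from_top: "b \<le> d \<Longrightarrow> up k d b = (if k = 0 \<and> b = d then 1 else 0)"
  by (cases k) (auto simp: step_def intro!: sum.neutral)

lemma up_below: "a < d \<Longrightarrow> b < d \<Longrightarrow> up k a b = walk gen d (replicate k Plain) a b"
proof (induction k arbitrary: a)
  case (Suc k)
  then show ?case by (auto simp: up_from_top intro!: sum.cong)
qed simp

lemma up_to_top:
  assumes "a < d"
  shows "up (Suc k) a d = (\<Sum>x<d. walk gen d (replicate k Plain) a x * gen Plain (x, d))"
proof -
  have s: "walk gen (Suc d) [Plain] i d = (if i < d then gen Plain (i, d) else 0)" if "i \<le> d" for i
    using that by (simp add: step_def)
  have "up (Suc k) a d = walk gen (Suc d) (replicate k Plain @ [Plain]) a d"
    by (simp only: replicate_append_same replicate_Suc)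
  also have "\<dots> = (\<Sum>i<Suc d. up k a i * walk gen (Suc d) [Plain] i d)"
    using assms by (subst walk_append) auto
  also have "\<dots> = (\<Sum>x<d. walk gen d (replicate k Plain) a x * gen Plain (x, d))"
    using assms by (simp add: s up_below del: walk.simps)
  finally show ?thesis .
qed

lemma down_to_top:
  assumes "a \<le> d"
  shows "down l a d = (if l = 0 \<and> a = d then 1 else 0)"
proof (cases l)
  case (Suc l')
  have s: "walk gen (Suc d) [Star] i d = 0" if "i \<le> d" for i
    using that by (auto simp: step_def intro!: sum.neutral)
  have "down l a d = walk gen (Suc d) (replicate l' Star @ [Star]) a d"
    by (simp only: replicate_append_same replicate_Suc Suc)
  also have "\<dots> = (\<Sum>i<Suc d. down l' a i * walk gen (Suc d) [Star] i d)"
    using assms by (subst walk_append) auto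
  also have "\<dots> = 0"
    by (rule sum.neutral) (use s in auto)
  finally show ?thesis using Suc by simp
qed auto

lemma down_below: "a < d \<Longrightarrow> b < d \<Longrightarrow> down l a b = walk gen d (replicate l Star) a b"
proof (induction l arbitrary: a)
  case (Suc l)
  then show ?case by (auto simp: step_def intro!: sum.cong)
qed simp

lemma down_from_top:
  assumes "b < d"
  shows "down (Suc l) d b = (\<Sum>x<d. gen Star (x, d) * walk gen d (replicate l Star) x b)"
  using assms by (auto simp: step_def down_below intro!: sum.cong)

lemma block_eq:
  assumes "a \<le> d"
  shows "block kl a b = pass kl a b + hit kl a b"
proof -
  obtain k l where kl: "kl = (k, l)" by force
  have "block kl a b = (\<Sum>x<Suc d. up k a x * down l x b)"
    unfolding block_def kl prod.case by (rule walk_append) (use assms in simp)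
  then show ?thesis by (simp only: sum.lessThan_Suc pass_def hit_def kl prod.case)
qed

lemma pass_eq:
  assumes "a \<le> d" and "b \<le> d"
  shows "pass (k, l) a b =
    (if a < d \<and> b < d then walk gen d (replicate k Plain @ replicate l Star) a b else 0)"
proof (cases "a < d \<and> b < d")
  case True
  have "pass (k, l) a b = (\<Sum>x<d. walk gen d (replicate k Plain) a x * walk gen d (replicate l Star) x b)"
    unfolding pass_def prod.case
    by (intro sum.cong refl arg_cong2[where f = "(*)"] up_below down_below) (use True in auto)
  then show ?thesis using True by (simp add: walk_append)
next
  case False
  have "up k a x * down l x b = 0" if "x < d" for x
  proof (cases "a < d")
    case True
    with False assms have "b = d" by simp
    then show ?thesis using that down_to_top[of x l] by simp
  next
    case False
    with assms have "a = d" by simp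
    then show ?thesis using that up_from_top[of x k] by simp
  qed
  then show ?thesis unfolding pass_def prod.case if_not_P[OF False] by (intro sum.neutral) simp
qed

text \<open>Since each gap avoids the index \<open>d\<close>, so do all the other indices: the product is the one for
  dimension \<open>d\<close>.\<close>

lemma chain_pass:
  assumes "zs \<noteq> []" and "a \<le> d" and "b \<le> d"
  shows "chain (Suc d) (map pass zs) a b = (if a < d \<and> b < d then walk gen d (pair_word zs) a b else 0)"
  using assms(1,2)
proof (induction zs arbitrary: a rule: list_nonempty_induct)
  case (single z)
  obtain k l where z: "z = (k, l)" by force
  have "chain (Suc d) [pass z] a b = pass z a b"
    using chain_snoc[of a "Suc d" b "[]" "pass z"] single assms(3)
    by (simp add: if_distrib[where f = "\<lambda>y. y * _"] cong: if_cong)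
  then show ?case using pass_eq[OF single assms(3)] by (simp only: z list.map pair_word_simps append_Nil2)
next
  case (cons z zs)
  obtain k l where z: "z = (k, l)" by force
  let ?V = "walk gen d (replicate k Plain @ replicate l Star)" and ?W = "walk gen d (pair_word zs)"
  have "chain (Suc d) (map pass (z # zs)) a b = (\<Sum>i<Suc d. pass z a i * chain (Suc d) (map pass zs) i b)"
    by (simp only: list.map chain.simps)
  also have "\<dots> = (\<Sum>i<Suc d. pass z a i * (if i < d \<and> b < d then ?W i b else 0))"
    by (intro sum.cong refl arg_cong2[where f = "(*)"] cons.IH) simp
  also have "\<dots> = (\<Sum>i<d. pass z a i * (if b < d then ?W i b else 0))"
    by simp
  also have "\<dots> = (\<Sum>i<d. (if a < d then ?V a i else 0) * (if b < d then ?W i b else 0))"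
    using cons.prems by (intro sum.cong refl arg_cong2[where f = "(*)"]) (simp add: z pass_eq)
  also have "\<dots> = (if a < d \<and> b < d then \<Sum>i<d. ?V a i * ?W i b else 0)"
    by simp
  also have "\<dots> = (if a < d \<and> b < d then walk gen d (pair_word (z # zs)) a b else 0)"
    using walk_append[of a d gen "replicate k Plain @ replicate l Star" "pair_word zs" b]
    by (simp add: z)
  finally show ?case .
qed

lemma down_walk_up:
  "(\<Sum>i<d. \<Sum>j<d. down l d i * walk gen d q i j * up k j d) =
    (if l \<noteq> 0 \<and> k \<noteq> 0 then open_trace (replicate (l - 1) Star @ q @ replicate (k - 1) Plain) else 0)"
proof (cases "l \<noteq> 0 \<and> k \<noteq> 0")
  case True
  then obtain l' k' where [simp]: "l = Suc l'" "k = Suc k'" by (metis not0_implies_Suc)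
  let ?Q = "\<lambda>a i. walk gen d (replicate l' Star) a i"
  let ?R = "\<lambda>j b. walk gen d (replicate k' Plain) j b"
  let ?w = "walk gen d q"
  have "(\<Sum>i<d. \<Sum>j<d. down l d i * ?w i j * up k j d) =
      (\<Sum>i<d. \<Sum>j<d. (\<Sum>a<d. gen Star (a, d) * ?Q a i) * ?w i j * (\<Sum>b<d. ?R j b * gen Plain (b, d)))"
    by (simp add: down_from_top up_to_top del: replicate_Suc)
  also have "\<dots> = (\<Sum>i<d. \<Sum>j<d. \<Sum>a<d. \<Sum>b<d. gen Star (a, d) * ?Q a i * ?w i j * ?R j b * gen Plain (b, d))"
    by (simp only: sum_distrib_right) (simp only: sum_distrib_left mult.assoc)
  also have "\<dots> = (\<Sum>i<d. \<Sum>a<d. \<Sum>j<d. \<Sum>b<d. gen Star (a, d) * ?Q a i * ?w i j * ?R j b * gen Plain (b, d))"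
    by (intro sum.cong refl sum.swap)
  also have "\<dots> = (\<Sum>a<d. \<Sum>i<d. \<Sum>j<d. \<Sum>b<d. gen Star (a, d) * ?Q a i * ?w i j * ?R j b * gen Plain (b, d))"
    by (rule sum.swap)
  also have "\<dots> = (\<Sum>a<d. \<Sum>i<d. \<Sum>b<d. \<Sum>j<d. gen Star (a, d) * ?Q a i * ?w i j * ?R j b * gen Plain (b, d))"
    by (intro sum.cong refl sum.swap)
  also have "\<dots> = (\<Sum>a<d. \<Sum>b<d. \<Sum>i<d. \<Sum>j<d. gen Star (a, d) * ?Q a i * ?w i j * ?R j b * gen Plain (b, d))"
    by (intro sum.cong refl sum.swap)
  also have "\<dots> = open_trace (replicate l' Star @ q @ replicate k' Plain)"
    unfolding open_trace_def
    by (intro sum.cong refl) (auto simp: walk_append sum_distrib_left sum_distrib_right mult.assoc)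
  finally show ?thesis by simp
next
  case False
  then show ?thesis
    by (auto simp: up_from_top down_to_top intro!: sum.neutral)
qed

lemma chain_excursion:
  "chain (Suc d) (down l # map pass zs @ [up k]) d d = excursion l zs k"
proof -
  let ?S = "\<Sum>i<d. \<Sum>j<d. down l d i * walk gen d (pair_word zs) i j * up k j d"
  have "chain (Suc d) (down l # map pass zs @ [up k]) d d =
      (\<Sum>i<Suc d. down l d i * (\<Sum>j<Suc d. chain (Suc d) (map pass zs) i j * up k j d))"
    unfolding chain.simps(2) by (intro sum.cong refl) (simp only: chain_snoc lessThan_iff lessI)
  also have "\<dots> = (if zs = [] \<and> l = 0 \<and> k = 0 then 1 else 0) + ?S"
  proof (cases "zs = []")
    case True
    have "(\<Sum>i<Suc d. down l d i * (\<Sum>j<Suc d. chain (Suc d) (map pass zs) i j * up k j d)) =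
        (\<Sum>i<Suc d. down l d i * up k i d)"
      using True by (auto simp: if_distrib[where f = "\<lambda>y. y * _"] sum.delta cong: if_cong intro!: sum.cong)
    also have "\<dots> = (\<Sum>i<d. down l d i * up k i d) + (if l = 0 \<and> k = 0 then 1 else 0)"
      by (simp add: up_from_top down_to_top)
    also have "(\<Sum>i<d. down l d i * up k i d) = ?S"
      using True
      by (auto simp: if_distrib[where f = "\<lambda>y. y * _"] if_distrib[where f = "\<lambda>y. _ * y"] sum.delta cong: if_cong intro!: sum.cong)
    finally show ?thesis using True by simp
  next
    case False
    then show ?thesis
      by (simp add: chain_pass sum_distrib_left mult.assoc)
  qed
  also have "\<dots> = excursion l zs k"
    unfolding down_walk_up excursion_def by auto
  finally show ?thesis .
qed

text \<open>Splitting the first undecided block into \<open>pass\<close> and \<open>hit\<close> reproduces the recursion of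
  \<open>visits_from\<close>, as \<open>hit\<close> cuts the product there.\<close>

lemma visits_from_excursion:
  "visits_from excursion l zs ys xs k =
    chain (Suc d) (down l # map pass zs @ map block ys @ map pass xs @ [up k]) d d"
proof (induction ys arbitrary: l zs)
  case Nil
  show ?case using chain_excursion[of l "zs @ xs" k] by (simp del: chain.simps)
next
  case (Cons y ys)
  obtain k' l' where y: "y = (k', l')" by force
  let ?As = "down l # map pass zs" and ?Bs = "map block ys @ map pass xs @ [up k]"
  have "chain (Suc d) (?As @ block y # ?Bs) d d =
      chain (Suc d) (?As @ pass y # ?Bs) d d + chain (Suc d) (?As @ hit y # ?Bs) d d"
    by (rule chain_insert_add) (auto simp: block_eq)
  also have "chain (Suc d) (?As @ pass y # ?Bs) d d = visits_from excursion l (zs @ [y]) ys xs k"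
    by (simp add: Cons.IH del: chain.simps)
  also have "chain (Suc d) (?As @ hit y # ?Bs) d d =
      chain (Suc d) (?As @ [up k']) d d * chain (Suc d) (down l' # ?Bs) d d"
  proof -
    have "chain (Suc d) (?As @ hit y # ?Bs) d d =
        (\<Sum>i<Suc d. chain (Suc d) ?As d i * up k' i d) * (\<Sum>j<Suc d. down l' d j * chain (Suc d) ?Bs j d)"
      by (rule chain_insert_rank_one) (auto simp: hit_def y)
    also have "(\<Sum>i<Suc d. chain (Suc d) ?As d i * up k' i d) = chain (Suc d) (?As @ [up k']) d d"
      by (rule chain_snoc[symmetric]) auto
    finally show ?thesis by (simp only: chain.simps)
  qed
  also have "chain (Suc d) (?As @ [up k']) d d = excursion l zs k'"
    using chain_excursion[of l zs k'] by (simp del: chain.simps)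
  also have "chain (Suc d) (down l' # ?Bs) d d = visits_from excursion l' [] ys xs k"
    using Cons.IH[of l' "[]"] by (simp del: chain.simps)
  finally have split: "chain (Suc d) (?As @ block y # ?Bs) d d =
      visits_from excursion l (zs @ [y]) ys xs k + excursion l zs k' * visits_from excursion l' [] ys xs k" .
  have "visits_from excursion l zs (y # ys) xs k =
      visits_from excursion l (zs @ [y]) ys xs k + excursion l zs k' * visits_from excursion l' [] ys xs k"
    by (simp only: y visits_from.simps)
  with split show ?case by (simp only: list.map append_Cons)
qed

lemma visits_excursion:
  "(\<Sum>a<Suc d. chain (Suc d) (map pass xs @ map block ys) a a) =
    (\<Sum>a<Suc d. chain (Suc d) (map pass (xs @ ys)) a a) + visits excursion xs ys"
proof (induction ys arbitrary: xs)
  case (Cons y ys)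
  obtain k l where y: "y = (k, l)" by force
  let ?As = "map pass xs" and ?Bs = "map block ys"
  have "(\<Sum>a<Suc d. chain (Suc d) (?As @ block y # ?Bs) a a) =
      (\<Sum>a<Suc d. chain (Suc d) (?As @ pass y # ?Bs) a a + chain (Suc d) (?As @ hit y # ?Bs) a a)"
    by (intro sum.cong refl chain_insert_add) (auto simp: block_eq)
  also have "\<dots> = (\<Sum>a<Suc d. chain (Suc d) (map pass (xs @ [y]) @ ?Bs) a a) +
      (\<Sum>a<Suc d. chain (Suc d) (?As @ hit y # ?Bs) a a)"
    by (simp add: sum.distrib del: chain.simps sum.lessThan_Suc)
  also have "(\<Sum>a<Suc d. chain (Suc d) (?As @ hit y # ?Bs) a a) =
      (\<Sum>a<Suc d. \<Sum>i<Suc d. \<Sum>j<Suc d. down l d j * chain (Suc d) ?Bs j a * (chain (Suc d) ?As a i * up k i d))"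
  proof (rule sum.cong[OF refl])
    fix a assume "a \<in> {..<Suc d}"
    then have "chain (Suc d) (?As @ hit y # ?Bs) a a =
        (\<Sum>i<Suc d. chain (Suc d) ?As a i * up k i d) * (\<Sum>j<Suc d. down l d j * chain (Suc d) ?Bs j a)"
      by (intro chain_insert_rank_one) (auto simp: hit_def y)
    then show "chain (Suc d) (?As @ hit y # ?Bs) a a = (\<Sum>i<Suc d. \<Sum>j<Suc d.
        down l d j * chain (Suc d) ?Bs j a * (chain (Suc d) ?As a i * up k i d))"
      unfolding sum_product by (simp only: mult.commute)
  qed
  also have "\<dots> = (\<Sum>a<Suc d. (\<Sum>j<Suc d. down l d j * chain (Suc d) ?Bs j a) * (\<Sum>i<Suc d. chain (Suc d) ?As a i * up k i d))"
    unfolding sum_product by (intro sum.cong refl sum.swap)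
  also have "\<dots> = chain (Suc d) ((down l # ?Bs) @ ?As @ [up k]) d d"
  proof -
    have "chain (Suc d) (?As @ [up k]) a d = (\<Sum>i<Suc d. chain (Suc d) ?As a i * up k i d)" if "a < Suc d" for a
      using that by (rule chain_snoc) simp
    then show ?thesis
      by (subst chain_append) (auto simp del: sum.lessThan_Suc intro!: sum.cong)
  qed
  also have "\<dots> = visits_from excursion l [] ys xs k"
    using visits_from_excursion[of l "[]" ys xs k] by (simp del: chain.simps)
  finally have split: "(\<Sum>a<Suc d. chain (Suc d) (?As @ block y # ?Bs) a a) =
      (\<Sum>a<Suc d. chain (Suc d) (map pass (xs @ [y]) @ ?Bs) a a) + visits_from excursion l [] ys xs k" .
  have IH: "(\<Sum>a<Suc d. chain (Suc d) (map pass (xs @ [y]) @ ?Bs) a a) =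
      (\<Sum>a<Suc d. chain (Suc d) (map pass (xs @ y # ys)) a a) + visits excursion (xs @ [y]) ys"
    using Cons.IH[of "xs @ [y]"] by (simp only: append_assoc append_Cons append_Nil)
  have V: "visits excursion xs (y # ys) = visits excursion (xs @ [y]) ys + visits_from excursion l [] ys xs k"
    by (simp add: y)
  show ?case by (simp only: list.map split IH V add.assoc)
next
  case Nil
  show ?case by (simp only: list.map append_Nil2 visits.simps add_0_right)
qed

text \<open>The new index \<open>d\<close> is the largest one, so a closed walk can be there only in the gap of a block. The
  closed walks that visit \<open>d\<close> are sorted by the set of gaps where they do so.\<close>

lemma walk_trace_Suc:
  assumes "kls \<noteq> []"
  shows "walk_trace gen (Suc d) (pair_word kls) =
    walk_trace gen d (pair_word kls) + visits excursion [] kls"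
proof -
  have "walk gen (Suc d) (pair_word kls) a b = chain (Suc d) (map block kls) a b" if "a < Suc d" for a b
    using that
  proof (induction kls arbitrary: a)
    case (Cons y kls)
    obtain k l where y: "y = (k, l)" by force
    have "walk gen (Suc d) (pair_word (y # kls)) a b =
        walk gen (Suc d) ((replicate k Plain @ replicate l Star) @ pair_word kls) a b"
      by (simp add: y)
    also have "\<dots> = (\<Sum>i<Suc d. block y a i * walk gen (Suc d) (pair_word kls) i b)"
      using Cons.prems by (subst walk_append) (auto simp: block_def y)
    finally show ?case using Cons.IH by simp
  qed simp
  then have "walk_trace gen (Suc d) (pair_word kls) = (\<Sum>a<Suc d. chain (Suc d) (map block kls) a a)"
    unfolding walk_trace_def by (intro sum.cong) auto
  also have "\<dots> = (\<Sum>a<Suc d. chain (Suc d) (map pass kls) a a) + visits excursion [] kls"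
    using visits_excursion[of "[]" kls] by simp
  also have "(\<Sum>a<Suc d. chain (Suc d) (map pass kls) a a) = walk_trace gen d (pair_word kls)"
    using assms by (simp add: chain_pass walk_trace_def)
  finally show ?thesis .
qed

lemma deriv_plain_walk:
  assumes "i < d"
  shows "deriv_plain (a, d) (walk gen d q i j) = 0"
  using assms
proof (induction q arbitrary: i)
  case (Cons c q)
  have "deriv_plain (a, d) (step gen c i x) = 0" if "x < d" for x
    using that Cons.prems by (auto simp: step_def deriv_plain_gen split: letter.splits)
  then show ?case
    using Cons by (auto simp: deriv_plain_sum deriv_plain_mult intro!: sum.neutral)
qed simp

lemma deriv_plain_walk_trace: "deriv_plain (a, d) (walk_trace gen d q) = 0"
  by (auto simp: walk_trace_def deriv_plain_sum deriv_plain_walk intro!: sum.neutral)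

lemma deriv_plain_open_trace:
  assumes "a < d"
  shows "deriv_plain (a, d) (open_trace q) = (\<Sum>i<d. gen Star (i, d) * walk gen d q i a)"
proof -
  have "deriv_plain (a, d) (open_trace q) =
      (\<Sum>i<d. \<Sum>b<d. gen Star (i, d) * walk gen d q i b * (if b = a then 1 else 0))"
    unfolding open_trace_def deriv_plain_sum
    by (intro sum.cong refl) (auto simp: deriv_plain_mult deriv_plain_gen deriv_plain_walk)
  then show ?thesis
    using assms by (simp add: if_distrib[where f = "\<lambda>y. _ * y"] sum.delta' cong: if_cong)
qed

text \<open>Integration by parts with respect to the conjugate entry of the first quadratic form. The derivative
  hits either its own second factor \<open>u\<close>, which closes the word up to a trace, or the factor \<open>u\<close> of
  another quadratic form, which merges the two words.\<close>

lemma expectation_open_trace: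
  assumes X: "\<And>a. a < d \<Longrightarrow> deriv_plain (a, d) X = 0"
  shows "expectation (X * (open_trace q * (\<Prod>q'\<leftarrow>qs. open_trace q'))) =
    expectation (X * (walk_trace gen d q * (\<Prod>q'\<leftarrow>qs. open_trace q'))) +
    (\<Sum>k<length qs. expectation (X * (\<Prod>q'\<leftarrow>qs[k := qs ! k @ q]. open_trace q')))"
proof -
  define R where "R = (\<Prod>q'\<leftarrow>qs. open_trace q')"
  define Y where "Y = (\<lambda>a. \<Sum>b<d. walk gen d q a b * gen Plain (b, d))"
  define G where "G = (\<lambda>q' a. \<Sum>i<d. gen Star (i, d) * walk gen d q' i a)"
  define T where "T = (\<lambda>k. prod_list (map open_trace (take k qs)) * prod_list (map open_trace (drop (Suc k) qs)))"
  have Y: "deriv_plain (a, d) (Y a) = walk gen d q a a" if "a < d" for a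
    using that
    by (simp add: Y_def deriv_plain_sum deriv_plain_mult deriv_plain_walk deriv_plain_gen
        if_distrib[where f = "\<lambda>y. _ * y"] sum.delta' cong: if_cong)
  have R: "deriv_plain (a, d) R = (\<Sum>k<length qs. G (qs ! k) a * T k)"
    if "a < d" for a
    unfolding R_def T_def G_def deriv_plain_prod_list
    using that by (simp add: deriv_plain_open_trace take_map drop_map mult.assoc)
  have glue: "(\<Sum>a<d. Y a * G q' a) = open_trace (q' @ q)" for q'
  proof -
    have "(\<Sum>a<d. Y a * G q' a) =
        (\<Sum>a<d. \<Sum>i<d. \<Sum>b<d. gen Star (i, d) * (walk gen d q' i a * walk gen d q a b) * gen Plain (b, d))"
      by (simp add: Y_def G_def sum_distrib_left sum_distrib_right ac_simps)
    also have "\<dots> = (\<Sum>i<d. \<Sum>a<d. \<Sum>b<d. gen Star (i, d) * (walk gen d q' i a * walk gen d q a b) * gen Plain (b, d))"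
      by (rule sum.swap)
    also have "\<dots> = (\<Sum>i<d. \<Sum>b<d. \<Sum>a<d. gen Star (i, d) * (walk gen d q' i a * walk gen d q a b) * gen Plain (b, d))"
      by (intro sum.cong refl sum.swap)
    also have "\<dots> = open_trace (q' @ q)"
      unfolding open_trace_def
      by (intro sum.cong refl) (auto simp: walk_append sum_distrib_left sum_distrib_right mult.assoc)
    finally show ?thesis .
  qed
  have upd: "(\<Prod>q'\<leftarrow>qs[k := w]. open_trace q') = open_trace w * T k" if "k < length qs" for k w
    using that by (simp add: upd_conv_take_nth_drop T_def)
  \<comment> \<open>Isolate the conjugate entry of the first quadratic form.\<close>
  have "X * (open_trace q * R) = (\<Sum>a<d. gen Star (a, d) * (X * Y a * R))"
    by (simp add: open_trace_def Y_def sum_distrib_left sum_distrib_right ac_simps)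
  then have "expectation (X * (open_trace q * R)) = (\<Sum>a<d. expectation (deriv_plain (a, d) (X * Y a * R)))"
    by (simp add: expectation_sum expectation_gen_Star)
  also have "\<dots> = (\<Sum>a<d. expectation (X * (walk gen d q a a * R)) + expectation (X * (Y a * deriv_plain (a, d) R)))"
    by (intro sum.cong refl) (auto simp: deriv_plain_mult X Y expectation_add[symmetric] algebra_simps)
  also have "\<dots> = expectation (X * (walk_trace gen d q * R)) + (\<Sum>a<d. expectation (X * (Y a * deriv_plain (a, d) R)))"
    by (simp add: sum.distrib walk_trace_def sum_distrib_left sum_distrib_right expectation_sum)
  also have "(\<Sum>a<d. expectation (X * (Y a * deriv_plain (a, d) R))) =
      (\<Sum>a<d. \<Sum>k<length qs. expectation (X * (Y a * G (qs ! k) a * T k)))"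
    by (intro sum.cong refl) (simp add: R sum_distrib_left expectation_sum mult.assoc)
  also have "\<dots> = (\<Sum>k<length qs. \<Sum>a<d. expectation (X * (Y a * G (qs ! k) a * T k)))"
    by (rule sum.swap)
  also have "\<dots> = (\<Sum>k<length qs. expectation (X * (open_trace (qs ! k @ q) * T k)))"
    unfolding glue[symmetric] expectation_sum[symmetric] sum_distrib_right sum_distrib_left ..
  also have "\<dots> = (\<Sum>k<length qs. expectation (X * (\<Prod>q'\<leftarrow>qs[k := qs ! k @ q]. open_trace q')))"
    by (intro sum.cong refl) (auto simp: upd)
  finally show ?thesis unfolding R_def .
qed

end

section \<open>Asymptotics of expected products of traces\<close>

lemma cesaro_null:
  fixes f :: "nat \<Rightarrow> real"
  assumes f: "f \<longlonglongrightarrow> 0" and nonneg: "\<And>i. f i \<ge> 0"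
  shows "(\<lambda>d. (\<Sum>i<d. f i) / real d) \<longlonglongrightarrow> 0"
proof (rule LIMSEQ_I)
  fix r :: real assume r: "r > 0"
  then obtain K where K: "\<And>i. i \<ge> K \<Longrightarrow> f i < r / 2"
    using LIMSEQ_D[OF f, of "r / 2"] nonneg by auto
  define B where "B = (\<Sum>i<K. f i)"
  have B: "B \<ge> 0" using nonneg by (simp add: B_def sum_nonneg)
  obtain L :: nat where L: "real L > 2 * B / r" using reals_Archimedean2 by blast
  show "\<exists>no. \<forall>d\<ge>no. norm ((\<Sum>i<d. f i) / real d - 0) < r"
  proof (intro exI allI impI)
    fix d assume d: "d \<ge> Suc (max K L)"
    have "(\<Sum>i<d. f i) = B + (\<Sum>i=K..<d. f i)"
      using d unfolding B_def lessThan_atLeast0 by (subst sum.atLeastLessThan_concat) auto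
    also have "(\<Sum>i=K..<d. f i) \<le> (\<Sum>i=K..<d. r / 2)"
      by (rule sum_mono) (use K in \<open>auto intro: less_imp_le\<close>)
    also have "\<dots> \<le> real d * (r / 2)" using r by (simp add: mult_right_mono)
    finally have 1: "(\<Sum>i<d. f i) \<le> B + real d * (r / 2)" by simp
    have "real L < real d" using d by simp
    then have "2 * B / r < real d" using L by linarith
    then have "B < real d * (r / 2)" using r by (simp add: field_simps)
    with 1 have "(\<Sum>i<d. f i) < real d * r" by simp
    then show "norm ((\<Sum>i<d. f i) / real d - 0) < r"
      using d nonneg by (simp add: sum_nonneg divide_simps mult.commute)
  qed
qed

lemma power_diff_limit:
  "(\<lambda>d. ((of_nat (Suc d)) ^ Suc k - of_nat d ^ Suc k) / (of_nat d ^ k :: complex)) \<longlonglongrightarrow> of_nat (Suc k)"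
proof (induction k)
  case (Suc k)
  let ?u = "\<lambda>d. ((of_nat (Suc d)) ^ Suc k - of_nat d ^ Suc k) / (of_nat d ^ k :: complex)"
  have "(\<lambda>d. (1 + 1 / of_nat d) * ?u d + 1) \<longlonglongrightarrow> (1 + 0) * of_nat (Suc k) + (1 :: complex)"
    by (intro tendsto_add tendsto_mult tendsto_const Suc lim_1_over_n)
  moreover have "\<forall>\<^sub>F d in sequentially. (1 + 1 / of_nat d) * ?u d + 1 =
      ((of_nat (Suc d)) ^ Suc (Suc k) - of_nat d ^ Suc (Suc k)) / (of_nat d ^ Suc k :: complex)"
    using eventually_gt_at_top[of 0]
    by eventually_elim (simp add: field_simps)
  ultimately have "(\<lambda>d. ((of_nat (Suc d)) ^ Suc (Suc k) - of_nat d ^ Suc (Suc k)) / (of_nat d ^ Suc k :: complex))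
      \<longlonglongrightarrow> (1 + 0) * of_nat (Suc k) + (1 :: complex)"
    by (rule Lim_transform_eventually)
  then show ?case by (simp add: algebra_simps)
qed simp

text \<open>The Stolz-Cesaro theorem for the sequence of powers: subtracting the multiple of \<open>d\<^sup>k\<^sup>+\<^sup>1\<close> with the
  right increments leaves a sequence with increments of lower order.\<close>

lemma stolz_power:
  fixes a :: "nat \<Rightarrow> complex"
  assumes "(\<lambda>d. (a (Suc d) - a d) / of_nat d ^ k) \<longlonglongrightarrow> S"
  shows "(\<lambda>d. a d / of_nat d ^ Suc k) \<longlonglongrightarrow> S / of_nat (Suc k)"
proof -
  define s where "s = S / of_nat (Suc k)"
  define b where "b = (\<lambda>d. a d - s * of_nat d ^ Suc k)"
  define f where "f = (\<lambda>d. (b (Suc d) - b d) / of_nat d ^ k)"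
  have f: "f \<longlonglongrightarrow> 0"
  proof -
    have "(\<lambda>d. (a (Suc d) - a d) / of_nat d ^ k -
        s * (((of_nat (Suc d)) ^ Suc k - of_nat d ^ Suc k) / of_nat d ^ k)) \<longlonglongrightarrow> S - s * of_nat (Suc k)"
      by (intro tendsto_diff tendsto_mult tendsto_const assms power_diff_limit)
    moreover have "S - s * of_nat (Suc k) = 0" by (simp add: s_def del: of_nat_Suc)
    moreover have "(a (Suc d) - a d) / of_nat d ^ k -
        s * (((of_nat (Suc d)) ^ Suc k - of_nat d ^ Suc k) / of_nat d ^ k) = f d" for d
      by (simp add: f_def b_def diff_divide_distrib right_diff_distrib del: of_nat_Suc power_Suc)
    ultimately show ?thesis by simp
  qed
  \<comment> \<open>The sum starts at \<open>1\<close>, since division by \<open>0\<^sup>k\<close> loses the increment at \<open>0\<close>.\<close>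
  have b: "b d = b 1 + (\<Sum>i=1..<d. of_nat i ^ k * f i)" if "d \<ge> 1" for d
  proof -
    have "(\<Sum>i=1..<d. of_nat i ^ k * f i) = (\<Sum>i=1..<d. b (Suc i) - b i)"
      by (rule sum.cong) (auto simp: f_def)
    also have "\<dots> = b d - b 1" using that by (rule sum_Suc_diff')
    finally show ?thesis by simp
  qed
  have bound: "norm (b d / of_nat d ^ Suc k) \<le> norm (b 1) / real d + (\<Sum>i<d. norm (f i)) / real d"
    if d: "d \<ge> 1" for d
  proof -
    have dk: "1 \<le> real d ^ k" using d by simp
    have "norm (b d) \<le> norm (b 1) + (\<Sum>i=1..<d. norm (of_nat i ^ k * f i))"
      unfolding b[OF d] by (intro order_trans[OF norm_triangle_ineq] add_left_mono norm_sum)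
    also have "(\<Sum>i=1..<d. norm (of_nat i ^ k * f i)) \<le> (\<Sum>i=1..<d. real d ^ k * norm (f i))"
      by (intro sum_mono) (auto simp: norm_mult norm_power intro!: mult_right_mono power_mono)
    also have "\<dots> \<le> (\<Sum>i<d. real d ^ k * norm (f i))"
      by (rule sum_mono2) auto
    also have "norm (b 1) \<le> real d ^ k * norm (b 1)"
      using mult_right_mono[OF dk, of "norm (b 1)"] by simp
    finally have "norm (b d) \<le> real d ^ k * (norm (b 1) + (\<Sum>i<d. norm (f i)))"
      by (simp add: sum_distrib_left distrib_left)
    then have "norm (b d) / real d ^ Suc k \<le> real d ^ k * (norm (b 1) + (\<Sum>i<d. norm (f i))) / real d ^ Suc k"
      by (rule divide_right_mono) simp
    also have "\<dots> = (norm (b 1) + (\<Sum>i<d. norm (f i))) / real d"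
      using d by simp
    finally show ?thesis by (simp add: norm_divide norm_power norm_mult add_divide_distrib)
  qed
  have "(\<lambda>d. norm (b 1) * (1 / real d) + (\<Sum>i<d. norm (f i)) / real d) \<longlonglongrightarrow> norm (b 1) * 0 + 0"
    using f by (intro tendsto_add tendsto_mult tendsto_const lim_1_over_n cesaro_null)
      (auto intro: tendsto_norm_zero)
  then have "(\<lambda>d. norm (b 1) / real d + (\<Sum>i<d. norm (f i)) / real d) \<longlonglongrightarrow> 0"
    by simp
  moreover have "\<forall>\<^sub>F d in sequentially.
      norm (b d / of_nat d ^ Suc k) \<le> norm (b 1) / real d + (\<Sum>i<d. norm (f i)) / real d"
    using eventually_ge_at_top[of 1] by eventually_elim (rule bound)
  ultimately have "(\<lambda>d. b d / of_nat d ^ Suc k) \<longlonglongrightarrow> 0"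
    by (rule Lim_null_comparison[rotated])
  then have "(\<lambda>d. b d / of_nat d ^ Suc k + s) \<longlonglongrightarrow> 0 + s"
    by (intro tendsto_add tendsto_const)
  moreover have "\<forall>\<^sub>F d in sequentially. b d / of_nat d ^ Suc k + s = a d / of_nat d ^ Suc k"
    using eventually_gt_at_top[of 0] by eventually_elim (simp add: b_def field_simps)
  ultimately have "(\<lambda>d. a d / of_nat d ^ Suc k) \<longlonglongrightarrow> 0 + s"
    by (rule Lim_transform_eventually)
  then show ?thesis by (simp add: s_def)
qed

lemma scaled_limit_lower:
  fixes x :: "nat \<Rightarrow> complex"
  assumes "(\<lambda>d. x d / of_nat d ^ e) \<longlonglongrightarrow> \<gamma>"
  shows "(\<lambda>d. x d / of_nat d ^ Suc e) \<longlonglongrightarrow> 0"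
proof -
  have "(\<lambda>d. x d / of_nat d ^ e * (1 / of_nat d)) \<longlonglongrightarrow> \<gamma> * 0"
    by (intro tendsto_mult assms lim_1_over_n)
  then show ?thesis by (simp add: mult.commute)
qed

abbreviation plains :: "star_word \<Rightarrow> nat" where
  "plains p \<equiv> count_list p Plain"

lemma count_list_replicate: "count_list (replicate n x) y = (if x = y then n else 0)"
  by (induction n) auto

lemma plains_pair_word: "plains (pair_word kls) = sum_list (map fst kls)"
  by (induction kls) (auto simp: count_list_replicate)

text \<open>A trace of a word with \<open>m\<close> letters \<open>Plain\<close> is expected to grow like the power \<open>m + 1\<close> of \<open>d\<close>:
  one factor for each pair of entries that match and one for the remaining free index. The same
  holds for a quadratic form in an additional column.\<close>

definition scale_exponent :: "star_word list \<Rightarrow> nat" where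
  "scale_exponent ps = (\<Sum>p\<leftarrow>ps. Suc (plains p))"

definition closed_product :: "nat \<Rightarrow> star_word list \<Rightarrow> wick_poly" where
  "closed_product d ps = (\<Prod>p\<leftarrow>ps. walk_trace gen d p)"

definition open_product :: "nat \<Rightarrow> star_word list \<Rightarrow> wick_poly" where
  "open_product d qs = (\<Prod>q\<leftarrow>qs. open_trace d q)"

lemma scale_exponent_simps [simp]:
  "scale_exponent [] = 0" "scale_exponent (p # ps) = Suc (plains p) + scale_exponent ps"
  by (simp_all add: scale_exponent_def)

lemma closed_product_simps [simp]:
  "closed_product d [] = 1" "closed_product d (p # ps) = walk_trace gen d p * closed_product d ps"
  by (simp_all add: closed_product_def)

lemma open_product_simps [simp]:
  "open_product d [] = 1" "open_product d (q # qs) = open_trace d q * open_product d qs"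
  by (simp_all add: open_product_def)

lemma scale_exponent_update:
  assumes "k < length qs"
  shows "scale_exponent (qs[k := qs ! k @ q]) = scale_exponent qs + plains q"
  using assms
proof (induction qs arbitrary: k)
  case (Cons p qs)
  then show ?case by (cases k) auto
qed simp

text \<open>The leading coefficient of \<open>excursion\<close>, if \<open>c\<close> gives the leading coefficients of the traces.\<close>

definition excursion_weight :: "(star_word \<Rightarrow> complex) \<Rightarrow> nat \<Rightarrow> (nat \<times> nat) list \<Rightarrow> nat \<Rightarrow> complex" where
  "excursion_weight c l zs k =
     (if zs = [] \<and> l = 0 \<and> k = 0 then 1
      else if l \<noteq> 0 \<and> k \<noteq> 0
        then c (replicate (l - 1) Star @ pair_word zs @ replicate (k - 1) Plain)
      else 0)"

abbreviation fst_sum :: "(nat \<times> nat) list \<Rightarrow> nat" where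
  "fst_sum kls \<equiv> sum_list (map fst kls)"

context
  fixes c :: "star_word \<Rightarrow> complex"
  assumes c_limit: "\<And>p. (\<lambda>d. expectation (walk_trace gen d p) / of_nat d ^ Suc (plains p)) \<longlonglongrightarrow> c p"
begin

abbreviation c_prod :: "star_word list \<Rightarrow> complex" where
  "c_prod ps \<equiv> prod_list (map c ps)"

text \<open>Asymptotic factorization of expected products of traces, for powers of \<open>d\<close> below \<open>N\<close>.\<close>

definition factorizes :: "nat \<Rightarrow> bool" where
  "factorizes N \<longleftrightarrow> (\<forall>ps. scale_exponent ps < N \<longrightarrow>
     (\<lambda>d. expectation (closed_product d ps) / of_nat d ^ scale_exponent ps) \<longlonglongrightarrow> c_prod ps)"

lemma deriv_plain_closed_product: "deriv_plain (a, d) (closed_product d ps) = 0"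
  by (induction ps) (auto simp: deriv_plain_mult deriv_plain_walk_trace)

text \<open>In \<open>expectation_open_trace\<close> closing up a word preserves the power of \<open>d\<close>, while merging two words
  lowers it by one. Hence to leading order quadratic forms behave like traces.\<close>

lemma wick_limit:
  assumes N: "factorizes N" and "scale_exponent ps + scale_exponent qs < N"
  shows "(\<lambda>d. expectation (closed_product d ps * open_product d qs) /
      of_nat d ^ (scale_exponent ps + scale_exponent qs)) \<longlonglongrightarrow> c_prod ps * c_prod qs"
  using assms(2)
proof (induction "length qs" arbitrary: ps qs)
  case 0
  then show ?case using N by (simp add: factorizes_def)
next
  case (Suc m)
  then obtain q qs' where qs: "qs = q # qs'" and m: "m = length qs'"
    by (cases qs) auto
  let ?e = "scale_exponent ps + scale_exponent qs"
  have 1: "(\<lambda>d. expectation (closed_product d ps * (walk_trace gen d q * open_product d qs')) / of_nat d ^ ?e)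
      \<longlonglongrightarrow> c_prod ps * c_prod qs"
    using Suc.hyps(1)[of qs' "q # ps"] Suc.prems m by (simp add: qs ac_simps)
  \<comment> \<open>Merging loses one power of \<open>d\<close>.\<close>
  have 2: "(\<lambda>d. expectation (closed_product d ps * open_product d (qs'[k := qs' ! k @ q])) / of_nat d ^ ?e) \<longlonglongrightarrow> 0"
    if k: "k < length qs'" for k
  proof -
    have e: "?e = Suc (scale_exponent ps + scale_exponent (qs'[k := qs' ! k @ q]))"
      by (simp add: qs scale_exponent_update[OF k])
    show ?thesis
      unfolding e
      by (rule scaled_limit_lower, rule Suc.hyps(1)) (use Suc.prems e m in auto)
  qed
  have "(\<lambda>d. expectation (closed_product d ps * (walk_trace gen d q * open_product d qs')) / of_nat d ^ ?e +
      (\<Sum>k<length qs'. expectation (closed_product d ps * open_product d (qs'[k := qs' ! k @ q])) / of_nat d ^ ?e))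
      \<longlonglongrightarrow> c_prod ps * c_prod qs + (\<Sum>k<length qs'. 0)"
    by (intro tendsto_add tendsto_sum 1 2) auto
  moreover have "expectation (closed_product d ps * open_product d qs) =
      expectation (closed_product d ps * (walk_trace gen d q * open_product d qs')) +
      (\<Sum>k<length qs'. expectation (closed_product d ps * open_product d (qs'[k := qs' ! k @ q])))" for d
    using expectation_open_trace[where d = d and X = "closed_product d ps" and q = q and qs = qs'] deriv_plain_closed_product
    by (simp add: qs open_product_def)
  ultimately show ?case by (simp add: add_divide_distrib sum_divide_distrib)
qed

text \<open>In expectations, the sequence \<open>x\<close> may be replaced by \<open>\<gamma> d\<^sup>e\<close> to leading order, also in the presence of
  further traces and quadratic forms, as long as the total power of \<open>d\<close> is below \<open>N\<close>. The additional
  factors are part of the notion since the expectation is not multiplicative.\<close>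

definition asym :: "nat \<Rightarrow> (nat \<Rightarrow> wick_poly) \<Rightarrow> nat \<Rightarrow> complex \<Rightarrow> bool" where
  "asym N x e \<gamma> \<longleftrightarrow> (\<forall>ps qs. e + scale_exponent ps + scale_exponent qs < N \<longrightarrow>
     (\<lambda>d. expectation (x d * closed_product d ps * open_product d qs) /
        of_nat d ^ (e + scale_exponent ps + scale_exponent qs)) \<longlonglongrightarrow> \<gamma> * c_prod ps * c_prod qs)"

lemma asym_one: "factorizes N \<Longrightarrow> asym N (\<lambda>_. 1) 0 1"
  using wick_limit by (simp add: asym_def)

lemma asym_zero: "asym N (\<lambda>_. 0) e 0"
  by (simp add: asym_def)

lemma asym_add:
  assumes "asym N x e \<gamma>" and "asym N y e \<delta>"
  shows "asym N (\<lambda>d. x d + y d) e (\<gamma> + \<delta>)"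
  unfolding asym_def
proof (intro allI impI)
  fix ps qs
  assume lt: "e + scale_exponent ps + scale_exponent qs < N"
  have "(\<lambda>d. expectation (x d * closed_product d ps * open_product d qs) / of_nat d ^ (e + scale_exponent ps + scale_exponent qs) +
      expectation (y d * closed_product d ps * open_product d qs) / of_nat d ^ (e + scale_exponent ps + scale_exponent qs))
    \<longlonglongrightarrow> \<gamma> * c_prod ps * c_prod qs + \<delta> * c_prod ps * c_prod qs"
    by (rule tendsto_add) (use assms lt in \<open>auto simp: asym_def\<close>)
  then show "(\<lambda>d. expectation ((x d + y d) * closed_product d ps * open_product d qs) /
      of_nat d ^ (e + scale_exponent ps + scale_exponent qs)) \<longlonglongrightarrow> (\<gamma> + \<delta>) * c_prod ps * c_prod qs"
    by (simp add: distrib_right expectation_add add_divide_distrib)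
qed

lemma asym_lower:
  assumes "asym N x e \<gamma>"
  shows "asym N x (Suc e) 0"
  unfolding asym_def add_Suc mult_zero_left
  by (intro allI impI, rule scaled_limit_lower, rule assms[unfolded asym_def, rule_format]) simp

text \<open>An additional trace is absorbed into the list of traces that the notion allows.\<close>

lemma asym_closed:
  assumes "asym N x e \<gamma>"
  shows "asym N (\<lambda>d. walk_trace gen d p * x d) (Suc (plains p) + e) (c p * \<gamma>)"
  unfolding asym_def
proof (intro allI impI)
  fix ps qs
  assume "Suc (plains p) + e + scale_exponent ps + scale_exponent qs < N"
  then show "(\<lambda>d. expectation (walk_trace gen d p * x d * closed_product d ps * open_product d qs) /
      of_nat d ^ (Suc (plains p) + e + scale_exponent ps + scale_exponent qs)) \<longlonglongrightarrow> c p * \<gamma> * c_prod ps * c_prod qs"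
    using assms[unfolded asym_def, rule_format, of "p # ps" qs] by (simp add: ac_simps)
qed

lemma asym_open:
  assumes "asym N x e \<gamma>"
  shows "asym N (\<lambda>d. open_trace d q * x d) (Suc (plains q) + e) (c q * \<gamma>)"
  unfolding asym_def
proof (intro allI impI)
  fix ps qs
  assume "Suc (plains q) + e + scale_exponent ps + scale_exponent qs < N"
  then show "(\<lambda>d. expectation (open_trace d q * x d * closed_product d ps * open_product d qs) /
      of_nat d ^ (Suc (plains q) + e + scale_exponent ps + scale_exponent qs)) \<longlonglongrightarrow> c q * \<gamma> * c_prod ps * c_prod qs"
    using assms[unfolded asym_def, rule_format, of ps "q # qs"] by (simp add: ac_simps)
qed

lemma asym_closed_product:
  assumes "asym N x e \<gamma>"
  shows "asym N (\<lambda>d. closed_product d ps * x d) (scale_exponent ps + e) (c_prod ps * \<gamma>)"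
proof (induction ps)
  case (Cons p ps)
  show ?case using asym_closed[OF Cons.IH, of p] by (simp add: mult.assoc add.assoc)
qed (use assms in simp)

lemma asym_excursion:
  assumes "asym N x e \<gamma>"
  shows "asym N (\<lambda>d. excursion d l zs k * x d) (fst_sum zs + k + e) (excursion_weight c l zs k * \<gamma>)"
proof (cases "l \<noteq> 0 \<and> k \<noteq> 0")
  case True
  let ?q = "replicate (l - 1) Star @ pair_word zs @ replicate (k - 1) Plain"
  have e: "Suc (plains ?q) + e = fst_sum zs + k + e"
    using True by (simp add: count_list_replicate plains_pair_word)
  show ?thesis using True asym_open[OF assms, of ?q, unfolded e]
    by (simp add: excursion_def excursion_weight_def)
next
  case False
  then show ?thesis
    using assms asym_zero[of N "fst_sum zs + k + e"] by (auto simp: excursion_def excursion_weight_def)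
qed

lemma asym_visits_from:
  assumes "asym N x e \<gamma>"
  shows "asym N (\<lambda>d. visits_from (excursion d) l zs ys xs k * x d)
    (fst_sum zs + fst_sum ys + fst_sum xs + k + e) (visits_from (excursion_weight c) l zs ys xs k * \<gamma>)"
  using assms
proof (induction ys arbitrary: l zs x e \<gamma>)
  case Nil
  show ?case using asym_excursion[OF Nil, of l "zs @ xs" k] by simp
next
  case (Cons y ys)
  obtain k' l' where y: "y = (k', l')" by force
  have 1: "asym N (\<lambda>d. visits_from (excursion d) l (zs @ [y]) ys xs k * x d)
      (fst_sum zs + fst_sum (y # ys) + fst_sum xs + k + e) (visits_from (excursion_weight c) l (zs @ [y]) ys xs k * \<gamma>)"
    using Cons.IH[OF Cons.prems, of l "zs @ [y]"] by (simp add: ac_simps)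
  have 2: "asym N (\<lambda>d. excursion d l zs k' * (visits_from (excursion d) l' [] ys xs k * x d))
      (fst_sum zs + fst_sum (y # ys) + fst_sum xs + k + e)
      (excursion_weight c l zs k' * (visits_from (excursion_weight c) l' [] ys xs k * \<gamma>))"
    using asym_excursion[OF Cons.IH[OF Cons.prems, of l' "[]"], of l zs k'] by (simp add: y ac_simps)
  show ?case using asym_add[OF 1 2] by (simp add: y algebra_simps)
qed

lemma asym_visits:
  assumes "asym N x e \<gamma>"
  shows "asym N (\<lambda>d. visits (excursion d) xs ys * x d)
    (fst_sum xs + fst_sum ys + e) (visits (excursion_weight c) xs ys * \<gamma>)"
proof (induction ys arbitrary: xs)
  case Nil
  show ?case using asym_zero by simp
next
  case (Cons y ys)
  obtain k l where y: "y = (k, l)" by force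
  have 1: "asym N (\<lambda>d. visits (excursion d) (xs @ [y]) ys * x d)
      (fst_sum xs + fst_sum (y # ys) + e) (visits (excursion_weight c) (xs @ [y]) ys * \<gamma>)"
    using Cons.IH[of "xs @ [y]"] by (simp add: ac_simps)
  have 2: "asym N (\<lambda>d. visits_from (excursion d) l [] ys xs k * x d)
      (fst_sum xs + fst_sum (y # ys) + e) (visits_from (excursion_weight c) l [] ys xs k * \<gamma>)"
    using asym_visits_from[OF assms, of l "[]" ys xs k] by (simp add: y ac_simps)
  show ?case using asym_add[OF 1 2] by (simp add: y algebra_simps)
qed

text \<open>The leading coefficient of the increment of a product of traces: to leading order the product rule
  holds.\<close>

primrec increment_limit :: "(nat \<times> nat) list list \<Rightarrow> complex" where
  "increment_limit [] = 0"
| "increment_limit (kls # klss) =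
     visits (excursion_weight c) [] kls * c_prod (map pair_word klss) + c (pair_word kls) * increment_limit klss"

text \<open>Expand the increment of a product as in the product rule. The term in which both factors change is
  of lower order, because each increment lowers the power of \<open>d\<close> by one.\<close>

lemma asym_increment:
  assumes x: "asym N x e \<gamma>" and "\<forall>kls\<in>set klss. kls \<noteq> []"
  defines "P \<equiv> \<lambda>klss. map pair_word klss"
  shows "asym N (\<lambda>d. (closed_product (Suc d) (P klss) - closed_product d (P klss)) * x d)
    (scale_exponent (P klss) - 1 + e) (increment_limit klss * \<gamma>)"
  using assms(2)
proof (induction klss)
  case Nil
  show ?case using asym_zero by (simp add: P_def)
next
  case (Cons kls klss)
  let ?ps = "P klss" and ?p = "pair_word kls"
  let ?Y = "\<lambda>d. closed_product (Suc d) ?ps - closed_product d ?ps"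
  let ?X = "\<lambda>d. visits (excursion d) [] kls"
  let ?e = "scale_exponent (P (kls # klss)) - 1 + e"
  have e: "?e = fst_sum kls + (scale_exponent ?ps + e)"
    by (simp add: P_def plains_pair_word)
  have IH: "asym N (\<lambda>d. ?Y d * x d) (scale_exponent ?ps - 1 + e) (increment_limit klss * \<gamma>)"
    using Cons by simp
  have 1: "asym N (\<lambda>d. ?X d * (closed_product d ?ps * x d)) ?e
      (visits (excursion_weight c) [] kls * (c_prod ?ps * \<gamma>))"
    using asym_visits[OF asym_closed_product[OF x, of ?ps], of "[]" kls] unfolding e by simp
  \<comment> \<open>Both factors change: the power of \<open>d\<close> is one too small.\<close>
  have 2: "asym N (\<lambda>d. ?X d * (?Y d * x d)) ?e 0"
  proof (cases klss)
    case Nil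
    then show ?thesis using asym_zero by (simp add: P_def)
  next
    case (Cons kls' klss')
    then have e': "Suc (fst_sum [] + fst_sum kls + (scale_exponent ?ps - 1 + e)) = ?e"
      by (simp add: P_def plains_pair_word)
    show ?thesis
      using asym_lower[OF asym_visits[OF IH, of "[]" kls]] unfolding e' .
  qed
  have 3: "asym N (\<lambda>d. walk_trace gen d ?p * (?Y d * x d)) ?e (c ?p * (increment_limit klss * \<gamma>))"
  proof (cases klss)
    case Nil
    then show ?thesis using asym_zero by (simp add: P_def)
  next
    case (Cons kls' klss')
    then have e': "Suc (plains ?p) + (scale_exponent ?ps - 1 + e) = ?e"
      by (simp add: P_def plains_pair_word)
    show ?thesis
      using asym_closed[OF IH, of ?p] unfolding e' .
  qed
  have "asym N (\<lambda>d. ?X d * (closed_product d ?ps * x d) + ?X d * (?Y d * x d) + walk_trace gen d ?p * (?Y d * x d)) ?e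
      (visits (excursion_weight c) [] kls * (c_prod ?ps * \<gamma>) + 0 + c ?p * (increment_limit klss * \<gamma>))"
    by (intro asym_add 1 2 3)
  moreover have "?X d * (closed_product d ?ps * x d) + ?X d * (?Y d * x d) + walk_trace gen d ?p * (?Y d * x d) =
      (closed_product (Suc d) (P (kls # klss)) - closed_product d (P (kls # klss))) * x d" for d
    using walk_trace_Suc[of kls d] Cons.prems by (simp add: P_def algebra_simps)
  moreover have "visits (excursion_weight c) [] kls * (c_prod ?ps * \<gamma>) + 0 + c ?p * (increment_limit klss * \<gamma>) =
      increment_limit (kls # klss) * \<gamma>"
    by (simp add: P_def algebra_simps)
  ultimately show ?case by simp
qed

text \<open>The increments have a power of \<open>d\<close> below \<open>N\<close>, where factorization is already known; summing them
  reaches the power \<open>N\<close>.\<close>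

lemma closed_product_limit:
  assumes N: "factorizes N" and "\<forall>kls\<in>set klss. kls \<noteq> []" and "klss \<noteq> []"
    and "scale_exponent (map pair_word klss) \<le> N"
  defines "e \<equiv> scale_exponent (map pair_word klss)"
  shows "(\<lambda>d. expectation (closed_product d (map pair_word klss)) / of_nat d ^ e) \<longlonglongrightarrow>
    increment_limit klss / of_nat e"
proof -
  obtain k where k: "e = Suc k" using assms(3) by (cases klss) (auto simp: e_def)
  have "(\<lambda>d. (expectation (closed_product (Suc d) (map pair_word klss)) -
      expectation (closed_product d (map pair_word klss))) / of_nat d ^ k) \<longlonglongrightarrow> increment_limit klss"
    using asym_increment[OF asym_one[OF N] assms(2), unfolded asym_def, rule_format, of "[]" "[]"]
      assms(4) k by (simp add: e_def[symmetric] expectation_diff)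
  then show ?thesis unfolding k by (rule stolz_power)
qed

text \<open>For a single trace the limit is known to be \<open>c\<close>, so comparing it with the limit computed from the
  increments gives an equation for \<open>c\<close>.\<close>

lemma visits_excursion_weight:
  assumes "factorizes (Suc (fst_sum kls))" and "kls \<noteq> []"
  shows "visits (excursion_weight c) [] kls = of_nat (Suc (fst_sum kls)) * c (pair_word kls)"
proof -
  let ?n = "Suc (fst_sum kls)"
  have "(\<lambda>d. expectation (walk_trace gen d (pair_word kls)) / of_nat d ^ ?n) \<longlonglongrightarrow>
      visits (excursion_weight c) [] kls / of_nat ?n"
    using closed_product_limit[OF assms(1), of "[kls]"] assms(2)
    by (simp add: plains_pair_word del: of_nat_Suc power_Suc)
  moreover have "(\<lambda>d. expectation (walk_trace gen d (pair_word kls)) / of_nat d ^ ?n) \<longlonglongrightarrow> c (pair_word kls)"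
    using c_limit[of "pair_word kls"] by (simp add: plains_pair_word)
  ultimately have "visits (excursion_weight c) [] kls / of_nat ?n = c (pair_word kls)"
    by (rule LIMSEQ_unique)
  then show ?thesis by (simp add: field_simps del: of_nat_Suc)
qed

text \<open>Empty powers are allowed in the blocks, so every word can be written in this form.\<close>

lemma ex_pair_word: "\<exists>kls. kls \<noteq> [] \<and> pair_word kls = p"
proof (induction p)
  case Nil
  show ?case by (rule exI[of _ "[(0, 0)]"]) simp
next
  case (Cons a p)
  then obtain kls where "kls \<noteq> []" "pair_word kls = p" by blast
  then show ?case
    by (intro exI[of _ "(case a of Plain \<Rightarrow> (1, 0) | Star \<Rightarrow> (0, 1)) # kls"]) (cases a; simp)
qed

text \<open>By the equations for single traces, the leading coefficient of the increments of a product of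
  traces is its total power of \<open>d\<close> times the product of the moments; summation divides by that power.\<close>

lemma factorizes_all: "factorizes N"
proof (induction N)
  case 0
  show ?case by (simp add: factorizes_def)
next
  case (Suc N)
  have "(\<lambda>d. expectation (closed_product d ps) / of_nat d ^ scale_exponent ps) \<longlonglongrightarrow> c_prod ps"
    if ps: "scale_exponent ps = N" for ps
  proof (cases "ps = []")
    case True
    then show ?thesis by (simp add: expectation_1)
  next
    case False
    have "\<exists>klss. (\<forall>kls\<in>set klss. kls \<noteq> []) \<and> map pair_word klss = ps" for ps
    proof (induction ps)
      case (Cons p ps)
      then obtain klss kls where "\<forall>kls\<in>set klss. kls \<noteq> []" "map pair_word klss = ps"
        "kls \<noteq> []" "pair_word kls = p"
        using ex_pair_word by metis
      then show ?case by (intro exI[of _ "kls # klss"]) simp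
    qed simp
    then obtain klss where klss: "\<forall>kls\<in>set klss. kls \<noteq> []" "map pair_word klss = ps" by blast
    have "increment_limit klss' = of_nat (scale_exponent (map pair_word klss')) * c_prod (map pair_word klss')"
      if "\<forall>kls\<in>set klss'. kls \<noteq> []" "scale_exponent (map pair_word klss') \<le> N" for klss'
      using that
    proof (induction klss')
      case (Cons kls klss')
      have "factorizes (Suc (fst_sum kls))"
        using Suc.IH Cons.prems by (auto simp: factorizes_def plains_pair_word)
      then have "visits (excursion_weight c) [] kls = of_nat (Suc (fst_sum kls)) * c (pair_word kls)"
        using Cons.prems by (intro visits_excursion_weight) auto
      then show ?case using Cons by (simp add: plains_pair_word algebra_simps)
    qed simp
    from this[OF klss(1)] have "increment_limit klss = of_nat N * c_prod ps"
      using ps klss(2) by simp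
    moreover have "N \<noteq> 0" using False ps by (cases ps) auto
    ultimately show ?thesis
      using closed_product_limit[OF Suc.IH klss(1)] klss(2) False ps by auto
  qed
  with Suc.IH show ?case by (auto simp: factorizes_def less_Suc_eq)
qed

text \<open>The expected trace grows like \<open>c d\<^sup>m\<^sup>+\<^sup>1\<close> and hence in steps of size \<open>(m + 1) c d\<^sup>m\<close>. By
  \<open>walk_trace_Suc\<close> the steps are sums over the nonempty sets of visited gaps, in which each stretch
  contributes the moment of a shorter word to leading order.\<close>

theorem moment_recursion:
  assumes "kls \<noteq> []"
  shows "of_nat (Suc (fst_sum kls)) * c (pair_word kls) = visits (excursion_weight c) [] kls"
  using visits_excursion_weight[OF factorizes_all assms] by simp

end

section \<open>Sums over sets of visits\<close>

context
  fixes s :: "nat \<Rightarrow> (nat \<times> nat) list \<Rightarrow> nat \<Rightarrow> 'r::comm_ring_1"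
    and K L :: "nat \<Rightarrow> nat" and n :: nat
begin

text \<open>Block \<open>t\<close> has \<open>K t\<close> rising and \<open>L t\<close> falling letters, for \<open>1 \<le> t \<le> n\<close>. The inner
  stretch leads from gap \<open>a\<close> to gap \<open>b\<close>, the outer one from the last gap \<open>a\<close> around to the first
  gap \<open>f\<close>.\<close>

definition inner_weight :: "nat \<Rightarrow> nat \<Rightarrow> 'r" where
  "inner_weight a b = s (L a) (map (\<lambda>t. (K t, L t)) [Suc a..<b]) (K b)"

definition outer_weight :: "nat \<Rightarrow> nat \<Rightarrow> 'r" where
  "outer_weight f a =
     s (L a) (map (\<lambda>t. (K t, L t)) [Suc a..<Suc n] @ map (\<lambda>t. (K t, L t)) [1..<f]) (K f)"

text \<open>The first gap \<open>f\<close> of the whole set is remembered, for the outer stretch; \<open>a\<close> is the current gap.\<close>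

primrec visit_product :: "nat \<Rightarrow> nat \<Rightarrow> nat list \<Rightarrow> 'r" where
  "visit_product f a [] = outer_weight f a"
| "visit_product f a (b # js) = inner_weight a b * visit_product f b js"

definition visit_weight :: "nat list \<Rightarrow> 'r" where
  "visit_weight js = outer_weight (hd js) (last js) * (\<Prod>(a, b)\<leftarrow>zip js (tl js). inner_weight a b)"

lemma visit_product_eq: "visit_product f a js =
    outer_weight f (last (a # js)) * (\<Prod>(a, b)\<leftarrow>zip (a # js) js. inner_weight a b)"
  by (induction js arbitrary: a) (auto simp: mult.left_commute)

lemma visit_weight_Cons: "visit_weight (a # js) = visit_product a a js"
  by (simp add: visit_weight_def visit_product_eq)

lemma sorted_list_of_set_insert_less:
  assumes "finite J" and "\<And>x. x \<in> J \<Longrightarrow> a < x"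
  shows "sorted_list_of_set (insert a J) = a # sorted_list_of_set (J :: nat set)"
proof -
  have "sorted_list_of_set (insert a J) = insort a (sorted_list_of_set (J - {a}))"
    using assms by (simp add: sorted_list_of_set_insert_remove)
  also have "J - {a} = J" using assms by auto
  also have "insort a (sorted_list_of_set J) = a # sorted_list_of_set J"
    using assms by (intro insort_is_Cons) (auto intro: less_imp_le)
  finally show ?thesis .
qed

lemma visits_from_subsets:
  assumes "a < t" and "t \<le> Suc n"
  shows "visits_from s (L a) (map (\<lambda>t. (K t, L t)) [Suc a..<t]) (map (\<lambda>t. (K t, L t)) [t..<Suc n])
      (map (\<lambda>t. (K t, L t)) [1..<f]) (K f) =
    (\<Sum>J\<in>Pow {t..n}. visit_product f a (sorted_list_of_set J))"
  using assms(2,1)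
proof (induction t arbitrary: a rule: inc_induct)
  case base
  then show ?case by (simp add: outer_weight_def)
next
  case (step t)
  let ?pr = "\<lambda>t. (K t, L t)"
  have up: "[t..<Suc n] = t # [Suc t..<Suc n]" using step.hyps by (simp add: upt_rec)
  have snoc: "map ?pr [Suc a..<t] @ [(K t, L t)] = map ?pr [Suc a..<Suc t]"
    using step.prems by simp
  have "visits_from s (L a) (map ?pr [Suc a..<t]) (map ?pr [t..<Suc n]) (map ?pr [1..<f]) (K f) =
      visits_from s (L a) (map ?pr [Suc a..<Suc t]) (map ?pr [Suc t..<Suc n]) (map ?pr [1..<f]) (K f) +
      inner_weight a t * visits_from s (L t) (map ?pr [Suc t..<Suc t]) (map ?pr [Suc t..<Suc n]) (map ?pr [1..<f]) (K f)"
    unfolding up list.map visits_from.simps snoc inner_weight_def by simp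
  also have "\<dots> = (\<Sum>J\<in>Pow {Suc t..n}. visit_product f a (sorted_list_of_set J)) +
      inner_weight a t * (\<Sum>J\<in>Pow {Suc t..n}. visit_product f t (sorted_list_of_set J))"
    using step.prems by (subst (1 2) step.IH) auto
  also have "inner_weight a t * (\<Sum>J\<in>Pow {Suc t..n}. visit_product f t (sorted_list_of_set J)) =
      (\<Sum>J\<in>Pow {Suc t..n}. visit_product f a (sorted_list_of_set (insert t J)))"
    unfolding sum_distrib_left
  proof (rule sum.cong[OF refl])
    fix J assume J: "J \<in> Pow {Suc t..n}"
    then have "sorted_list_of_set (insert t J) = t # sorted_list_of_set J"
      by (intro sorted_list_of_set_insert_less) (auto intro: finite_subset)
    then show "inner_weight a t * visit_product f t (sorted_list_of_set J) =
        visit_product f a (sorted_list_of_set (insert t J))" by simp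
  qed
  also have "(\<Sum>J\<in>Pow {Suc t..n}. visit_product f a (sorted_list_of_set J)) +
      (\<Sum>J\<in>Pow {Suc t..n}. visit_product f a (sorted_list_of_set (insert t J))) =
      (\<Sum>J\<in>Pow {t..n}. visit_product f a (sorted_list_of_set J))"
  proof -
    have "{t..n} = insert t {Suc t..n}" using step.hyps by auto
    moreover have "Pow {Suc t..n} \<inter> insert t ` Pow {Suc t..n} = {}" by auto
    moreover have "inj_on (insert t) (Pow {Suc t..n})"
    proof (rule inj_onI)
      fix A B assume "A \<in> Pow {Suc t..n}" "B \<in> Pow {Suc t..n}" and eq: "insert t A = insert t B"
      then have "t \<notin> A" "t \<notin> B" by auto
      with eq show "A = B" by (simp add: insert_ident)
    qed
    ultimately show ?thesis
      by (simp add: Pow_insert sum.union_disjoint sum.reindex)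
  qed
  finally show ?case .
qed

text \<open>The recursion of \<open>visits\<close> decides for one gap after the other whether it belongs to the set.\<close>

lemma visits_subsets:
  assumes "1 \<le> f" and "f \<le> Suc n"
  shows "visits s (map (\<lambda>t. (K t, L t)) [1..<f]) (map (\<lambda>t. (K t, L t)) [f..<Suc n]) =
    (\<Sum>a=f..n. \<Sum>J\<in>Pow {Suc a..n}. visit_weight (a # sorted_list_of_set J))"
  using assms(2,1)
proof (induction f rule: inc_induct)
  case base
  then show ?case by simp
next
  case (step f)
  let ?pr = "\<lambda>t. (K t, L t)"
  have up: "[f..<Suc n] = f # [Suc f..<Suc n]" using step.hyps by (simp add: upt_rec)
  have snoc: "map ?pr [1..<f] @ [(K f, L f)] = map ?pr [1..<Suc f]"
    using step.prems by simp
  have set: "{f..n} = insert f {Suc f..n}" using step.hyps by auto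
  have "visits s (map ?pr [1..<f]) (map ?pr [f..<Suc n]) =
      visits s (map ?pr [1..<Suc f]) (map ?pr [Suc f..<Suc n]) +
      visits_from s (L f) (map ?pr [Suc f..<Suc f]) (map ?pr [Suc f..<Suc n]) (map ?pr [1..<f]) (K f)"
    unfolding up list.map visits.simps snoc by simp
  also have "\<dots> = (\<Sum>a=Suc f..n. \<Sum>J\<in>Pow {Suc a..n}. visit_weight (a # sorted_list_of_set J)) +
      (\<Sum>J\<in>Pow {Suc f..n}. visit_weight (f # sorted_list_of_set J))"
    using step by (subst visits_from_subsets) (auto simp: visit_weight_Cons)
  finally show ?case by (simp add: set add.commute)
qed

end

lemma sum_subsets_Min:
  fixes F :: "nat list \<Rightarrow> 'r::comm_monoid_add"
  shows "(\<Sum>a=1..n. \<Sum>J\<in>Pow {Suc a..n}. F (a # sorted_list_of_set J)) =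
    (\<Sum>J\<in>Pow {1..n} - {{}}. F (sorted_list_of_set J))"
proof -
  have "(\<Sum>a=1..n. \<Sum>J\<in>Pow {Suc a..n}. F (a # sorted_list_of_set J)) =
      (\<Sum>(a, J)\<in>(SIGMA a:{1..n}. Pow {Suc a..n}). F (a # sorted_list_of_set J))"
    by (rule sum.Sigma) auto
  also have "\<dots> = (\<Sum>J\<in>Pow {1..n} - {{}}. F (sorted_list_of_set J))"
  proof (rule sum.reindex_bij_witness[where i = "\<lambda>J. (Min J, J - {Min J})" and j = "\<lambda>(a, J). insert a J"], goal_cases)
    case (1 x)
    then obtain a J where x: "x = (a, J)" and J: "J \<subseteq> {Suc a..n}" by auto
    then have "finite J" by (auto intro: finite_subset)
    then have "Min (insert a J) = a" using J by (intro Min_eqI) auto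
    moreover have "a \<notin> J" using J by auto
    ultimately show ?case using x by simp
  next
    case (2 x)
    then show ?case by auto
  next
    case (3 J)
    then have "finite J" "J \<noteq> {}" by (auto intro: finite_subset)
    then show ?case by (auto simp: insert_absorb)
  next
    case (4 J)
    then have fin: "finite J" "J \<noteq> {}" by (auto intro: finite_subset)
    then have "Min J \<in> J" by simp
    moreover have J: "J \<subseteq> {1..n}" using 4 by simp
    ultimately have "Min J \<in> {1..n}" by blast
    moreover have "J - {Min J} \<subseteq> {Suc (Min J)..n}"
    proof
      fix x assume x: "x \<in> J - {Min J}"
      then have "Min J \<le> x" "x \<noteq> Min J" using fin by simp_all
      moreover have "x \<le> n" using x J by auto
      ultimately show "x \<in> {Suc (Min J)..n}" by simp
    qed
    ultimately show ?case by simp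
  next
    case (5 x)
    then obtain a J where x: "x = (a, J)" and J: "J \<subseteq> {Suc a..n}" by auto
    then have "sorted_list_of_set (insert a J) = a # sorted_list_of_set J"
      by (intro sorted_list_of_set_insert_less) (auto intro: finite_subset)
    then show ?case using x by simp
  qed
  finally show ?thesis .
qed

text \<open>A strictly increasing function on \<open>{1..r}\<close> is the enumeration of its range.\<close>

lemma sum_strict_mono_lists:
  fixes F :: "nat list \<Rightarrow> 'r::comm_monoid_add"
  shows "(\<Sum>r=2..n. \<Sum>j | j \<in> {1..r} \<rightarrow>\<^sub>E {1..n} \<and> strict_mono_on {1..r} j. F (map j [1..<Suc r])) =
    (\<Sum>J | J \<subseteq> {1..n} \<and> 2 \<le> card J. F (sorted_list_of_set J))"
proof -
  let ?S = "\<lambda>r::nat. {j::nat \<Rightarrow> nat. j \<in> {1..r} \<rightarrow>\<^sub>E {1..n} \<and> strict_mono_on {1..r} j}"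
  have fin: "finite (?S r)" for r
    by (rule finite_subset[of _ "{1..r} \<rightarrow>\<^sub>E {1..n}"], blast, rule finite_PiE) auto
  have sl: "sorted_list_of_set (j ` {1..r}) = map j [1..<Suc r]" and inj: "inj_on j {1..r}"
    if "j \<in> ?S r" for j r
  proof -
    have mono: "strict_mono_on {1..r} j" using that by simp
    show inj: "inj_on j {1..r}" by (rule strict_mono_on_imp_inj_on[OF mono])
    have "sorted_wrt (<) (map j [1..<Suc r])"
      using mono unfolding sorted_wrt_map
      by (intro sorted_wrt_mono_rel[OF _ sorted_wrt_upt]) (auto simp: strict_mono_on_def)
    then have "sorted (map j [1..<Suc r])" "distinct (map j [1..<Suc r])"
      by (simp_all add: strict_sorted_iff del: upt_Suc)
    then have "sorted_list_of_set (set (map j [1..<Suc r])) = map j [1..<Suc r]"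
      by (rule sorted_list_of_set.idem_if_sorted_distinct)
    moreover have "set (map j [1..<Suc r]) = j ` {1..r}" by (auto simp del: upt_Suc)
    ultimately show "sorted_list_of_set (j ` {1..r}) = map j [1..<Suc r]" by simp
  qed
  have "(\<Sum>r=2..n. \<Sum>j\<in>?S r. F (map j [1..<Suc r])) = (\<Sum>(r, j)\<in>(SIGMA r:{2..n}. ?S r). F (map j [1..<Suc r]))"
  proof (rule sum.Sigma)
    show "\<forall>r\<in>{2..n}. finite (?S r)" using fin by blast
  qed simp
  also have "\<dots> = (\<Sum>J | J \<subseteq> {1..n} \<and> 2 \<le> card J. F (sorted_list_of_set J))"
  proof (rule sum.reindex_bij_witness[where
        i = "\<lambda>J. (card J, \<lambda>i\<in>{1..card J}. sorted_list_of_set J ! (i - 1))" and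
        j = "\<lambda>(r, j). j ` {1..r}"], goal_cases)
    case (1 x)
    then obtain r j where x: "x = (r, j)" and j: "j \<in> ?S r" by auto
    have c: "card (j ` {1..r}) = r" using inj[OF j] by (simp add: card_image)
    have "(\<lambda>i\<in>{1..r}. map j [1..<Suc r] ! (i - 1)) = j"
    proof
      fix i
      show "(\<lambda>i\<in>{1..r}. map j [1..<Suc r] ! (i - 1)) i = j i"
      proof (cases "i \<in> {1..r}")
        case True
        then have "map j [1..<Suc r] ! (i - 1) = j (1 + (i - 1))"
          by (subst nth_map) (auto simp del: upt_Suc)
        then show ?thesis using True by simp
      next
        case False
        have "j \<in> {1..r} \<rightarrow>\<^sub>E {1..n}" using j by simp
        from PiE_arb[OF this False] False show ?thesis by (simp only: restrict_apply if_False)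
      qed
    qed
    then show ?case by (simp only: x prod.case c sl[OF j])
  next
    case (2 x)
    then obtain r j where x: "x = (r, j)" and r: "2 \<le> r" and j: "j \<in> ?S r" by auto
    have c: "card (j ` {1..r}) = r" using inj[OF j] by (simp add: card_image)
    moreover have "j ` {1..r} \<subseteq> {1..n}" using j by (auto dest: PiE_mem)
    ultimately show ?case using r by (simp only: x prod.case mem_Collect_eq simp_thms)
  next
    case (3 J)
    then have J: "finite J" "J \<subseteq> {1..n}" by (auto intro: finite_subset)
    have "(\<lambda>i\<in>{1..card J}. sorted_list_of_set J ! (i - 1)) ` {1..card J} = (\<lambda>i. sorted_list_of_set J ! (i - 1)) ` {1..card J}"
      by (rule image_cong) auto
    also have "\<dots> = (\<lambda>i. sorted_list_of_set J ! i) ` (\<lambda>i. i - 1) ` {1..card J}"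
      by (simp add: image_image)
    also have "(\<lambda>i. i - 1) ` {1..card J} = {..<card J}"
      by (auto simp: image_iff intro!: bexI[of _ "Suc _"])
    also have "(\<lambda>i. sorted_list_of_set J ! i) ` {..<card J} = set (sorted_list_of_set J)"
      using J by (auto simp: set_conv_nth)
    finally show ?case using J by simp
  next
    case (4 J)
    then have J: "finite J" "J \<subseteq> {1..n}" "2 \<le> card J" by (auto intro: finite_subset)
    have "card J \<le> n" using card_mono[OF _ J(2)] by simp
    moreover have "sorted_list_of_set J ! (i - 1) \<in> {1..n}" if "i \<in> {1..card J}" for i
    proof -
      have "sorted_list_of_set J ! (i - 1) \<in> set (sorted_list_of_set J)"
        using that J by (intro nth_mem) auto
      then show ?thesis using J by auto
    qed
    moreover have "strict_mono_on {1..card J} (\<lambda>i\<in>{1..card J}. sorted_list_of_set J ! (i - 1))"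
    proof (rule strict_mono_onI)
      fix p q assume "p \<in> {1..card J}" "q \<in> {1..card J}" "p < q"
      then show "(\<lambda>i\<in>{1..card J}. sorted_list_of_set J ! (i - 1)) p < (\<lambda>i\<in>{1..card J}. sorted_list_of_set J ! (i - 1)) q"
        using J sorted_wrt_nth_less[OF strict_sorted_list_of_set, of "p - 1" "q - 1" J] by auto
    qed
    ultimately show ?case using J by auto
  next
    case (5 x)
    then obtain r j where x: "x = (r, j)" and j: "j \<in> ?S r" by auto
    then show ?case using sl[OF j] by (simp del: upt_Suc)
  qed
  finally show ?thesis .
qed

text \<open>The singletons will give the sum on the left of the theorem, the larger sets its right side.\<close>

lemma sum_nonempty_subsets_split:
  fixes F :: "nat list \<Rightarrow> 'r::comm_monoid_add"
  shows "(\<Sum>J\<in>Pow {1..n} - {{}}. F (sorted_list_of_set J)) =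
    (\<Sum>i=1..n. F [i]) + (\<Sum>J | J \<subseteq> {1..n} \<and> 2 \<le> card J. F (sorted_list_of_set J))"
proof -
  have eq: "Pow {1..n} - {{}} = (\<lambda>i. {i}) ` {1..n} \<union> {J. J \<subseteq> {1..n} \<and> 2 \<le> card J}"
  proof (intro equalityI subsetI)
    fix J assume J: "J \<in> Pow {1..n} - {{}}"
    then have "finite J" by (auto intro: finite_subset)
    with J have "card J \<noteq> 0" by auto
    then consider "card J = 1" | "2 \<le> card J" by linarith
    then show "J \<in> (\<lambda>i. {i}) ` {1..n} \<union> {J. J \<subseteq> {1..n} \<and> 2 \<le> card J}"
      using J by cases (auto simp: card_1_singleton_iff)
  qed auto
  have fin: "finite {J. J \<subseteq> {1..n} \<and> 2 \<le> card J}"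
    by (rule finite_subset[of _ "Pow {1..n}"]) auto
  show ?thesis
    unfolding eq using fin
    by (subst sum.union_disjoint) (auto simp: sum.reindex)
qed

section \<open>Coefficients of series in several variables\<close>

abbreviation lookup where "lookup \<equiv> Poly_Mapping.lookup"
abbreviation keys where "keys \<equiv> Poly_Mapping.keys"
abbreviation single where "single \<equiv> Poly_Mapping.single"

lemma total_degree_add: "total_degree (a + b) = total_degree a + total_degree b"
  unfolding total_degree_def by (rule setsum_keys_plus_distrib) auto

lemma total_degree_single [simp]: "total_degree (single v k) = k"
  by (simp add: total_degree_def)

lemma total_degree_0 [simp]: "total_degree 0 = 0"
  by (simp add: total_degree_def)

lemma keys_add_nat: "keys (a + b :: 'v \<Rightarrow>\<^sub>0 nat) = keys a \<union> keys b"
  by (auto simp: in_keys_iff lookup_add)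

text \<open>Besides the set of variables, the evenness which \<open>\<odot>\<close> presupposes is recorded.\<close>

definition supported :: "'v set \<Rightarrow> ('v, 'a::comm_ring_1) mfps \<Rightarrow> bool" where
  "supported V f \<longleftrightarrow> (\<forall>m. mcoeff f m \<noteq> 0 \<longrightarrow> keys m \<subseteq> V \<and> even (total_degree m))"

text \<open>With this normalization the binomial coefficients in the definition of \<open>\<odot>\<close> disappear.\<close>

definition ncoeff :: "('v, complex) mfps \<Rightarrow> ('v \<Rightarrow>\<^sub>0 nat) \<Rightarrow> complex" where
  "ncoeff f m = mcoeff f m / fact (total_degree m div 2)"

lemma mcoeff_plus: "mcoeff (f + g) m = mcoeff f m + mcoeff g m"
  by (simp add: plus_mfps_def)

lemma mcoeff_minus: "mcoeff (f - g) m = mcoeff f m - mcoeff g m"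
  by (simp add: minus_mfps_def)

lemma mcoeff_zero: "mcoeff 0 m = 0"
  by (simp add: zero_mfps_def)

lemma mcoeff_one: "mcoeff 1 m = (if m = 0 then 1 else 0)"
  by (simp add: one_mfps_def)

lemma mcoeff_sum: "mcoeff (\<Sum>i\<in>I. f i) m = (\<Sum>i\<in>I. mcoeff (f i) m)"
  by (induction I rule: infinite_finite_induct) (auto simp: mcoeff_plus mcoeff_zero)

lemma mcoeff_mvar_mult_add: "mcoeff (mvar v * f) (single v 1 + m) = mcoeff f m"
proof -
  have "mcoeff (mvar v * f) (single v 1 + m) =
      (\<Sum>(a, b) | a + b = single v 1 + m. if a = single v 1 then mcoeff f b else 0)"
    unfolding times_mfps_def mvar_def mcoeff_Mfps by (rule sum.cong) auto
  also have "\<dots> = (\<Sum>(a, b) \<in> {(single v (1 :: nat), m)}. if a = single v 1 then mcoeff f b else 0)"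
    by (rule sum.mono_neutral_right) (auto simp: finite_add_eq split: if_splits)
  finally show ?thesis by simp
qed

lemma mcoeff_mvar_mult_0:
  assumes "lookup m v = 0"
  shows "mcoeff (mvar v * f) m = 0"
proof -
  have ne: "single v 1 + b \<noteq> m" for b
    using assms by (auto simp: lookup_add)
  show ?thesis
    unfolding times_mfps_def mvar_def mcoeff_Mfps
    by (rule sum.neutral) (use ne in auto)
qed

lemma mcoeff_mvar_mult:
  "mcoeff (mvar v * f) m = (if lookup m v = 0 then 0 else mcoeff f (m - single v 1))"
proof (cases "lookup m v = 0")
  case False
  then have "m = single v 1 + (m - single v 1)"
    by (intro poly_mapping_eqI) (auto simp: lookup_add lookup_minus lookup_single when_def)
  then show ?thesis using False mcoeff_mvar_mult_add[of v f "m - single v 1"] by simp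
qed (simp add: mcoeff_mvar_mult_0)

lemma supported_mono: "supported A f \<Longrightarrow> A \<subseteq> B \<Longrightarrow> supported B f"
  by (auto simp: supported_def)

lemma supported_one: "supported V 1"
  by (auto simp: supported_def mcoeff_one split: if_splits)

lemma supported_mvar_mult2:
  assumes "supported V f" and "x \<in> V" and "y \<in> V"
  shows "supported V (mvar x * mvar y * f)"
  unfolding supported_def
proof (intro allI impI)
  fix m assume nz: "mcoeff (mvar x * mvar y * f) m \<noteq> 0"
  let ?m1 = "m - single x 1" let ?m2 = "?m1 - single y 1"
  have 1: "lookup m x \<noteq> 0" "mcoeff (mvar y * f) ?m1 \<noteq> 0"
    using nz unfolding mult.assoc mcoeff_mvar_mult[of x] by (auto split: if_splits)
  then have 2: "lookup ?m1 y \<noteq> 0" "mcoeff f ?m2 \<noteq> 0"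
    unfolding mcoeff_mvar_mult[of y] by (auto split: if_splits)
  have m1: "m = single x 1 + ?m1"
    using 1(1) by (intro poly_mapping_eqI) (auto simp: lookup_add lookup_minus lookup_single when_def)
  have m2: "?m1 = single y 1 + ?m2"
    using 2(1) by (intro poly_mapping_eqI) (auto simp: lookup_add lookup_minus lookup_single when_def)
  have m: "m = single x 1 + (single y 1 + ?m2)" using m1 m2 by metis
  have "keys ?m2 \<subseteq> V" "even (total_degree ?m2)" using assms(1) 2(2) by (auto simp: supported_def)
  then show "keys m \<subseteq> V \<and> even (total_degree m)"
    using assms(2,3) by (subst (1 2) m) (simp only: keys_add_nat total_degree_add total_degree_single keys_single, simp)
qed

lemma odot_mcoeff:
  "mcoeff (f \<odot> g) m = (\<Sum>k\<le>total_degree m. \<Sum>l\<le>total_degree m. \<Sum>(a, b) | a + b = m.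
     of_nat ((k + l) choose k) *
       ((if total_degree a = 2 * k then mcoeff f a else 0) * (if total_degree b = 2 * l then mcoeff g b else 0)))"
  by (simp add: odot_def times_mfps_def homogeneous_part_def sum_distrib_left case_prod_unfold)

lemma supported_odot:
  assumes f: "supported A f" and g: "supported B g"
  shows "supported (A \<union> B) (f \<odot> g)"
  unfolding supported_def
proof (intro allI impI)
  fix m assume nz: "mcoeff (f \<odot> g) m \<noteq> 0"
  have "\<exists>a b. a + b = m \<and> mcoeff f a \<noteq> 0 \<and> mcoeff g b \<noteq> 0"
  proof (rule ccontr)
    assume "\<not> ?thesis"
    then have "mcoeff f a * mcoeff g b = 0" if "a + b = m" for a b
      using that by (metis mult_zero_left mult_zero_right)
    then have "mcoeff (f \<odot> g) m = 0"
      unfolding odot_mcoeff by (intro sum.neutral ballI) auto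
    with nz show False by simp
  qed
  then obtain a b where "a + b = m" "mcoeff f a \<noteq> 0" "mcoeff g b \<noteq> 0" by blast
  then show "keys m \<subseteq> A \<union> B \<and> even (total_degree m)"
    using f g by (fastforce simp: supported_def keys_add_nat total_degree_add)
qed

text \<open>A monomial splits in one way only into monomials in disjoint sets of variables, so that products
  of series in disjoint variables have coefficients with a single term.\<close>

lemma disjoint_keys_decomposition_unique:
  fixes a b a' b' :: "'v \<Rightarrow>\<^sub>0 nat"
  assumes "a + b = a' + b'" and "A \<inter> B = {}"
    and "keys a \<subseteq> A" "keys a' \<subseteq> A" "keys b \<subseteq> B" "keys b' \<subseteq> B"
  shows "a = a'" and "b = b'"
proof -
  show "a = a'"
  proof (rule poly_mapping_eqI)
    fix v
    have eq: "lookup a v + lookup b v = lookup a' v + lookup b' v"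
      using assms(1) by (metis lookup_add)
    show "lookup a v = lookup a' v"
    proof (cases "v \<in> A")
      case True
      then have "v \<notin> keys b" "v \<notin> keys b'" using assms by auto
      then show ?thesis using eq by (simp add: in_keys_iff)
    next
      case False
      then have "v \<notin> keys a" "v \<notin> keys a'" using assms by auto
      then show ?thesis by (simp add: in_keys_iff)
    qed
  qed
  with assms(1) show "b = b'" by simp
qed

text \<open>Only one term of the sum defining the coefficient survives, and its binomial coefficient is the
  quotient of the factorials in the normalization.\<close>

lemma ncoeff_odot:
  assumes f: "supported A f" and g: "supported B g" and "A \<inter> B = {}"
    and "keys a \<subseteq> A" and "keys b \<subseteq> B"
  shows "ncoeff (f \<odot> g) (a + b) = ncoeff f a * ncoeff g b"
proof -
  let ?t = "\<lambda>k l (a', b'). of_nat ((k + l) choose k) *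
    ((if total_degree a' = 2 * k then mcoeff f a' else 0) * (if total_degree b' = 2 * l then mcoeff g b' else 0))"
  have inner: "(\<Sum>p | fst p + snd p = a + b. ?t k l p) = ?t k l (a, b)" for k l
  proof -
    have "(\<Sum>p | fst p + snd p = a + b. ?t k l p) = (\<Sum>p\<in>{(a, b)}. ?t k l p)"
    proof (rule sum.mono_neutral_right)
      show "finite {p. fst p + snd p = a + b}"
        using finite_add_eq[of "a + b"] by (simp add: case_prod_unfold)
      show "\<forall>p\<in>{p. fst p + snd p = a + b} - {(a, b)}. ?t k l p = 0"
      proof
        fix p assume "p \<in> {p. fst p + snd p = a + b} - {(a, b)}"
        then obtain a' b' where p: "p = (a', b')" "a' + b' = a + b" "(a', b') \<noteq> (a, b)"
          by (cases p) auto
        have "mcoeff f a' = 0 \<or> mcoeff g b' = 0"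
        proof (rule ccontr)
          assume "\<not> ?thesis"
          then have "keys a' \<subseteq> A" "keys b' \<subseteq> B" using f g by (auto simp: supported_def)
          then have "a' = a" "b' = b"
            using disjoint_keys_decomposition_unique[OF p(2) assms(3)] assms(4,5) by auto
          with p show False by simp
        qed
        then show "?t k l p = 0" using p by auto
      qed
    qed simp
    then show ?thesis by simp
  qed
  let ?m = "a + b"
  have eq: "mcoeff (f \<odot> g) ?m = (\<Sum>k\<le>total_degree ?m. \<Sum>l\<le>total_degree ?m. ?t k l (a, b))"
    unfolding odot_mcoeff inner[symmetric] by (simp add: case_prod_unfold)
  show ?thesis
  proof (cases "mcoeff f a = 0 \<or> mcoeff g b = 0")
    case True
    then have "mcoeff (f \<odot> g) ?m = 0" unfolding eq by (intro sum.neutral ballI) auto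
    then show ?thesis using True by (auto simp: ncoeff_def)
  next
    case False
    then have "even (total_degree a)" "even (total_degree b)"
      using f g by (auto simp: supported_def)
    then obtain i j where ij: "total_degree a = 2 * i" "total_degree b = 2 * j" by (auto elim!: evenE)
    have "mcoeff (f \<odot> g) ?m = (\<Sum>k\<le>total_degree ?m. \<Sum>l\<le>total_degree ?m.
        if l = j then if k = i then of_nat ((i + j) choose i) * (mcoeff f a * mcoeff g b) else 0 else 0)"
      unfolding eq using ij by (intro sum.cong refl) auto
    also have "\<dots> = of_nat ((i + j) choose i) * (mcoeff f a * mcoeff g b)"
      by (simp add: total_degree_add ij)
    finally have "mcoeff (f \<odot> g) ?m = of_nat ((i + j) choose i) * (mcoeff f a * mcoeff g b)" .
    moreover have "of_nat ((i + j) choose i) = (fact (i + j) / (fact i * fact j) :: complex)"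
      by (simp add: binomial_fact)
    moreover have "total_degree ?m div 2 = i + j" by (simp add: total_degree_add ij)
    ultimately show ?thesis by (simp add: ncoeff_def ij)
  qed
qed

lemma pair_monomial_simps [simp]:
  "pair_monomial [] [] = 0"
  "pair_monomial ((x, y) # xys) ((k, l) # kls) = single x k + single y l + pair_monomial xys kls"
  by (simp_all add: pair_monomial_def)

abbreviation pair_vars :: "('v \<times> 'v) list \<Rightarrow> 'v set" where
  "pair_vars xys \<equiv> fst ` set xys \<union> snd ` set xys"

lemma pair_monomial_keys_degree:
  assumes "length kls = length xys"
  shows "keys (pair_monomial xys kls) \<subseteq> pair_vars xys"
    and "total_degree (pair_monomial xys kls) = sum_list (map fst kls) + sum_list (map snd kls)"
proof -
  have "keys (pair_monomial xys kls) \<subseteq> pair_vars xys \<and>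
      total_degree (pair_monomial xys kls) = sum_list (map fst kls) + sum_list (map snd kls)"
    using assms
  proof (induction kls xys rule: list_induct2)
    case (Cons kl kls xy xys)
    then show ?case
      by (cases kl; cases xy) (auto simp: keys_add_nat total_degree_add split: if_splits)
  qed simp
  then show "keys (pair_monomial xys kls) \<subseteq> pair_vars xys"
    and "total_degree (pair_monomial xys kls) = sum_list (map fst kls) + sum_list (map snd kls)" by auto
qed

text \<open>For distinct variables a monomial determines its exponents, so that the coefficients of \<open>DT_F\<close> are
  single numbers \<open>N\<close>.\<close>

lemma pair_monomial_inj:
  assumes "distinct (map fst xys @ map snd xys)"
    and "length kls = length xys" and "length kls' = length xys"
    and "pair_monomial xys kls = pair_monomial xys kls'"
  shows "kls = kls'"
  using assms
proof (induction xys arbitrary: kls kls')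
  case (Cons xy xys)
  obtain x y where xy: "xy = (x, y)" by force
  obtain k l ks where kls: "kls = (k, l) # ks" using Cons.prems(2) by (cases kls) auto
  obtain k' l' ks' where kls': "kls' = (k', l') # ks'" using Cons.prems(3) by (cases kls') auto
  have len: "length ks = length xys" "length ks' = length xys" using Cons.prems kls kls' by auto
  have xnew: "x \<noteq> y" "x \<notin> pair_vars xys" "y \<notin> pair_vars xys" using Cons.prems(1) by (auto simp: xy)
  then have zero: "lookup (pair_monomial xys ks) v = 0" "lookup (pair_monomial xys ks') v = 0" if "v \<in> {x, y}" for v
    using pair_monomial_keys_degree(1)[OF len(1)] pair_monomial_keys_degree(1)[OF len(2)] that
    by (metis in_keys_iff insertE singletonD subsetD)+
  have eq: "single x k + single y l + pair_monomial xys ks = single x k' + single y l' + pair_monomial xys ks'"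
    using Cons.prems(4) by (simp add: xy kls kls')
  have "k = k'" using arg_cong[OF eq, of "\<lambda>m. lookup m x"] xnew zero[of x]
    by (simp add: lookup_add lookup_single when_def)
  moreover have "l = l'" using arg_cong[OF eq, of "\<lambda>m. lookup m y"] xnew zero[of y]
    by (simp add: lookup_add lookup_single when_def)
  ultimately have "pair_monomial xys ks = pair_monomial xys ks'" using eq by simp
  then have "ks = ks'" using Cons.IH[OF _ len] Cons.prems(1) by (auto simp: xy)
  then show ?case using \<open>k = k'\<close> \<open>l = l'\<close> by (simp add: kls kls')
qed simp

lemma mcoeff_DT_F:
  assumes "distinct (map fst xys @ map snd xys)" and "length kls = length xys"
  shows "mcoeff (DT_F T \<tau> xys) (pair_monomial xys kls) = DT_N T \<tau> kls"
proof -
  have "{kls'. length kls' = length xys \<and> pair_monomial xys kls' = pair_monomial xys kls} = {kls}"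
    using pair_monomial_inj[OF assms(1) _ assms(2)] assms(2) by auto
  then show ?thesis by (simp add: DT_F_def)
qed

lemma supported_DT_F: "supported (pair_vars xys) (DT_F T \<tau> xys)"
  unfolding supported_def
proof (intro allI impI)
  fix m assume nz: "mcoeff (DT_F T \<tau> xys) m \<noteq> 0"
  have "\<exists>kls. length kls = length xys \<and> pair_monomial xys kls = m \<and> DT_N T \<tau> kls \<noteq> 0"
  proof (rule ccontr)
    assume "\<not> ?thesis"
    then have "mcoeff (DT_F T \<tau> xys) m = 0"
      unfolding DT_F_def mcoeff_Mfps by (intro sum.neutral) auto
    with nz show False by simp
  qed
  then obtain kls where kls: "length kls = length xys" "pair_monomial xys kls = m" "DT_N T \<tau> kls \<noteq> 0" by blast
  then have "sum_list (map fst kls) = sum_list (map snd kls)"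
    by (auto simp: DT_N_def Let_def split: if_splits)
  then show "keys m \<subseteq> pair_vars xys \<and> even (total_degree m)"
    using pair_monomial_keys_degree[OF kls(1)] kls(2) by auto
qed

section \<open>The generating functions\<close>

lemma length_eq_count_letters: "length p = count_list p Plain + count_list p Star"
proof (induction p)
  case (Cons c p)
  then show ?case by (cases c) auto
qed simp

lemma op_word_append: "op_word (p @ q) T = op_word p T \<circ> op_word q T"
  by (induction p) (simp_all add: op_word_def comp_assoc)

lemma op_word_replicate:
  "op_word (replicate k Star) T = adjoint T ^^ k" "op_word (replicate k Plain) T = T ^^ k"
  by (induction k) (simp_all add: op_word_def)

lemma op_word_swap_pair_word:
  "op_word (map swap_letter (pair_word kls)) T = foldr (\<lambda>(k, l) A. (adjoint T ^^ k) \<circ> (T ^^ l) \<circ> A) kls id"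
proof (induction kls)
  case Nil
  show ?case by (simp add: op_word_def)
next
  case (Cons kl kls)
  obtain k l where kl: "kl = (k, l)" by force
  show ?case
    using Cons by (simp add: kl op_word_append op_word_replicate comp_assoc map_replicate_const[symmetric] del: map_replicate_const)
qed

text \<open>The blocks of a stretch after regrouping: its falling letters are paired with the rising letters of
  the following block, as in the variables \<open>(w, z)\<close> of the inner factors of the theorem.\<close>

fun zigzag :: "nat \<Rightarrow> (nat \<times> nat) list \<Rightarrow> nat \<Rightarrow> (nat \<times> nat) list" where
  "zigzag l [] k = [(l, k)]"
| "zigzag l ((k', l') # zs) k = (l, k') # zigzag l' zs k"

text \<open>Regrouping the letters requires an exchange of the two kinds of letters, since in \<open>pair_word\<close> the
  rising letters come first.\<close>

lemma swap_pair_word_zigzag: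
  "map swap_letter (pair_word (zigzag l zs k)) = replicate l Star @ pair_word zs @ replicate k Plain"
  by (induction l zs k rule: zigzag.induct) simp_all

lemma zigzag_upt:
  assumes "a < b"
  shows "zigzag (L a) (map (\<lambda>t. (K t, L t)) [Suc a..<b]) (K b) = map (\<lambda>t. (L t, K (Suc t))) [a..<b]"
proof -
  obtain b' where b: "b = Suc b'" using assms by (cases b) auto
  have "a \<le> b'" using assms b by simp
  then show ?thesis
    unfolding b
  proof (induction a rule: inc_induct)
    case base
    show ?case by simp
  next
    case (step a)
    have "[Suc a..<Suc b'] = Suc a # [Suc (Suc a)..<Suc b']" "[a..<Suc b'] = a # [Suc a..<Suc b']"
      using step.hyps by (simp_all add: upt_rec)
    then show ?case using step.IH by simp
  qed
qed

lemma pair_monomial_append: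
  assumes "length xs = length ks"
  shows "pair_monomial (xs @ ys) (ks @ ls) = pair_monomial xs ks + pair_monomial ys ls"
  using assms by (simp add: pair_monomial_def)

lemma lookup_ZW_monomial:
  assumes "distinct ts"
  shows "lookup (pair_monomial (map (\<lambda>t. (Z t, W t)) ts) (map (\<lambda>t. (K t, L t)) ts)) (Z s) = (if s \<in> set ts then K s else 0)"
    and "lookup (pair_monomial (map (\<lambda>t. (Z t, W t)) ts) (map (\<lambda>t. (K t, L t)) ts)) (W s) = (if s \<in> set ts then L s else 0)"
  using assms by (induction ts) (auto simp: lookup_add lookup_single when_def)

abbreviation segment_vars :: "nat \<Rightarrow> nat \<Rightarrow> (var \<times> var) list" where
  "segment_vars a b \<equiv> map (\<lambda>t. (W t, Z (t + 1))) [a..<b]"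

abbreviation outer_vars :: "nat \<Rightarrow> nat \<Rightarrow> nat \<Rightarrow> (var \<times> var) list" where
  "outer_vars n f a \<equiv> map (\<lambda>t. (Z t, W t)) [1..<f] @ [(Z f, W a)] @ map (\<lambda>t. (Z t, W t)) [a + 1..<n + 1]"

text \<open>The parts of the monomial with exponents \<open>K\<close> for \<open>z\<close> and \<open>L\<close> for \<open>w\<close> that belong to the variables of
  an inner factor and of the outer factor.\<close>

definition segment_monomial :: "(nat \<Rightarrow> nat) \<Rightarrow> (nat \<Rightarrow> nat) \<Rightarrow> nat \<Rightarrow> nat \<Rightarrow> (var \<Rightarrow>\<^sub>0 nat)" where
  "segment_monomial K L a b = pair_monomial (segment_vars a b) (map (\<lambda>t. (L t, K (Suc t))) [a..<b])"

definition outer_monomial :: "nat \<Rightarrow> (nat \<Rightarrow> nat) \<Rightarrow> (nat \<Rightarrow> nat) \<Rightarrow> nat \<Rightarrow> nat \<Rightarrow> (var \<Rightarrow>\<^sub>0 nat)" where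
  "outer_monomial n K L f a = pair_monomial (outer_vars n f a)
     (map (\<lambda>t. (K t, L t)) [1..<f] @ [(K f, L a)] @ map (\<lambda>t. (K t, L t)) [a + 1..<n + 1])"

lemma lookup_segment_monomial:
  "lookup (segment_monomial K L a b) (W s) = (if a \<le> s \<and> s < b then L s else 0)"
  "lookup (segment_monomial K L a b) (Z s) = (if a < s \<and> s \<le> b then K s else 0)"
proof -
  have *: "lookup (pair_monomial (map (\<lambda>t. (W t, Z (t + 1))) ts) (map (\<lambda>t. (L t, K (Suc t))) ts)) (W s) =
      (if s \<in> set ts then L s else 0)"
    "lookup (pair_monomial (map (\<lambda>t. (W t, Z (t + 1))) ts) (map (\<lambda>t. (L t, K (Suc t))) ts)) (Z s) =
      (if s \<in> Suc ` set ts then K s else 0)" if "distinct ts" for ts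
    using that by (induction ts) (auto simp: lookup_add lookup_single when_def)
  show "lookup (segment_monomial K L a b) (W s) = (if a \<le> s \<and> s < b then L s else 0)"
    using *(1)[of "[a..<b]"] by (simp add: segment_monomial_def)
  have "s \<in> Suc ` {a..<b} \<longleftrightarrow> a < s \<and> s \<le> b"
    by (cases s) auto
  then show "lookup (segment_monomial K L a b) (Z s) = (if a < s \<and> s \<le> b then K s else 0)"
    using *(2)[of "[a..<b]"] by (simp add: segment_monomial_def)
qed

lemma lookup_outer_monomial:
  assumes "f \<le> a"
  shows "lookup (outer_monomial n K L f a) (W s) = (if 1 \<le> s \<and> s < f \<or> s = a \<or> a < s \<and> s \<le> n then L s else 0)"
    and "lookup (outer_monomial n K L f a) (Z s) = (if 1 \<le> s \<and> s < f \<or> s = f \<or> a < s \<and> s \<le> n then K s else 0)"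
  using assms
  by (auto simp: outer_monomial_def pair_monomial_append lookup_add lookup_ZW_monomial lookup_single when_def
      simp del: upt_Suc)

lemma segment_monomial_append:
  assumes "a \<le> b" and "b \<le> e"
  shows "segment_monomial K L a e = segment_monomial K L a b + segment_monomial K L b e"
proof -
  have "[a..<e] = [a..<b] @ [b..<e]" using assms by (metis le_Suc_ex upt_add_eq_append)
  then show ?thesis by (simp add: segment_monomial_def pair_monomial_append)
qed

lemma distinct_segment_vars: "distinct (map fst (segment_vars a b) @ map snd (segment_vars a b))"
  by (auto simp: distinct_map inj_on_def comp_def)

lemma distinct_outer_vars:
  "f \<le> a \<Longrightarrow> distinct (map fst (outer_vars n f a) @ map snd (outer_vars n f a))"
  by (auto simp: distinct_map inj_on_def comp_def simp del: upt_Suc)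

lemma pair_vars_segment: "pair_vars (segment_vars a b) = W ` {a..<b} \<union> Z ` {a<..b}"
proof -
  have "Suc ` {a..<b} = {a<..b}" by (auto simp: image_iff intro!: bexI[of _ "_ - 1"])
  then have "Z ` {a<..b} = (\<lambda>t. Z (t + 1)) ` {a..<b}" by (simp flip: image_image)
  then show ?thesis by (auto simp: image_image)
qed

lemma pair_vars_outer:
  "1 \<le> f \<Longrightarrow> a \<le> n \<Longrightarrow>
    pair_vars (outer_vars n f a) = Z ` ({1..f} \<union> {a<..n}) \<union> W ` ({1..<f} \<union> {a..n})"
proof -
  assume "1 \<le> f" "a \<le> n"
  then have "{1..f} = insert f {1..<f}" "{a<..n} = {a + 1..<n + 1}" "{a..n} = insert a {a + 1..<n + 1}"
    by auto
  then show ?thesis by (auto simp: image_Un image_image simp del: upt_Suc)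
qed

lemma supported_times_F_tilde:
  assumes "x \<in> pair_vars xys" and "y \<in> pair_vars xys"
  shows "supported (pair_vars xys) (times_F_tilde T \<tau> x y xys)"
  using supported_DT_F[of xys T \<tau>] supported_mvar_mult2[OF supported_DT_F[of xys T \<tau>] assms]
  by (simp add: times_F_tilde_def)

definition vars_upto :: "nat \<Rightarrow> var set" where
  "vars_upto n = Z ` {1..n} \<union> W ` {1..n}"

lemma lookup_outside_vars_upto:
  assumes "keys m \<subseteq> vars_upto n" and "s = 0 \<or> s > n"
  shows "lookup m (Z s) = 0" and "lookup m (W s) = 0"
proof -
  have "Z s \<notin> vars_upto n" "W s \<notin> vars_upto n" using assms(2) by (auto simp: vars_upto_def)
  then have "Z s \<notin> keys m" "W s \<notin> keys m" using assms(1) by blast+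
  then show "lookup m (Z s) = 0" and "lookup m (W s) = 0" by (simp_all add: in_keys_iff)
qed

lemma pair_monomial_lookups:
  assumes "keys m \<subseteq> vars_upto n"
  shows "pair_monomial (map (\<lambda>i. (Z i, W i)) [1..<n + 1]) (map (\<lambda>t. (lookup m (Z t), lookup m (W t))) [1..<n + 1]) = m"
    (is "?p = m")
proof (rule poly_mapping_eqI)
  fix v
  have "s \<in> set [1..<n + 1] \<longleftrightarrow> \<not> (s = 0 \<or> s > n)" for s by auto
  then show "lookup ?p v = lookup m v"
    using lookup_ZW_monomial[of "[1..<n + 1]" "\<lambda>t. lookup m (Z t)" "\<lambda>t. lookup m (W t)"]
      lookup_outside_vars_upto[OF assms]
    by (cases v) (simp_all del: upt_Suc set_upt)
qed

lemma outer_segment_monomial_lookups: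
  assumes "keys m \<subseteq> vars_upto n" and "1 \<le> f" and "f \<le> a" and "a \<le> n"
  defines "K \<equiv> \<lambda>t. lookup m (Z t)" and "L \<equiv> \<lambda>t. lookup m (W t)"
  shows "outer_monomial n K L f a + segment_monomial K L f a = m"
proof (rule poly_mapping_eqI)
  fix v
  show "lookup (outer_monomial n K L f a + segment_monomial K L f a) v = lookup m v"
  proof (cases v)
    case (Z s)
    show ?thesis
      using assms(2-4) lookup_outside_vars_upto[OF assms(1), of s]
      unfolding Z lookup_add lookup_outer_monomial[OF assms(3)] lookup_segment_monomial K_def L_def by auto
  next
    case (W s)
    show ?thesis
      using assms(2-4) lookup_outside_vars_upto[OF assms(1), of s]
      unfolding W lookup_add lookup_outer_monomial[OF assms(3)] lookup_segment_monomial K_def L_def by auto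
  qed
qed

definition segment_series ::
    "('h::real_inner \<Rightarrow> 'h) \<Rightarrow> (('h \<Rightarrow> 'h) \<Rightarrow> complex) \<Rightarrow> nat \<times> nat \<Rightarrow> (var, complex) mfps" where
  "segment_series T \<tau> = (\<lambda>(a, b). times_F_tilde T \<tau> (W a) (Z b) (segment_vars a b))"

definition outer_series ::
    "('h::real_inner \<Rightarrow> 'h) \<Rightarrow> (('h \<Rightarrow> 'h) \<Rightarrow> complex) \<Rightarrow> nat \<Rightarrow> nat \<Rightarrow> nat \<Rightarrow> (var, complex) mfps" where
  "outer_series T \<tau> n f a = times_F_tilde T \<tau> (Z f) (W a) (outer_vars n f a)"

definition visit_series ::
    "('h::real_inner \<Rightarrow> 'h) \<Rightarrow> (('h \<Rightarrow> 'h) \<Rightarrow> complex) \<Rightarrow> nat \<Rightarrow> nat list \<Rightarrow> (var, complex) mfps" where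
  "visit_series T \<tau> n js = outer_series T \<tau> n (hd js) (last js) \<odot>
     odot_list (map (segment_series T \<tau>) (zip js (tl js)))"

context
  fixes scaleC :: "complex \<Rightarrow> 'h::{real_inner,complete_space} \<Rightarrow> 'h"
    and T :: "'h \<Rightarrow> 'h"
    and \<tau> :: "('h \<Rightarrow> 'h) \<Rightarrow> complex"
  assumes DT: "quasinilpotent_DT scaleC T \<tau>"
begin

definition star_moment :: "star_word \<Rightarrow> complex" where
  "star_moment p = \<tau> (op_word p T)"

lemma expected_trace_limit: "expected_trace p \<longlonglongrightarrow> star_moment p"
  unfolding star_moment_def by (rule quasinilpotent_DT.moments[OF DT])

text \<open>Multiplying \<open>T\<close> by a phase preserves the model; in terms of monomials, no entry can be left without
  its conjugate.\<close>

lemma star_moment_unbalanced: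
  assumes "count_list p Plain \<noteq> count_list p Star"
  shows "star_moment p = 0"
proof -
  have "\<forall>\<^sub>F d in sequentially. expected_trace p d = 0"
    using eventually_gt_at_top[of 0]
    by eventually_elim (simp add: expected_trace_eq expectation_walk_trace_unbalanced[OF assms])
  then have "expected_trace p \<longlonglongrightarrow> 0" by (rule tendsto_eventually)
  then show ?thesis using expected_trace_limit LIMSEQ_unique by blast
qed

text \<open>Rescaling the entries to variance \<open>1\<close> replaces the normalization \<open>1 / d\<close> of the trace by the power
  of \<open>d\<close> which is natural for the induction.\<close>

lemma star_moment_limit: "(\<lambda>d. expectation (walk_trace gen d p) / of_nat d ^ Suc (plains p)) \<longlonglongrightarrow> star_moment p"
proof (cases "count_list p Plain = count_list p Star")
  case True
  then have len: "length p = 2 * plains p" by (simp add: length_eq_count_letters)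
  have "\<forall>\<^sub>F d in sequentially. expected_trace p d = expectation (walk_trace gen d p) / of_nat d ^ Suc (plains p)"
    using eventually_gt_at_top[of 0]
  proof eventually_elim
    case (elim d)
    have "complex_of_real (sqrt (1 / d)) ^ 2 = 1 / of_nat d"
      by (simp flip: of_real_power)
    then have "complex_of_real (sqrt (1 / d)) ^ length p = 1 / of_nat d ^ plains p"
      unfolding len power_mult by (simp add: power_divide)
    then show ?case using elim by (simp add: expected_trace_eq)
  qed
  then show ?thesis by (rule Lim_transform_eventually[OF expected_trace_limit])
next
  case False
  then show ?thesis by (simp add: expectation_walk_trace_unbalanced star_moment_unbalanced)
qed

lemma star_moment_cong:
  assumes "length p = length q"
    and "\<And>d. expectation (walk_trace gen d p) = expectation (walk_trace gen d q)"
  shows "star_moment p = star_moment q"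
proof -
  have "\<forall>\<^sub>F d in sequentially. expected_trace p d = expected_trace q d"
    using eventually_gt_at_top[of 0] by eventually_elim (simp add: expected_trace_eq assms)
  then have "expected_trace q \<longlonglongrightarrow> star_moment p" by (rule Lim_transform_eventually[OF expected_trace_limit])
  then show ?thesis using expected_trace_limit LIMSEQ_unique by blast
qed

lemma star_moment_swap: "star_moment (map swap_letter p) = star_moment p"
  by (rule star_moment_cong) (auto simp: expectation_walk_trace_swap)

lemma star_moment_commute: "star_moment (p @ q) = star_moment (q @ p)"
  by (rule star_moment_cong) (auto simp: walk_trace_commute[of gen _ p q])

abbreviation snd_sum :: "(nat \<times> nat) list \<Rightarrow> nat" where
  "snd_sum kls \<equiv> sum_list (map snd kls)"

lemma stars_pair_word: "count_list (pair_word kls) Star = snd_sum kls"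
  by (induction kls) (auto simp: count_list_replicate)

lemma star_moment_pair_word_unbalanced: "fst_sum kls \<noteq> snd_sum kls \<Longrightarrow> star_moment (pair_word kls) = 0"
  by (rule star_moment_unbalanced) (simp add: plains_pair_word stars_pair_word)

text \<open>Both the exchange of \<open>T\<close> with \<open>T\<^sup>*\<close> and the vanishing of unbalanced moments enter: the right side
  has its rising letters first and makes no case distinction.\<close>

lemma DT_N_eq: "DT_N T \<tau> kls = fact (Suc (fst_sum kls)) * star_moment (pair_word kls)"
proof (cases "fst_sum kls = snd_sum kls")
  case True
  have "\<tau> (foldr (\<lambda>(k, l) A. (adjoint T ^^ k) \<circ> (T ^^ l) \<circ> A) kls id) = star_moment (map swap_letter (pair_word kls))"
    by (simp only: op_word_swap_pair_word star_moment_def)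
  then show ?thesis using True by (simp add: DT_N_def Let_def star_moment_swap)
next
  case False
  then show ?thesis by (simp add: DT_N_def Let_def star_moment_pair_word_unbalanced)
qed

abbreviation weight :: "nat \<Rightarrow> (nat \<times> nat) list \<Rightarrow> nat \<Rightarrow> complex" where
  "weight \<equiv> excursion_weight star_moment"

lemma star_moment_recursion:
  "kls \<noteq> [] \<Longrightarrow> of_nat (Suc (fst_sum kls)) * star_moment (pair_word kls) = visits weight [] kls"
  by (rule moment_recursion[OF star_moment_limit])

text \<open>The normalization turns \<open>(m + 1)! c\<close> into \<open>(m + 1) c\<close>, the left side of the recursion.\<close>

lemma ncoeff_DT_F_visits:
  assumes "distinct (map fst xys @ map snd xys)" and "length kls = length xys" and "kls \<noteq> []"
  shows "ncoeff (DT_F T \<tau> xys) (pair_monomial xys kls) = visits weight [] kls"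
proof (cases "fst_sum kls = snd_sum kls")
  case True
  then have "total_degree (pair_monomial xys kls) div 2 = fst_sum kls"
    by (simp add: pair_monomial_keys_degree(2)[OF assms(2)])
  then show ?thesis
    using assms by (simp add: ncoeff_def mcoeff_DT_F DT_N_eq star_moment_recursion[symmetric])
next
  case False
  then show ?thesis
    using assms star_moment_pair_word_unbalanced[OF False] star_moment_recursion[OF assms(3)]
    by (simp add: ncoeff_def mcoeff_DT_F DT_N_eq)
qed

text \<open>For a stretch without blocks in between, the moment vanishes unless \<open>l = k\<close>.\<close>

lemma weight_single_commute: "weight l [] k = weight k [] l"
proof (cases "l = k")
  case False
  then have "star_moment (replicate (l - 1) Star @ replicate (k - 1) Plain) = 0"
    "star_moment (replicate (k - 1) Star @ replicate (l - 1) Plain) = 0" if "l \<noteq> 0" "k \<noteq> 0"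
    using that by (auto intro!: star_moment_unbalanced simp: count_list_replicate)
  then show ?thesis using False by (auto simp: excursion_weight_def)
qed simp

text \<open>For a single pair of variables the recursion has one term, which explains why \<open>F\<^sub>1\<close> itself takes the
  place of the product of \<open>x y F\<close>: its constant term is the empty stretch.\<close>

lemma ncoeff_DT_F_single:
  assumes "x \<noteq> y"
  shows "ncoeff (DT_F T \<tau> [(x, y)]) (pair_monomial [(x, y)] [(k, l)]) = weight l [] k"
  using ncoeff_DT_F_visits[of "[(x, y)]" "[(k, l)]"] assms by simp

text \<open>The factor \<open>x y\<close> raises half the degree by one, so that the normalization is exactly the factorial
  in \<open>N = (m + 1)! c\<close>.\<close>

lemma ncoeff_mvars_DT_F:
  assumes "distinct (map fst xys @ map snd xys)" and "length kls' = length xys"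
    and "m = single x 1 + (single y 1 + pair_monomial xys kls')"
  shows "ncoeff (mvar x * mvar y * DT_F T \<tau> xys) m = star_moment (pair_word kls')"
proof -
  have "mcoeff (mvar x * mvar y * DT_F T \<tau> xys) m = fact (Suc (fst_sum kls')) * star_moment (pair_word kls')"
    unfolding assms(3) mult.assoc mcoeff_mvar_mult_add mcoeff_DT_F[OF assms(1,2)] DT_N_eq ..
  moreover have deg: "total_degree m = fst_sum kls' + snd_sum kls' + 2"
    by (simp add: assms(3) total_degree_add pair_monomial_keys_degree(2)[OF assms(2)])
  ultimately show ?thesis
  proof (cases "fst_sum kls' = snd_sum kls'")
    case True
    then have "total_degree m div 2 = Suc (fst_sum kls')" by (simp add: deg)
    with \<open>mcoeff _ m = _\<close> show ?thesis by (simp add: ncoeff_def del: fact_Suc)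
  qed (simp add: ncoeff_def star_moment_pair_word_unbalanced)
qed

lemma ncoeff_mvars_0:
  assumes "lookup m x = 0 \<or> lookup m y = 0"
  shows "ncoeff (mvar x * mvar y * f) m = 0"
  using assms mcoeff_mvar_mult_0[of m x "mvar y * f"] mcoeff_mvar_mult_0[of m y "mvar x * f"]
  by (auto simp: ncoeff_def ac_simps)

text \<open>A stretch needs a falling letter at its start and a rising letter at its end; these are the two
  variables multiplied to \<open>F\<close>.\<close>

lemma ncoeff_segment:
  assumes "a < b"
  shows "ncoeff (times_F_tilde T \<tau> (W a) (Z b) (segment_vars a b)) (segment_monomial K L a b) =
    inner_weight weight K L a b"
proof (cases "b = Suc a")
  case True
  then show ?thesis
    using ncoeff_DT_F_single[of "W a" "Z (Suc a)" "L a" "K (Suc a)"]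
    by (simp add: times_F_tilde_def segment_monomial_def inner_weight_def weight_single_commute)
next
  case False
  then have len: "length (segment_vars a b) \<noteq> 1" using assms by simp
  have ne: "[Suc a..<b] \<noteq> []" using assms False by simp
  show ?thesis
  proof (cases "L a \<noteq> 0 \<and> K b \<noteq> 0")
    case True
    define K' where "K' = K(b := K b - 1)"
    define L' where "L' = L(a := L a - 1)"
    let ?kls = "map (\<lambda>t. (L' t, K' (Suc t))) [a..<b]"
    have mono: "segment_monomial K L a b = single (W a) 1 + (single (Z b) 1 + segment_monomial K' L' a b)"
    proof (rule poly_mapping_eqI)
      fix v
      show "lookup (segment_monomial K L a b) v =
          lookup (single (W a) 1 + (single (Z b) 1 + segment_monomial K' L' a b)) v"
        using True assms
        by (cases v) (auto simp: lookup_segment_monomial lookup_add lookup_single when_def K'_def L'_def)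
    qed
    have "ncoeff (mvar (W a) * mvar (Z b) * DT_F T \<tau> (segment_vars a b)) (segment_monomial K L a b) =
        star_moment (pair_word ?kls)"
      by (rule ncoeff_mvars_DT_F[OF distinct_segment_vars]) (use mono in \<open>simp_all add: segment_monomial_def\<close>)
    also have "?kls = zigzag (L' a) (map (\<lambda>t. (K' t, L' t)) [Suc a..<b]) (K' b)"
      using zigzag_upt[OF assms, of L' K'] by simp
    also have "map (\<lambda>t. (K' t, L' t)) [Suc a..<b] = map (\<lambda>t. (K t, L t)) [Suc a..<b]"
      by (rule map_cong) (auto simp: K'_def L'_def)
    also have "star_moment (pair_word (zigzag (L' a) \<dots> (K' b))) =
        star_moment (replicate (L' a) Star @ pair_word (map (\<lambda>t. (K t, L t)) [Suc a..<b]) @ replicate (K' b) Plain)"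
      by (simp only: star_moment_swap[symmetric, of "pair_word (zigzag _ _ _)"] swap_pair_word_zigzag)
    also have "\<dots> = inner_weight weight K L a b"
      using True ne by (simp add: inner_weight_def excursion_weight_def K'_def L'_def)
    finally show ?thesis using len by (simp add: times_F_tilde_def)
  next
    case False
    then have "lookup (segment_monomial K L a b) (W a) = 0 \<or> lookup (segment_monomial K L a b) (Z b) = 0"
      using assms by (auto simp: lookup_segment_monomial)
    then have "ncoeff (mvar (W a) * mvar (Z b) * DT_F T \<tau> (segment_vars a b)) (segment_monomial K L a b) = 0"
      by (rule ncoeff_mvars_0)
    then show ?thesis
      using False ne len by (auto simp: times_F_tilde_def inner_weight_def excursion_weight_def)
  qed
qed

text \<open>The outer stretch runs around the end of the cyclic word, and \<open>star_moment_commute\<close> brings its two parts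
  into the order of the variables.\<close>

lemma ncoeff_outer:
  assumes "1 \<le> f" and "f \<le> a" and "a \<le> n"
  shows "ncoeff (times_F_tilde T \<tau> (Z f) (W a) (outer_vars n f a)) (outer_monomial n K L f a) =
    outer_weight weight K L n f a"
proof (cases "f = 1 \<and> a = n")
  case True
  then show ?thesis
    using ncoeff_DT_F_single[of "Z 1" "W n" "K 1" "L n"]
    by (simp add: times_F_tilde_def outer_monomial_def outer_weight_def)
next
  case False
  let ?pr = "\<lambda>t. (K t, L t)"
  let ?pre = "map ?pr [1..<f]" and ?post = "map ?pr [Suc a..<Suc n]"
  have "Suc a < f + n" using assms False by (cases "f = 1") auto
  then have len: "length (outer_vars n f a) \<noteq> 1" using assms by simp
  have ne: "?post @ ?pre \<noteq> []"
    using assms False by (auto simp del: upt_Suc)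
  show ?thesis
  proof (cases "L a \<noteq> 0 \<and> K f \<noteq> 0")
    case True
    let ?kls = "?pre @ [(K f - 1, L a - 1)] @ ?post"
    have single: "single v k = single v 1 + single v (k - 1)" if "k \<noteq> 0" for v :: var and k :: nat
      using that by (simp flip: single_add)
    have "single (Z f) (K f) + single (W a) (L a) =
        single (Z f) 1 + (single (W a) 1 + (single (Z f) (K f - 1) + single (W a) (L a - 1)))"
      using single[of "K f" "Z f"] single[of "L a" "W a"] True by (metis (no_types) add.assoc add.left_commute)
    then have mono: "outer_monomial n K L f a = single (Z f) 1 + (single (W a) 1 + pair_monomial (outer_vars n f a) ?kls)"
      by (simp add: outer_monomial_def pair_monomial_append ac_simps del: upt_Suc)
    have "ncoeff (mvar (Z f) * mvar (W a) * DT_F T \<tau> (outer_vars n f a)) (outer_monomial n K L f a) =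
        star_moment (pair_word ?kls)"
      by (rule ncoeff_mvars_DT_F[OF distinct_outer_vars[OF assms(2)] _ mono]) simp
    also have "pair_word ?kls = (pair_word ?pre @ replicate (K f - 1) Plain) @ (replicate (L a - 1) Star @ pair_word ?post)"
      by (simp del: upt_Suc)
    also have "star_moment \<dots> = star_moment ((replicate (L a - 1) Star @ pair_word ?post) @ (pair_word ?pre @ replicate (K f - 1) Plain))"
      by (rule star_moment_commute)
    also have "\<dots> = outer_weight weight K L n f a"
      using True ne by (simp add: outer_weight_def excursion_weight_def del: upt_Suc)
    finally show ?thesis using len by (simp only: times_F_tilde_def if_False)
  next
    case False
    then have "lookup (outer_monomial n K L f a) (Z f) = 0 \<or> lookup (outer_monomial n K L f a) (W a) = 0"
      using assms by (auto simp: lookup_outer_monomial)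
    then have "ncoeff (mvar (Z f) * mvar (W a) * DT_F T \<tau> (outer_vars n f a)) (outer_monomial n K L f a) = 0"
      by (rule ncoeff_mvars_0)
    then show ?thesis
      using False ne len by (auto simp: times_F_tilde_def outer_weight_def excursion_weight_def simp del: upt_Suc)
  qed
qed

lemma supported_segment_series:
  assumes "a < b"
  shows "supported (pair_vars (segment_vars a b)) (segment_series T \<tau> (a, b))"
  unfolding segment_series_def prod.case
proof (rule supported_times_F_tilde)
  show "W a \<in> pair_vars (segment_vars a b)" "Z b \<in> pair_vars (segment_vars a b)"
    unfolding pair_vars_segment using assms by auto
qed

lemma supported_outer_series:
  assumes "1 \<le> f" and "a \<le> n"
  shows "supported (pair_vars (outer_vars n f a)) (outer_series T \<tau> n f a)"
  unfolding outer_series_def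
proof (rule supported_times_F_tilde)
  show "Z f \<in> pair_vars (outer_vars n f a)" "W a \<in> pair_vars (outer_vars n f a)"
    unfolding pair_vars_outer[OF assms] using assms by auto
qed

text \<open>Consecutive segments have disjoint variables, and their monomials add up to that of the whole
  range.\<close>

lemma odot_list_segments:
  assumes "sorted_wrt (<) (a # js)"
  shows "supported (pair_vars (segment_vars a (last (a # js)))) (odot_list (map (segment_series T \<tau>) (zip (a # js) js)))"
      (is "?S a js")
    and "ncoeff (odot_list (map (segment_series T \<tau>) (zip (a # js) js))) (segment_monomial K L a (last (a # js))) =
      (\<Prod>(a, b)\<leftarrow>zip (a # js) js. inner_weight weight K L a b)" (is "?N a js")
proof -
  have "?S a js \<and> ?N a js"
    using assms
  proof (induction js arbitrary: a)
    case Nil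
    show ?case
      by (simp add: odot_list_def supported_one ncoeff_def mcoeff_one segment_monomial_def)
  next
    case (Cons b js)
    let ?e = "last (b # js)"
    have ab: "a < b" using Cons.prems by simp
    have be: "b \<le> ?e" using Cons.prems by (cases js rule: rev_cases) auto
    have IH: "?S b js" "?N b js" using Cons.IH[of b] Cons.prems by auto
    have odot: "odot_list (map (segment_series T \<tau>) (zip (a # b # js) (b # js))) =
        segment_series T \<tau> (a, b) \<odot> odot_list (map (segment_series T \<tau>) (zip (b # js) js))"
      by (simp add: odot_list_def)
    have un: "pair_vars (segment_vars a b) \<union> pair_vars (segment_vars b ?e) = pair_vars (segment_vars a ?e)"
    proof -
      have "{a..<?e} = {a..<b} \<union> {b..<?e}" "{a<..?e} = {a<..b} \<union> {b<..?e}" using ab be by auto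
      then show ?thesis unfolding pair_vars_segment by (simp only: image_Un ac_simps Un_ac)
    qed
    have dis: "pair_vars (segment_vars a b) \<inter> pair_vars (segment_vars b ?e) = {}"
      unfolding pair_vars_segment by auto
    have keys: "keys (segment_monomial K L a b) \<subseteq> pair_vars (segment_vars a b)" for a b
      unfolding segment_monomial_def by (rule pair_monomial_keys_degree(1)) simp
    have "?S a (b # js)"
      unfolding odot using supported_odot[OF supported_segment_series[OF ab] IH(1)] un by simp
    moreover have "?N a (b # js)"
    proof -
      have "ncoeff (segment_series T \<tau> (a, b) \<odot> odot_list (map (segment_series T \<tau>) (zip (b # js) js)))
          (segment_monomial K L a b + segment_monomial K L b ?e) =
          ncoeff (segment_series T \<tau> (a, b)) (segment_monomial K L a b) *
          ncoeff (odot_list (map (segment_series T \<tau>) (zip (b # js) js))) (segment_monomial K L b ?e)"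
        by (rule ncoeff_odot[OF supported_segment_series[OF ab] IH(1) dis keys keys])
      then show ?thesis
        unfolding odot using IH(2) ncoeff_segment[OF ab, of K L] segment_monomial_append[of a b ?e K L] ab be
        by (simp add: segment_series_def)
    qed
    ultimately show ?case by blast
  qed
  then show "?S a js" and "?N a js" by auto
qed

text \<open>The outer factor and the segments together contain every variable exactly once.\<close>

lemma visit_series_coeff:
  assumes js: "sorted_wrt (<) js" "js \<noteq> []" "set js \<subseteq> {1..n}"
  shows "supported (vars_upto n) (visit_series T \<tau> n js)" (is ?S)
    and "keys m \<subseteq> vars_upto n \<Longrightarrow>
      ncoeff (visit_series T \<tau> n js) m =
        visit_weight weight (\<lambda>t. lookup m (Z t)) (\<lambda>t. lookup m (W t)) n js"
proof -
  obtain f js' where fjs: "js = f # js'" using js(2) by (cases js) auto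
  let ?a = "last js"
  have f: "1 \<le> f" and a: "?a \<le> n" using js fjs last_in_set[OF js(2)] by auto
  have fa: "f \<le> ?a" using js(1) unfolding fjs by (cases js' rule: rev_cases) auto
  have series: "visit_series T \<tau> n js = outer_series T \<tau> n f ?a \<odot> odot_list (map (segment_series T \<tau>) (zip (f # js') js'))"
    by (simp add: visit_series_def fjs)
  have sup: "supported (pair_vars (segment_vars f ?a)) (odot_list (map (segment_series T \<tau>) (zip (f # js') js')))"
    using odot_list_segments(1)[of f js'] js(1) by (simp add: fjs)
  have "pair_vars (outer_vars n f ?a) \<union> pair_vars (segment_vars f ?a) \<subseteq> vars_upto n"
    unfolding pair_vars_outer[OF f a] pair_vars_segment vars_upto_def using f a fa by auto
  then show ?S
    unfolding series using supported_odot[OF supported_outer_series[OF f a] sup] supported_mono by blast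
  assume m: "keys m \<subseteq> vars_upto n"
  let ?K = "\<lambda>t. lookup m (Z t)" and ?L = "\<lambda>t. lookup m (W t)"
  have dis: "pair_vars (outer_vars n f ?a) \<inter> pair_vars (segment_vars f ?a) = {}"
    unfolding pair_vars_outer[OF f a] pair_vars_segment by auto
  have decomp: "outer_monomial n ?K ?L f ?a + segment_monomial ?K ?L f ?a = m"
    by (rule outer_segment_monomial_lookups[OF m f fa a])
  have "ncoeff (visit_series T \<tau> n js) (outer_monomial n ?K ?L f ?a + segment_monomial ?K ?L f ?a) =
      ncoeff (outer_series T \<tau> n f ?a) (outer_monomial n ?K ?L f ?a) *
      ncoeff (odot_list (map (segment_series T \<tau>) (zip (f # js') js'))) (segment_monomial ?K ?L f ?a)"
    unfolding series
  proof (rule ncoeff_odot[OF supported_outer_series[OF f a] sup dis])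
    show "keys (outer_monomial n ?K ?L f ?a) \<subseteq> pair_vars (outer_vars n f ?a)"
      unfolding outer_monomial_def by (rule pair_monomial_keys_degree(1)) simp
    show "keys (segment_monomial ?K ?L f ?a) \<subseteq> pair_vars (segment_vars f ?a)"
      unfolding segment_monomial_def by (rule pair_monomial_keys_degree(1)) simp
  qed
  also have "ncoeff (outer_series T \<tau> n f ?a) (outer_monomial n ?K ?L f ?a) = outer_weight weight ?K ?L n f ?a"
    unfolding outer_series_def by (rule ncoeff_outer[OF f fa a])
  also have "ncoeff (odot_list (map (segment_series T \<tau>) (zip (f # js') js'))) (segment_monomial ?K ?L f ?a) =
      (\<Prod>(a, b)\<leftarrow>zip (f # js') js'. inner_weight weight ?K ?L a b)"
    using odot_list_segments(2)[of f js' ?K ?L] js(1) by (simp add: fjs)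
  finally show "ncoeff (visit_series T \<tau> n js) m = visit_weight weight ?K ?L n js"
    unfolding decomp by (simp add: visit_weight_def fjs)
qed

lemma ncoeff_sum: "ncoeff (\<Sum>i\<in>I. f i) m = (\<Sum>i\<in>I. ncoeff (f i) m)"
  by (simp add: ncoeff_def mcoeff_sum sum_divide_distrib)

lemma ncoeff_minus: "ncoeff (f - g) m = ncoeff f m - ncoeff g m"
  by (simp add: ncoeff_def mcoeff_minus diff_divide_distrib)

lemma ncoeff_outside: "supported V f \<Longrightarrow> \<not> keys m \<subseteq> V \<Longrightarrow> ncoeff f m = 0"
  by (auto simp: supported_def ncoeff_def)

text \<open>The recursion for the moments in terms of generating functions. The terms of the sum on the left are the
  outer factors for the sets with a single gap; for \<open>n \<ge> 2\<close> these never fall under the special rule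
  for \<open>F\<^sub>1\<close>.\<close>

lemma generating_function_visits:
  assumes n: "n \<ge> 2"
  shows "DT_F T \<tau> (map (\<lambda>i. (Z i, W i)) [1..<n + 1]) -
      (\<Sum>i=1..n. mvar (Z i) * mvar (W i) * DT_F T \<tau> (map (\<lambda>i. (Z i, W i)) [1..<n + 1])) =
    (\<Sum>J | J \<subseteq> {1..n} \<and> 2 \<le> card J. visit_series T \<tau> n (sorted_list_of_set J))"
proof -
  let ?xys = "map (\<lambda>i. (Z i, W i)) [1..<n + 1]"
  let ?F = "DT_F T \<tau> ?xys"
  have vars: "pair_vars ?xys = vars_upto n"
    by (auto simp: vars_upto_def image_image simp del: upt_Suc)
  have outer: "outer_vars n i i = ?xys" if "i \<in> {1..n}" for i
  proof -
    have "[1..<n + 1] = [1..<i] @ [i] @ [i + 1..<n + 1]"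
      using that upt_add_eq_append[of 1 i "n + 1 - i"] upt_conv_Cons[of i "n + 1"] by simp
    then show ?thesis by (simp del: upt_Suc)
  qed
  have single: "mvar (Z i) * mvar (W i) * ?F = outer_series T \<tau> n i i" if "i \<in> {1..n}" for i
    using outer[OF that] n by (simp add: outer_series_def times_F_tilde_def del: upt_Suc)
  have sorted: "sorted_wrt (<) (sorted_list_of_set J)" "sorted_list_of_set J \<noteq> []" "set (sorted_list_of_set J) \<subseteq> {1..n}"
    if "J \<subseteq> {1..n}" "2 \<le> card J" for J
  proof -
    have fin: "finite J" using that(1) finite_subset by blast
    then show "sorted_wrt (<) (sorted_list_of_set J)" "set (sorted_list_of_set J) \<subseteq> {1..n}"
      using that by auto
    show "sorted_list_of_set J \<noteq> []" using fin that by (auto simp: sorted_list_of_set_eq_Nil_iff)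
  qed
  have "ncoeff (?F - (\<Sum>i=1..n. mvar (Z i) * mvar (W i) * ?F)) m =
      ncoeff (\<Sum>J | J \<subseteq> {1..n} \<and> 2 \<le> card J. visit_series T \<tau> n (sorted_list_of_set J)) m" for m
  proof (cases "keys m \<subseteq> vars_upto n")
    case True
    let ?K = "\<lambda>t. lookup m (Z t)" and ?L = "\<lambda>t. lookup m (W t)"
    let ?kls = "map (\<lambda>t. (?K t, ?L t)) [1..<n + 1]"
    have "ncoeff ?F (pair_monomial ?xys ?kls) = visits weight [] ?kls"
      by (rule ncoeff_DT_F_visits) (use n in \<open>auto simp: distinct_map inj_on_def comp_def simp del: upt_Suc\<close>)
    then have "ncoeff ?F m = visits weight [] ?kls"
      unfolding pair_monomial_lookups[OF True] .
    also have "\<dots> = (\<Sum>a=1..n. \<Sum>J\<in>Pow {Suc a..n}. visit_weight weight ?K ?L n (a # sorted_list_of_set J))"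
      using visits_subsets[of 1 n weight ?K ?L] by simp
    also have "\<dots> = (\<Sum>i=1..n. visit_weight weight ?K ?L n [i]) +
        (\<Sum>J | J \<subseteq> {1..n} \<and> 2 \<le> card J. visit_weight weight ?K ?L n (sorted_list_of_set J))"
      unfolding sum_subsets_Min sum_nonempty_subsets_split ..
    finally have F: "ncoeff ?F m = \<dots>" .
    have "ncoeff (mvar (Z i) * mvar (W i) * ?F) m = visit_weight weight ?K ?L n [i]" if i: "i \<in> {1..n}" for i
    proof -
      have mi: "outer_monomial n ?K ?L i i = m"
        using outer_segment_monomial_lookups[OF True, of i i] i by (simp add: segment_monomial_def)
      have "ncoeff (outer_series T \<tau> n i i) (outer_monomial n ?K ?L i i) = outer_weight weight ?K ?L n i i"
        unfolding outer_series_def by (rule ncoeff_outer) (use i in auto)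
      then have "ncoeff (outer_series T \<tau> n i i) m = outer_weight weight ?K ?L n i i"
        by (simp only: mi)
      then show ?thesis using single[OF i] by (simp add: visit_weight_def)
    qed
    moreover have "ncoeff (visit_series T \<tau> n (sorted_list_of_set J)) m =
        visit_weight weight ?K ?L n (sorted_list_of_set J)" if "J \<subseteq> {1..n}" "2 \<le> card J" for J
      by (rule visit_series_coeff(2)[OF sorted[OF that] True])
    ultimately show ?thesis
      unfolding ncoeff_minus ncoeff_sum F by simp
  next
    case False
    have "supported (vars_upto n) ?F" using supported_DT_F[of ?xys T \<tau>] unfolding vars .
    moreover have "supported (vars_upto n) (mvar (Z i) * mvar (W i) * ?F)" if "i \<in> {1..n}" for i
      by (rule supported_mvar_mult2[OF calculation]) (use that in \<open>auto simp: vars_upto_def\<close>)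
    moreover have "supported (vars_upto n) (visit_series T \<tau> n (sorted_list_of_set J))" if "J \<subseteq> {1..n}" "2 \<le> card J" for J
      by (rule visit_series_coeff(1)[OF sorted[OF that]])
    ultimately show ?thesis
      unfolding ncoeff_minus ncoeff_sum using ncoeff_outside[OF _ False] by simp
  qed
  then show ?thesis by (intro mfps_eqI) (simp add: ncoeff_def)
qed

end

lemma zip_map_tl_upt:
  "zip (map j [1..<Suc r]) (tl (map j [1..<Suc r])) = map (\<lambda>i. (j i, j (i + 1))) [1..<r]"
  by (rule nth_equalityI) (auto simp: nth_tl simp del: upt_Suc)

theorem theorem2p4:
  fixes scaleC :: "complex \<Rightarrow> 'h::{real_inner,complete_space} \<Rightarrow> 'h"
    and T :: "'h \<Rightarrow> 'h"
    and \<tau> :: "('h \<Rightarrow> 'h) \<Rightarrow> complex"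
    and n :: nat
  assumes "quasinilpotent_DT scaleC T \<tau>"
    and "n \<ge> 2"
  shows "(1 - (\<Sum>i=1..n. mvar (Z i) * mvar (W i))) * DT_F T \<tau> (map (\<lambda>i. (Z i, W i)) [1..<n+1]) =
    (\<Sum>r=2..n. \<Sum>j | j \<in> {1..r} \<rightarrow>\<^sub>E {1..n} \<and> strict_mono_on {1..r} j.
       times_F_tilde T \<tau> (Z (j 1)) (W (j r))
         (map (\<lambda>i. (Z i, W i)) [1..<j 1] @ [(Z (j 1), W (j r))] @
          map (\<lambda>i. (Z i, W i)) [j r + 1..<n+1])
       \<odot>
       odot_list (map (\<lambda>i. times_F_tilde T \<tau> (W (j i)) (Z (j (i+1)))
         (map (\<lambda>a. (W a, Z (a+1))) [j i..<j (i+1)])) [1..<r]))"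
proof -
  let ?F = "DT_F T \<tau> (map (\<lambda>i. (Z i, W i)) [1..<n+1])"
  have "(1 - (\<Sum>i=1..n. mvar (Z i) * mvar (W i))) * ?F = ?F - (\<Sum>i=1..n. mvar (Z i) * mvar (W i) * ?F)"
    by (simp add: left_diff_distrib sum_distrib_right del: upt_Suc)
  also have "\<dots> = (\<Sum>J | J \<subseteq> {1..n} \<and> 2 \<le> card J. visit_series T \<tau> n (sorted_list_of_set J))"
    by (rule generating_function_visits[OF assms])
  also have "\<dots> = (\<Sum>r=2..n. \<Sum>j | j \<in> {1..r} \<rightarrow>\<^sub>E {1..n} \<and> strict_mono_on {1..r} j.
      visit_series T \<tau> n (map j [1..<Suc r]))"
    by (rule sum_strict_mono_lists[symmetric])
  also have "\<dots> = (\<Sum>r=2..n. \<Sum>j | j \<in> {1..r} \<rightarrow>\<^sub>E {1..n} \<and> strict_mono_on {1..r} j.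
       times_F_tilde T \<tau> (Z (j 1)) (W (j r))
         (map (\<lambda>i. (Z i, W i)) [1..<j 1] @ [(Z (j 1), W (j r))] @
          map (\<lambda>i. (Z i, W i)) [j r + 1..<n+1])
       \<odot>
       odot_list (map (\<lambda>i. times_F_tilde T \<tau> (W (j i)) (Z (j (i+1)))
         (map (\<lambda>a. (W a, Z (a+1))) [j i..<j (i+1)])) [1..<r]))"
  proof (intro sum.cong refl)
    fix r :: nat and j :: "nat \<Rightarrow> nat"
    assume "r \<in> {2..n}"
    then have ends: "hd (map j [1..<Suc r]) = j 1" "last (map j [1..<Suc r]) = j r"
      by (simp_all add: hd_map last_map)
    show "visit_series T \<tau> n (map j [1..<Suc r]) =
        times_F_tilde T \<tau> (Z (j 1)) (W (j r))
         (map (\<lambda>i. (Z i, W i)) [1..<j 1] @ [(Z (j 1), W (j r))] @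
          map (\<lambda>i. (Z i, W i)) [j r + 1..<n+1])
       \<odot>
       odot_list (map (\<lambda>i. times_F_tilde T \<tau> (W (j i)) (Z (j (i+1)))
         (map (\<lambda>a. (W a, Z (a+1))) [j i..<j (i+1)])) [1..<r])"
      by (simp only: visit_series_def zip_map_tl_upt ends outer_series_def segment_series_def
          map_map comp_def prod.case)
  qed
  finally show ?thesis .
qed

end
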